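(* The theory of the variety $\mathcal V_5$ has a model completion, which is axiomatized (together with the axioms of $\mathcal V_5$) by the density axiom D5 and the splitting axiom S5.
   Context: A co-Heyting algebra is a bounded distributive lattice $(L,\mathbf{0},\mathbf{1},\vee,\wedge)$ with a binary operation $-$ such that $a-b$ is the least $c\in L$ with $a\le b\vee c$, viewed as a structure in the language $\{\mathbf 0,\mathbf 1,\vee,\wedge,-\}$. For $a,b\in L$ write $b\ll a$ iff $a-b=a$ and $b\le a$. $\mathcal V_5$ is the variety of co-Heyting algebras satisfying both $(\mathbf 1-x)\wedge(\mathbf 1-(\mathbf 1-x))=\mathbf 0$ and $\big(((\mathbf 1-x)\wedge x)-y\big)\wedge y=\mathbf 0$. Model completion is in the usual model-theoretic sense. Axiom D5: for every $a$ with $a=\mathbf 1-(\mathbf 1-a)\neq\mathbf 0$ there is $b\ne\mathbf 0$ with $b\ll a$. Axiom S5: for all $a,b_1,b_2$ with $b_1\vee b_2\ll a\ne\mathbf 0$ and $b_1\wedge b_2\wedge(\mathbf 1-(\mathbf 1-a))=\mathbf 0$ there are non-zero $a_1,a_2$ with $a-a_2=a_1\ge b_1$, $a-a_1=a_2\ge b_2$, and $a_1\wedge a_2=b_1\wedge b_2$. *)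

theory Defs
  imports "HOL-Library.Infinite_Typeclass"
begin

section \<open>First-order logic over the language of co-Heyting algebras\<close>

text \<open>
  Terms and formulas in the language with symbols 0, 1, join, meet and difference, and
  with additional constant symbols from \<^typ>\<open>'c\<close>. Variables are named by natural
  numbers. Equality is the only relation symbol. The constants serve to write down diagrams;
  the sentences of the language itself are those without constants.
\<close>

datatype 'c trm =
    V nat
  | Cst 'c
  | Zr
  | On
  | Jn "'c trm" "'c trm"  (infixl "\<squnion>" 65)
  | Mt "'c trm" "'c trm"  (infixl "\<sqinter>" 70)
  | Df "'c trm" "'c trm"  (infixl "\<ominus>" 75)

datatype 'c fm =
    Eq "'c trm" "'c trm"  (infix "\<approx>" 50)
  | Neg "'c fm"
  | Conj "'c fm" "'c fm"  (infixr "\<^bold>\<and>" 35)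
  | Forall nat "'c fm"

abbreviation Imp :: "'c fm \<Rightarrow> 'c fm \<Rightarrow> 'c fm"  (infixr "\<^bold>\<longrightarrow>" 25)
  where "p \<^bold>\<longrightarrow> q \<equiv> Neg (p \<^bold>\<and> Neg q)"

abbreviation Exists :: "nat \<Rightarrow> 'c fm \<Rightarrow> 'c fm"
  where "Exists n p \<equiv> Neg (Forall n (Neg p))"

abbreviation Neq :: "'c trm \<Rightarrow> 'c trm \<Rightarrow> 'c fm"  (infix "\<^bold>\<noteq>" 50)
  where "s \<^bold>\<noteq> t \<equiv> Neg (s \<approx> t)"

fun fvt :: "'c trm \<Rightarrow> nat set" where
  "fvt (V n) = {n}"
| "fvt (Cst c) = {}"
| "fvt Zr = {}"
| "fvt On = {}"
| "fvt (s \<squnion> t) = fvt s \<union> fvt t"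
| "fvt (s \<sqinter> t) = fvt s \<union> fvt t"
| "fvt (s \<ominus> t) = fvt s \<union> fvt t"

fun fv :: "'c fm \<Rightarrow> nat set" where
  "fv (s \<approx> t) = fvt s \<union> fvt t"
| "fv (Neg p) = fv p"
| "fv (p \<^bold>\<and> q) = fv p \<union> fv q"
| "fv (Forall n p) = fv p - {n}"

text \<open>\<open>set_fm p\<close>, from the datatype package, is the set of constants occurring in \<open>p\<close>.
  \<open>sentence A p\<close>: \<open>p\<close> is a sentence of the language expanded by constants for the elements
  of \<open>A\<close>.\<close>

definition sentence :: "'c set \<Rightarrow> 'c fm \<Rightarrow> bool" where
  "sentence A p \<longleftrightarrow> fv p = {} \<and> set_fm p \<subseteq> A"

fun literal :: "'c fm \<Rightarrow> bool" where
  "literal (s \<approx> t) = True"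
| "literal (Neg (s \<approx> t)) = True"
| "literal _ = False"


section \<open>Structures and satisfaction\<close>

record 'a struct =
  univ :: "'a set"
  zero :: 'a
  one :: 'a
  join :: "'a \<Rightarrow> 'a \<Rightarrow> 'a"
  meet :: "'a \<Rightarrow> 'a \<Rightarrow> 'a"
  diff :: "'a \<Rightarrow> 'a \<Rightarrow> 'a"

definition is_struct :: "'a struct \<Rightarrow> bool" where
  "is_struct M \<longleftrightarrow>
     zero M \<in> univ M \<and> one M \<in> univ M \<and>
     (\<forall>x\<in>univ M. \<forall>y\<in>univ M.
        join M x y \<in> univ M \<and> meet M x y \<in> univ M \<and> diff M x y \<in> univ M)"

fun tval :: "'a struct \<Rightarrow> ('c \<Rightarrow> 'a) \<Rightarrow> (nat \<Rightarrow> 'a) \<Rightarrow> 'c trm \<Rightarrow> 'a" where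
  "tval M k e (V n) = e n"
| "tval M k e (Cst c) = k c"
| "tval M k e Zr = zero M"
| "tval M k e On = one M"
| "tval M k e (s \<squnion> t) = join M (tval M k e s) (tval M k e t)"
| "tval M k e (s \<sqinter> t) = meet M (tval M k e s) (tval M k e t)"
| "tval M k e (s \<ominus> t) = diff M (tval M k e s) (tval M k e t)"

fun sat :: "'a struct \<Rightarrow> ('c \<Rightarrow> 'a) \<Rightarrow> (nat \<Rightarrow> 'a) \<Rightarrow> 'c fm \<Rightarrow> bool" where
  "sat M k e (s \<approx> t) \<longleftrightarrow> tval M k e s = tval M k e t"
| "sat M k e (Neg p) \<longleftrightarrow> \<not> sat M k e p"
| "sat M k e (p \<^bold>\<and> q) \<longleftrightarrow> sat M k e p \<and> sat M k e q"
| "sat M k e (Forall n p) \<longleftrightarrow> (\<forall>x\<in>univ M. sat M k (e(n := x)) p)"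

text \<open>Truth of a sentence; the assignment is irrelevant then.\<close>

definition holds :: "'a struct \<Rightarrow> ('c \<Rightarrow> 'a) \<Rightarrow> 'c fm \<Rightarrow> bool" where
  "holds M k p \<longleftrightarrow> (\<forall>e. range e \<subseteq> univ M \<longrightarrow> sat M k e p)"

text \<open>\<open>(M, k)\<close> is a model of \<open>T\<close>, a theory in the language with constants for the elements of
  \<open>A\<close>; \<open>k\<close> interprets these constants and is irrelevant outside \<open>A\<close>.\<close>

definition model :: "'c set \<Rightarrow> 'c fm set \<Rightarrow> 'a struct \<Rightarrow> ('c \<Rightarrow> 'a) \<Rightarrow> bool" where
  "model A T M k \<longleftrightarrow> is_struct M \<and> k ` A \<subseteq> univ M \<and> (\<forall>p\<in>T. holds M k p)"

text \<open>Models of a theory in the language without constants.\<close>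

definition is_model :: "'a fm set \<Rightarrow> 'a struct \<Rightarrow> bool" where
  "is_model T M \<longleftrightarrow> model {} T M id"

definition embedding :: "('a \<Rightarrow> 'b) \<Rightarrow> 'a struct \<Rightarrow> 'b struct \<Rightarrow> bool" where
  "embedding f M N \<longleftrightarrow>
     f ` univ M \<subseteq> univ N \<and> inj_on f (univ M) \<and>
     f (zero M) = zero N \<and> f (one M) = one N \<and>
     (\<forall>x\<in>univ M. \<forall>y\<in>univ M.
        f (join M x y) = join N (f x) (f y) \<and>
        f (meet M x y) = meet N (f x) (f y) \<and>
        f (diff M x y) = diff N (f x) (f y))"


section \<open>Model completions\<close>

text \<open>
  HOL cannot quantify over types inside a formula, so structures and their elements are taken
  from one type \<^typ>\<open>'u\<close>, which is infinite in all uses and otherwise arbitrary. As the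
  language is countable, the Loewenheim-Skolem theorem shows that nothing is lost: if
  \<open>card A \<le> card 'u\<close>, every satisfiable theory in the language expanded by \<open>A\<close> has a model
  with universe in \<^typ>\<open>'u\<close>, so consequence, completeness and embeddability into models have
  their absolute meaning.
\<close>

definition entails :: "'u set \<Rightarrow> 'u fm set \<Rightarrow> 'u fm \<Rightarrow> bool" where
  "entails A T p \<longleftrightarrow> (\<forall>(M :: 'u struct) k. model A T M k \<longrightarrow> holds M k p)"

definition complete_theory :: "'u set \<Rightarrow> 'u fm set \<Rightarrow> bool" where
  "complete_theory A T \<longleftrightarrow>
     (\<exists>(M :: 'u struct) k. model A T M k) \<and>
     (\<forall>p. sentence A p \<longrightarrow> entails A T p \<or> entails A T (Neg p))"

definition diagram :: "'u struct \<Rightarrow> 'u fm set" where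
  "diagram M = {p. sentence (univ M) p \<and> literal p \<and> holds M id p}"

definition model_completion :: "'u fm set \<Rightarrow> 'u fm set \<Rightarrow> bool" where
  "model_completion T T' \<longleftrightarrow>
     (\<forall>p\<in>T \<union> T'. sentence {} p) \<and>
     (\<forall>p\<in>T. entails {} T' p) \<and>
     (\<forall>M. is_model T M \<longrightarrow> (\<exists>N f. is_model T' N \<and> embedding f M N)) \<and>
     (\<forall>M. is_model T M \<longrightarrow> complete_theory (univ M) (T' \<union> diagram M))"


section \<open>The variety and the axioms\<close>

abbreviation Le :: "'c trm \<Rightarrow> 'c trm \<Rightarrow> 'c fm"  (infix "\<preceq>" 50)
  where "s \<preceq> t \<equiv> s \<sqinter> t \<approx> s"

abbreviation Ll :: "'c trm \<Rightarrow> 'c trm \<Rightarrow> 'c fm"  (infix "\<lless>" 50)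
  where "b \<lless> a \<equiv> (a \<ominus> b \<approx> a \<^bold>\<and> b \<preceq> a)"

definition co_Heyting :: "'c fm set" where
  "co_Heyting = (let x = V 0; y = V 1; z = V 2 in
    {Forall 0 (Forall 1 (x \<squnion> y \<approx> y \<squnion> x)),
     Forall 0 (Forall 1 (x \<sqinter> y \<approx> y \<sqinter> x)),
     Forall 0 (Forall 1 (Forall 2 (x \<squnion> y \<squnion> z \<approx> x \<squnion> (y \<squnion> z)))),
     Forall 0 (Forall 1 (Forall 2 (x \<sqinter> y \<sqinter> z \<approx> x \<sqinter> (y \<sqinter> z)))),
     Forall 0 (Forall 1 (x \<squnion> (x \<sqinter> y) \<approx> x)),
     Forall 0 (Forall 1 (x \<sqinter> (x \<squnion> y) \<approx> x)),
     Forall 0 (Forall 1 (Forall 2 (x \<sqinter> (y \<squnion> z) \<approx> (x \<sqinter> y) \<squnion> (x \<sqinter> z)))),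
     Forall 0 (Zr \<preceq> x),
     Forall 0 (x \<preceq> On),
     Forall 0 (Forall 1 (x \<preceq> y \<squnion> (x \<ominus> y))),
     Forall 0 (Forall 1 (Forall 2 (x \<preceq> y \<squnion> z \<^bold>\<longrightarrow> x \<ominus> y \<preceq> z)))})"

definition V5 :: "'c fm set" where
  "V5 = co_Heyting \<union> (let x = V 0; y = V 1 in
    {Forall 0 ((On \<ominus> x) \<sqinter> (On \<ominus> (On \<ominus> x)) \<approx> Zr),
     Forall 0 (Forall 1 ((((On \<ominus> x) \<sqinter> x) \<ominus> y) \<sqinter> y \<approx> Zr))})"

definition D5 :: "'c fm" where
  "D5 = (let a = V 0; b = V 1 in
     Forall 0 (a \<approx> On \<ominus> (On \<ominus> a) \<^bold>\<and> a \<^bold>\<noteq> Zr \<^bold>\<longrightarrow> Exists 1 (b \<^bold>\<noteq> Zr \<^bold>\<and> b \<lless> a)))"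

definition S5 :: "'c fm" where
  "S5 = (let a = V 0; b1 = V 1; b2 = V 2; a1 = V 3; a2 = V 4 in
     Forall 0 (Forall 1 (Forall 2 (
       b1 \<squnion> b2 \<lless> a \<^bold>\<and> a \<^bold>\<noteq> Zr \<^bold>\<and> b1 \<sqinter> b2 \<sqinter> (On \<ominus> (On \<ominus> a)) \<approx> Zr \<^bold>\<longrightarrow>
       Exists 3 (Exists 4 (
         a1 \<^bold>\<noteq> Zr \<^bold>\<and> a2 \<^bold>\<noteq> Zr \<^bold>\<and>
         a \<ominus> a2 \<approx> a1 \<^bold>\<and> b1 \<preceq> a1 \<^bold>\<and>
         a \<ominus> a1 \<approx> a2 \<^bold>\<and> b2 \<preceq> a2 \<^bold>\<and>
         a1 \<sqinter> a2 \<approx> b1 \<sqinter> b2))))))"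

lemma axioms_are_sentences: "p \<in> V5 \<union> {D5, S5} \<Longrightarrow> sentence {} p"
  by (auto simp: V5_def co_Heyting_def D5_def S5_def sentence_def Let_def)

lemma sat_D5:
  "sat M k e D5 \<longleftrightarrow>
     (\<forall>a\<in>univ M. a = diff M (one M) (diff M (one M) a) \<and> a \<noteq> zero M \<longrightarrow>
        (\<exists>b\<in>univ M. b \<noteq> zero M \<and> diff M a b = a \<and> meet M b a = b))"
  unfolding D5_def Let_def by (simp only: sat.simps tval.simps fun_upd_apply) (simp, blast)

lemma sat_S5:
  "sat M k e S5 \<longleftrightarrow>
     (\<forall>a\<in>univ M. \<forall>b1\<in>univ M. \<forall>b2\<in>univ M.
        diff M a (join M b1 b2) = a \<and> meet M (join M b1 b2) a = join M b1 b2 \<and> a \<noteq> zero M \<and>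
        meet M (meet M b1 b2) (diff M (one M) (diff M (one M) a)) = zero M \<longrightarrow>
        (\<exists>a1\<in>univ M. \<exists>a2\<in>univ M. a1 \<noteq> zero M \<and> a2 \<noteq> zero M \<and>
           diff M a a2 = a1 \<and> meet M b1 a1 = b1 \<and> diff M a a1 = a2 \<and> meet M b2 a2 = b2 \<and>
           meet M a1 a2 = meet M b1 b2))"
  unfolding S5_def Let_def by (simp only: sat.simps tval.simps fun_upd_apply) (simp, blast)

end

theory Submission
  imports Defs "HOL-Library.FuncSet"
begin

text \<open>
  Every prime filter \<open>P\<close> of a \<open>V5\<close>-algebra contains a unique minimal one, and no prime filter lies
  strictly between the two. Hence \<open>P\<close> yields a homomorphism (a character) onto a subalgebra of the
  three-element chain \<open>0 < 1 < 2\<close>: an element has value 2 if it lies in the minimal prime filter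
  below \<open>P\<close>, and value 1 if it only lies in \<open>P\<close>. Characters separate points and extend along
  embeddings, so the quantifier-free type of a finite tuple is the finite set of value patterns that
  the characters produce on it.

  Call \<open>a\<close> regular if \<open>a = 1 - (1 - a)\<close>, and small if it lies in no minimal prime filter. D5 and S5 say
  that non-zero regular elements contain non-zero small ones, that non-zero small elements split, and
  that non-zero regular ones split around any two disjoint small elements below them. This is what is needed to realize, in a model of D5 and S5, any pattern set of
  a one-element extension of a finite tuple. A back-and-forth argument thus gives quantifier
  elimination and the completeness of the theory with a diagram. Conversely, a \<open>V5\<close>-algebra embeds
  by its characters into a power of one concrete model of D5 and S5, and the
  Loewenheim-Skolem argument cuts that power down to the size of the given type.
\<close>

section \<open>Algebras of the variety and their prime filters\<close>

text \<open>Minimal prime filters are never constructed: the one below \<open>P\<close> consists of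
  the \<open>x\<close> with \<open>1 - (1 - x)\<close> in \<open>P\<close>. The first identity
  complements \<open>1 - x\<close>, which makes this set prime; the second makes \<open>y\<close>
  and \<open>z - y\<close> disjoint for a boundary \<open>z = (1 - x) \<and> x\<close>, which leaves
  no room between the two filters.

  The obstacle in a one-element extension is that patterns cannot be realized independently. The
  regular element of a minimal pattern also contains the small elements of all patterns above it,
  and the new element has value 2 on some parts of these and value 0 or 1 on others. A cut of the
  regular element has to respect both kinds of parts, which is the purpose of \<open>b1\<close> and
  \<open>b2\<close> in S5. The only constraints on the values come from the endomorphism
  \<open>mn3\<close>.

  The digits of the concrete model have matching tasks: 0 and 1 both keep non-minimal points, so
  small elements split; 2 and 3 in the next coordinate avoid every small element of the current
  level, so regular elements split off any given small ones.\<close>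

locale V5_algebra =
  fixes M :: "'a struct"
  assumes zero_closed [simp, intro]: "zero M \<in> univ M"
    and one_closed [simp, intro]: "one M \<in> univ M"
    and join_closed [simp, intro]: "\<And>x y. x \<in> univ M \<Longrightarrow> y \<in> univ M \<Longrightarrow> join M x y \<in> univ M"
    and meet_closed [simp, intro]: "\<And>x y. x \<in> univ M \<Longrightarrow> y \<in> univ M \<Longrightarrow> meet M x y \<in> univ M"
    and diff_closed [simp, intro]: "\<And>x y. x \<in> univ M \<Longrightarrow> y \<in> univ M \<Longrightarrow> diff M x y \<in> univ M"
    and join_comm: "\<And>x y. x \<in> univ M \<Longrightarrow> y \<in> univ M \<Longrightarrow> join M x y = join M y x"
    and meet_comm: "\<And>x y. x \<in> univ M \<Longrightarrow> y \<in> univ M \<Longrightarrow> meet M x y = meet M y x"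
    and join_assoc: "\<And>x y z. x \<in> univ M \<Longrightarrow> y \<in> univ M \<Longrightarrow> z \<in> univ M \<Longrightarrow>
          join M (join M x y) z = join M x (join M y z)"
    and meet_assoc: "\<And>x y z. x \<in> univ M \<Longrightarrow> y \<in> univ M \<Longrightarrow> z \<in> univ M \<Longrightarrow>
          meet M (meet M x y) z = meet M x (meet M y z)"
    and join_meet_absorb: "\<And>x y. x \<in> univ M \<Longrightarrow> y \<in> univ M \<Longrightarrow> join M x (meet M x y) = x"
    and meet_join_absorb: "\<And>x y. x \<in> univ M \<Longrightarrow> y \<in> univ M \<Longrightarrow> meet M x (join M x y) = x"
    and meet_join_distrib: "\<And>x y z. x \<in> univ M \<Longrightarrow> y \<in> univ M \<Longrightarrow> z \<in> univ M \<Longrightarrow>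
          meet M x (join M y z) = join M (meet M x y) (meet M x z)"
    and zero_least: "\<And>x. x \<in> univ M \<Longrightarrow> meet M (zero M) x = zero M"
    and one_greatest: "\<And>x. x \<in> univ M \<Longrightarrow> meet M x (one M) = x"
    and le_join_diff: "\<And>x y. x \<in> univ M \<Longrightarrow> y \<in> univ M \<Longrightarrow>
          meet M x (join M y (diff M x y)) = x"
    and diff_least: "\<And>x y z. x \<in> univ M \<Longrightarrow> y \<in> univ M \<Longrightarrow> z \<in> univ M \<Longrightarrow>
          meet M x (join M y z) = x \<Longrightarrow> meet M (diff M x y) z = diff M x y"
    and dual_stone: "\<And>x. x \<in> univ M \<Longrightarrow>
          meet M (diff M (one M) x) (diff M (one M) (diff M (one M) x)) = zero M"
    and depth_two: "\<And>x y. x \<in> univ M \<Longrightarrow> y \<in> univ M \<Longrightarrow>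
          meet M (diff M (meet M (diff M (one M) x) x) y) y = zero M"

section \<open>Satisfaction of sentences\<close>

lemma tval_cong:
  assumes "\<And>n. n \<in> fvt t \<Longrightarrow> e n = e' n" and "\<And>c. c \<in> set_trm t \<Longrightarrow> k c = k' c"
  shows "tval M k e t = tval M k' e' t"
  using assms by (induction t) auto

lemma sat_cong:
  assumes "\<And>n. n \<in> fv p \<Longrightarrow> e n = e' n" and "\<And>c. c \<in> set_fm p \<Longrightarrow> k c = k' c"
  shows "sat M k e p \<longleftrightarrow> sat M k' e' p"
  using assms
proof (induction p arbitrary: e e')
  case (Eq s t)
  then show ?case using tval_cong[of s e e' k k' M] tval_cong[of t e e' k k' M] by simp
next
  case (Neg p)
  from Neg.IH[of e e'] Neg.prems show ?case by simp
next
  case (Conj p q)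
  from Conj.IH(1)[of e e'] Conj.IH(2)[of e e'] Conj.prems show ?case by simp
next
  case (Forall n p)
  have "sat M k (e(n := x)) p \<longleftrightarrow> sat M k' (e'(n := x)) p" for x
    by (rule Forall.IH) (use Forall.prems in auto)
  then show ?case by simp
qed

lemma holds_sentence_iff:
  assumes "fv p = {}" and "range e \<subseteq> univ M"
  shows "holds M k p \<longleftrightarrow> sat M k e p"
proof -
  have "sat M k e' p \<longleftrightarrow> sat M k e p" for e'
    by (rule sat_cong) (use assms(1) in auto)
  then show ?thesis using assms(2) by (auto simp: holds_def)
qed

lemma is_model_V5_iff: "is_model V5 M \<longleftrightarrow> V5_algebra M"
proof (cases "is_struct M")
  case True
  define e :: "nat \<Rightarrow> 'a" where "e = (\<lambda>_. zero M)"
  have e: "range e \<subseteq> univ M"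
    using True by (auto simp: is_struct_def e_def)
  have "holds M id p \<longleftrightarrow> sat M id e p" if "p \<in> V5" for p
    using that axioms_are_sentences[of p] e by (intro holds_sentence_iff) (auto simp: sentence_def)
  then have "is_model V5 M \<longleftrightarrow> (\<forall>p\<in>V5. sat M id e p)"
    by (simp add: is_model_def model_def True)
  also have "\<dots> \<longleftrightarrow> V5_algebra M"
    unfolding V5_def co_Heyting_def Let_def ball_Un V5_algebra_def
    apply (simp only: ball_simps sat.simps tval.simps fun_upd_apply simp_thms if_True if_False)
    apply simp
    using True[unfolded is_struct_def]
    apply simp
    apply (simp only: Ball_def simp_thms)
    done
  finally show ?thesis .
next
  case False
  then show ?thesis by (auto simp: V5_algebra_def is_struct_def is_model_def model_def)
qed

section \<open>Order, residuation and the prime filter theorem\<close>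

context V5_algebra
begin

definition le :: "'a \<Rightarrow> 'a \<Rightarrow> bool" where
  "le x y \<longleftrightarrow> meet M x y = x"

lemma meet_idem: "x \<in> univ M \<Longrightarrow> meet M x x = x"
  by (metis join_meet_absorb meet_join_absorb meet_closed)

lemma le_refl: "x \<in> univ M \<Longrightarrow> le x x"
  by (simp add: le_def meet_idem)

lemma le_trans:
  assumes "x \<in> univ M" "y \<in> univ M" "z \<in> univ M" "le x y" "le y z"
  shows "le x z"
  using assms meet_assoc[of x y z] by (simp add: le_def)

lemma le_antisym:
  assumes "x \<in> univ M" "y \<in> univ M" "le x y" "le y x"
  shows "x = y"
  using assms meet_comm[of x y] by (simp add: le_def)

lemma le_iff_join: "x \<in> univ M \<Longrightarrow> y \<in> univ M \<Longrightarrow> le x y \<longleftrightarrow> join M x y = y"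
  unfolding le_def by (metis join_comm join_meet_absorb meet_comm meet_join_absorb)

lemma meet_le1: "x \<in> univ M \<Longrightarrow> y \<in> univ M \<Longrightarrow> le (meet M x y) x"
  by (metis le_def meet_assoc meet_comm meet_idem meet_closed)

lemma meet_le2: "x \<in> univ M \<Longrightarrow> y \<in> univ M \<Longrightarrow> le (meet M x y) y"
  by (metis meet_le1 meet_comm)

lemma le_meetI:
  assumes "x \<in> univ M" "y \<in> univ M" "z \<in> univ M" "le z x" "le z y"
  shows "le z (meet M x y)"
  using assms meet_assoc[of z x y] by (simp add: le_def)

lemma le_join1: "x \<in> univ M \<Longrightarrow> y \<in> univ M \<Longrightarrow> le x (join M x y)"
  by (simp add: le_def meet_join_absorb)

lemma le_join2: "x \<in> univ M \<Longrightarrow> y \<in> univ M \<Longrightarrow> le y (join M x y)"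
  by (metis le_join1 join_comm)

lemma join_leI:
  assumes "x \<in> univ M" "y \<in> univ M" "z \<in> univ M" "le x z" "le y z"
  shows "le (join M x y) z"
  using assms join_assoc[of x y z] by (simp add: le_iff_join)

lemma le_meet1:
  assumes "x \<in> univ M" "y \<in> univ M" "z \<in> univ M" "le x z"
  shows "le (meet M x y) z"
  by (rule le_trans[of _ x]) (use assms meet_le1 in auto)

lemma le_meet2:
  assumes "x \<in> univ M" "y \<in> univ M" "z \<in> univ M" "le y z"
  shows "le (meet M x y) z"
  by (rule le_trans[of _ y]) (use assms meet_le2 in auto)

lemma le_joinI1:
  assumes "x \<in> univ M" "y \<in> univ M" "z \<in> univ M" "le z x"
  shows "le z (join M x y)"
  by (rule le_trans[of _ x]) (use assms le_join1 in auto)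

lemma le_joinI2:
  assumes "x \<in> univ M" "y \<in> univ M" "z \<in> univ M" "le z y"
  shows "le z (join M x y)"
  by (rule le_trans[of _ y]) (use assms le_join2 in auto)

lemma zero_le: "x \<in> univ M \<Longrightarrow> le (zero M) x"
  by (simp add: le_def zero_least)

lemma le_one: "x \<in> univ M \<Longrightarrow> le x (one M)"
  by (simp add: le_def one_greatest)

lemma le_zeroD: "x \<in> univ M \<Longrightarrow> le x (zero M) \<Longrightarrow> x = zero M"
  by (simp add: le_antisym zero_le)

lemma diff_le_iff:
  assumes "x \<in> univ M" "y \<in> univ M" "z \<in> univ M"
  shows "le (diff M x y) z \<longleftrightarrow> le x (join M y z)"
proof
  assume "le (diff M x y) z"
  then have "le (join M y (diff M x y)) (join M y z)"
    using assms by (intro join_leI) (auto intro: le_join1 le_joinI2)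
  then show "le x (join M y z)"
    using assms le_trans[of x "join M y (diff M x y)" "join M y z"]
    by (simp add: le_def le_join_diff)
qed (use assms diff_least in \<open>simp add: le_def\<close>)

lemma diff_le: "x \<in> univ M \<Longrightarrow> y \<in> univ M \<Longrightarrow> le (diff M x y) x"
  by (simp add: diff_le_iff le_join2)

definition is_filter :: "'a set \<Rightarrow> bool" where
  "is_filter F \<longleftrightarrow> F \<subseteq> univ M \<and> one M \<in> F \<and> (\<forall>x\<in>F. \<forall>y\<in>F. meet M x y \<in> F) \<and>
     (\<forall>x\<in>F. \<forall>y\<in>univ M. le x y \<longrightarrow> y \<in> F)"

definition is_ideal :: "'a set \<Rightarrow> bool" where
  "is_ideal I \<longleftrightarrow> I \<subseteq> univ M \<and> zero M \<in> I \<and> (\<forall>x\<in>I. \<forall>y\<in>I. join M x y \<in> I) \<and>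
     (\<forall>x\<in>I. \<forall>y\<in>univ M. le y x \<longrightarrow> y \<in> I)"

definition is_prime :: "'a set \<Rightarrow> bool" where
  "is_prime P \<longleftrightarrow> is_filter P \<and> zero M \<notin> P \<and>
     (\<forall>x\<in>univ M. \<forall>y\<in>univ M. join M x y \<in> P \<longrightarrow> x \<in> P \<or> y \<in> P)"

lemma is_filter_extend:
  assumes P: "is_filter P" and x: "x \<in> univ M"
  defines "G \<equiv> {z \<in> univ M. \<exists>p\<in>P. le (meet M p x) z}"
  shows "is_filter G" and "P \<subseteq> G" and "x \<in> G"
proof -
  have PU: "p \<in> univ M" if "p \<in> P" for p
    using that P by (auto simp: is_filter_def)
  have one: "one M \<in> P"
    using P by (simp add: is_filter_def)
  show "is_filter G"
    unfolding is_filter_def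
  proof (intro conjI ballI impI)
    show "G \<subseteq> univ M"
      by (auto simp: G_def)
    show "one M \<in> G"
      unfolding G_def using one x PU[OF one] le_one by blast
  next
    fix y z assume "y \<in> G" "z \<in> G"
    then obtain p q where p: "p \<in> P" "le (meet M p x) y" "y \<in> univ M"
      and q: "q \<in> P" "le (meet M q x) z" "z \<in> univ M"
      unfolding G_def by blast
    let ?r = "meet M p q"
    have r: "?r \<in> P"
      using p q P by (simp add: is_filter_def)
    note c = PU[OF p(1)] PU[OF q(1)] PU[OF r] x p(3) q(3)
    have "le (meet M ?r x) (meet M p x)"
      using c by (intro le_meetI le_meet1[of ?r] meet_le1 meet_le2 meet_closed)
    then have "le (meet M ?r x) y"
      by (rule le_trans[rotated 3, OF _ p(2)]) (use c in auto)
    moreover have "le (meet M ?r x) (meet M q x)"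
      using c by (intro le_meetI le_meet1[of ?r] meet_le1 meet_le2 meet_closed)
    then have "le (meet M ?r x) z"
      by (rule le_trans[rotated 3, OF _ q(2)]) (use c in auto)
    ultimately have "le (meet M ?r x) (meet M y z)"
      using c by (intro le_meetI) auto
    then show "meet M y z \<in> G"
      unfolding G_def using r c by blast
  next
    fix y z assume "y \<in> G" "z \<in> univ M" "le y z"
    then show "z \<in> G"
      unfolding G_def using PU x le_trans[of "meet M _ x" y z] meet_closed by blast
  qed
  show "P \<subseteq> G"
    unfolding G_def using PU x meet_le1 by blast
  show "x \<in> G"
    unfolding G_def using PU[OF one] x meet_le2 one by blast
qed

text \<open>Zorn's lemma gives a filter that is maximal among those disjoint from \<open>I\<close>;
  distributivity makes it prime.\<close>

theorem prime_filter_exists: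
  assumes F: "is_filter F" and I: "is_ideal I" and disj: "F \<inter> I = {}"
  obtains P where "is_prime P" "F \<subseteq> P" "P \<inter> I = {}"
proof -
  define \<A> where "\<A> = {G. is_filter G \<and> F \<subseteq> G \<and> G \<inter> I = {}}"
  have "\<exists>P\<in>\<A>. \<forall>X\<in>\<A>. P \<subseteq> X \<longrightarrow> X = P"
  proof (rule subset_Zorn_nonempty)
    show "\<A> \<noteq> {}"
      using F disj by (auto simp: \<A>_def)
  next
    fix C assume ne: "C \<noteq> {}" and "subset.chain \<A> C"
    then have C: "C \<subseteq> \<A>" and ch: "\<And>X Y. X \<in> C \<Longrightarrow> Y \<in> C \<Longrightarrow> X \<subseteq> Y \<or> Y \<subseteq> X"
      by (auto simp: subset_chain_def)
    have filt: "is_filter X" if "X \<in> C" for X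
      using that C by (auto simp: \<A>_def)
    have "is_filter (\<Union>C)"
      unfolding is_filter_def
    proof (intro conjI ballI impI)
      show "\<Union>C \<subseteq> univ M"
        using filt by (fastforce simp: is_filter_def)
      show "one M \<in> \<Union>C"
        using filt ne by (fastforce simp: is_filter_def)
    next
      fix x y assume "x \<in> \<Union>C" "y \<in> \<Union>C"
      then obtain X Y where "X \<in> C" "Y \<in> C" "x \<in> X" "y \<in> Y" by blast
      then obtain Z where "Z \<in> C" "x \<in> Z" "y \<in> Z"
        using ch by blast
      then have "meet M x y \<in> Z"
        using filt by (simp add: is_filter_def)
      with \<open>Z \<in> C\<close> show "meet M x y \<in> \<Union>C" by blast
    next
      fix x y assume "x \<in> \<Union>C" "y \<in> univ M" "le x y"
      then obtain X where "X \<in> C" "x \<in> X" by blast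
      then have "y \<in> X"
        using filt \<open>y \<in> univ M\<close> \<open>le x y\<close> unfolding is_filter_def by blast
      with \<open>X \<in> C\<close> show "y \<in> \<Union>C" by blast
    qed
    with C ne show "\<Union>C \<in> \<A>"
      unfolding \<A>_def by blast
  qed
  then obtain P where P: "P \<in> \<A>" and max: "\<And>X. X \<in> \<A> \<Longrightarrow> P \<subseteq> X \<Longrightarrow> X = P"
    by blast
  have filt: "is_filter P" and FP: "F \<subseteq> P" and PI: "P \<inter> I = {}"
    using P by (auto simp: \<A>_def)
  have PU: "p \<in> univ M" if "p \<in> P" for p
    using that filt by (auto simp: is_filter_def)
  have IU: "i \<in> univ M" if "i \<in> I" for i
    using that I by (auto simp: is_ideal_def)
  \<comment> \<open>Maximality in usable form: the filter generated by \<open>P\<close> and an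
    outside element \<open>x\<close> meets \<open>I\<close>.\<close>
  have hit: "\<exists>p\<in>P. \<exists>i\<in>I. le (meet M p x) i" if x: "x \<in> univ M" "x \<notin> P" for x
  proof (rule ccontr)
    assume no: "\<not> ?thesis"
    let ?G = "{z \<in> univ M. \<exists>p\<in>P. le (meet M p x) z}"
    have "?G \<in> \<A>"
      using is_filter_extend[OF filt x(1)] FP no unfolding \<A>_def by blast
    then have "?G = P"
      using max is_filter_extend(2)[OF filt x(1)] by blast
    then show False
      using is_filter_extend(3)[OF filt x(1)] x(2) by blast
  qed
  have "x \<in> P \<or> y \<in> P" if xy: "x \<in> univ M" "y \<in> univ M" "join M x y \<in> P" for x y
  proof (rule ccontr)
    assume "\<not> ?thesis"
    then obtain p q i j where p: "p \<in> P" "i \<in> I" "le (meet M p x) i"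
      and q: "q \<in> P" "j \<in> I" "le (meet M q y) j"
      using hit[OF xy(1)] hit[OF xy(2)] by blast
    let ?r = "meet M p q"
    have r: "?r \<in> P"
      using p q filt by (simp add: is_filter_def)
    note c = PU[OF p(1)] PU[OF q(1)] PU[OF r] IU[OF p(2)] IU[OF q(2)] xy(1,2)
    have ij: "join M i j \<in> univ M"
      using c by blast
    have "le (meet M ?r x) (meet M p x)"
      using c by (intro le_meetI le_meet1[of ?r] meet_le1 meet_le2 meet_closed)
    then have "le (meet M ?r x) i"
      by (rule le_trans[rotated 3, OF _ p(3)]) (use c in auto)
    then have 1: "le (meet M ?r x) (join M i j)"
      using c by (intro le_joinI1) auto
    have "le (meet M ?r y) (meet M q y)"
      using c by (intro le_meetI le_meet1[of ?r] meet_le1 meet_le2 meet_closed)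
    then have "le (meet M ?r y) j"
      by (rule le_trans[rotated 3, OF _ q(3)]) (use c in auto)
    then have 2: "le (meet M ?r y) (join M i j)"
      using c by (intro le_joinI2) auto
    \<comment> \<open>Distributivity enters here: an element of \<open>P\<close> falls below an
      element of \<open>I\<close>.\<close>
    have "le (meet M ?r (join M x y)) (join M i j)"
      using 1 2 c ij by (simp add: meet_join_distrib join_leI)
    moreover have "meet M ?r (join M x y) \<in> P"
      using filt r xy(3) by (simp add: is_filter_def)
    ultimately have "join M i j \<in> P"
      using filt ij unfolding is_filter_def by blast
    moreover have "join M i j \<in> I"
      using I p q by (simp add: is_ideal_def)
    ultimately show False
      using PI by blast
  qed
  moreover have "zero M \<notin> P"
    using PI I by (auto simp: is_ideal_def)
  ultimately have "is_prime P"
    using filt by (simp add: is_prime_def)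
  with FP PI that show thesis by blast
qed

lemma prime_up:
  assumes "is_prime P" "x \<in> P" "y \<in> univ M" "le x y"
  shows "y \<in> P"
  using assms unfolding is_prime_def is_filter_def by blast

lemma prime_one: "is_prime P \<Longrightarrow> one M \<in> P"
  and prime_zero: "is_prime P \<Longrightarrow> zero M \<notin> P"
  by (simp_all add: is_prime_def is_filter_def)

lemma prime_meet_iff:
  assumes "is_prime P" "x \<in> univ M" "y \<in> univ M"
  shows "meet M x y \<in> P \<longleftrightarrow> x \<in> P \<and> y \<in> P"
proof
  assume "meet M x y \<in> P"
  then show "x \<in> P \<and> y \<in> P"
    using prime_up[of P "meet M x y" x] prime_up[of P "meet M x y" y] assms
    by (simp add: meet_le1 meet_le2)
qed (use assms in \<open>simp add: is_prime_def is_filter_def\<close>)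

lemma prime_join_iff:
  assumes "is_prime P" "x \<in> univ M" "y \<in> univ M"
  shows "join M x y \<in> P \<longleftrightarrow> x \<in> P \<or> y \<in> P"
proof
  assume "x \<in> P \<or> y \<in> P"
  then show "join M x y \<in> P"
    using prime_up[of P x "join M x y"] prime_up[of P y "join M x y"] assms
    by (auto simp: le_join1 le_join2)
qed (use assms in \<open>simp add: is_prime_def\<close>)

lemma prime_separation:
  assumes "x \<in> univ M" "y \<in> univ M" "\<not> le x y"
  obtains P where "is_prime P" "x \<in> P" "y \<notin> P"
proof -
  have "is_filter {z \<in> univ M. le x z}"
    unfolding is_filter_def using assms(1)
    by (auto intro: le_one le_meetI) (meson le_trans)
  moreover have "is_ideal {z \<in> univ M. le z y}"
    unfolding is_ideal_def using assms(2)
    by (auto intro: zero_le join_leI) (meson le_trans)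
  moreover have "{z \<in> univ M. le x z} \<inter> {z \<in> univ M. le z y} = {}"
    using assms le_trans[OF assms(1) _ assms(2)] by blast
  ultimately obtain P where P: "is_prime P" "{z \<in> univ M. le x z} \<subseteq> P"
    "P \<inter> {z \<in> univ M. le z y} = {}"
    by (rule prime_filter_exists)
  then have "x \<in> P" "y \<notin> P"
    using assms le_refl by auto
  with P(1) that show thesis by blast
qed

end

section \<open>Characters\<close>

text \<open>\<open>df3\<close> is the difference of the chain \<open>0 < 1 < 2\<close>; composing a character with the endomorphism
  \<open>mn3\<close> passes from a prime filter to the minimal one below it.\<close>

definition mn3 :: "nat \<Rightarrow> nat" where
  "mn3 v = (if v = 2 then 2 else 0)"

definition df3 :: "nat \<Rightarrow> nat \<Rightarrow> nat" where
  "df3 v w = (if v \<le> w then 0 else v)"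

definition chars :: "'a struct \<Rightarrow> ('a \<Rightarrow> nat) set" where
  "chars M = {\<chi>. (\<forall>x\<in>univ M. \<chi> x \<le> 2) \<and> \<chi> (zero M) = 0 \<and> \<chi> (one M) = 2 \<and>
     (\<forall>x\<in>univ M. \<forall>y\<in>univ M. \<chi> (join M x y) = max (\<chi> x) (\<chi> y) \<and>
        \<chi> (meet M x y) = min (\<chi> x) (\<chi> y) \<and> \<chi> (diff M x y) = df3 (\<chi> x) (\<chi> y))}"

lemma char_le: "\<chi> \<in> chars M \<Longrightarrow> x \<in> univ M \<Longrightarrow> \<chi> x \<le> 2"
  and char_zero: "\<chi> \<in> chars M \<Longrightarrow> \<chi> (zero M) = 0"
  and char_one: "\<chi> \<in> chars M \<Longrightarrow> \<chi> (one M) = 2"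
  and char_join: "\<chi> \<in> chars M \<Longrightarrow> x \<in> univ M \<Longrightarrow> y \<in> univ M \<Longrightarrow>
    \<chi> (join M x y) = max (\<chi> x) (\<chi> y)"
  and char_meet: "\<chi> \<in> chars M \<Longrightarrow> x \<in> univ M \<Longrightarrow> y \<in> univ M \<Longrightarrow>
    \<chi> (meet M x y) = min (\<chi> x) (\<chi> y)"
  and char_diff: "\<chi> \<in> chars M \<Longrightarrow> x \<in> univ M \<Longrightarrow> y \<in> univ M \<Longrightarrow>
    \<chi> (diff M x y) = df3 (\<chi> x) (\<chi> y)"
  by (auto simp: chars_def)

lemmas char_simps = char_zero char_one char_join char_meet char_diff

lemma chars_mn: "\<chi> \<in> chars M \<Longrightarrow> (\<lambda>x. mn3 (\<chi> x)) \<in> chars M"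
  by (auto simp: chars_def mn3_def df3_def max_def min_def le_antisym)

section \<open>Differences and double complements in prime filters\<close>

context V5_algebra
begin

abbreviation compl :: "'a \<Rightarrow> 'a" where
  "compl x \<equiv> diff M (one M) x"

abbreviation reg :: "'a \<Rightarrow> 'a" where
  "reg x \<equiv> compl (compl x)"

lemma le_if_primes:
  assumes "x \<in> univ M" "y \<in> univ M" "\<And>P. is_prime P \<Longrightarrow> x \<in> P \<Longrightarrow> y \<in> P"
  shows "le x y"
proof (rule ccontr)
  assume "\<not> le x y"
  then obtain P where "is_prime P" "x \<in> P" "y \<notin> P"
    by (rule prime_separation[OF assms(1,2)])
  with assms(3) show False by blast
qed

lemma prime_diff_cover:
  assumes "is_prime P" "x \<in> univ M" "y \<in> univ M" "x \<in> P"
  shows "y \<in> P \<or> diff M x y \<in> P"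
proof -
  have "join M y (diff M x y) \<in> P"
    by (rule prime_up[of P x]) (use assms in \<open>auto simp: le_def le_join_diff\<close>)
  then show ?thesis
    using assms prime_join_iff by simp
qed

text \<open>The join of \<open>compl x\<close> and \<open>reg x\<close> is 1 in every co-Heyting
  algebra, and \<open>dual_stone\<close> makes their meet 0, so a prime filter contains exactly one
  of them.\<close>

lemma prime_compl_iff:
  assumes "is_prime P" "x \<in> univ M"
  shows "compl x \<in> P \<longleftrightarrow> reg x \<notin> P"
proof
  show "reg x \<notin> P" if "compl x \<in> P"
    using prime_meet_iff[of P "compl x" "reg x"] that assms dual_stone[of x] prime_zero[of P]
    by simp
  show "compl x \<in> P" if "reg x \<notin> P"
    using prime_diff_cover[of P "one M" "compl x"] that assms prime_one[of P] by simp
qed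

lemma one_le_join_compl:
  assumes "x \<in> univ M"
  shows "le (one M) (join M (compl x) x)"
proof (rule le_if_primes)
  fix P assume "is_prime P" "one M \<in> P"
  then show "join M (compl x) x \<in> P"
    using prime_diff_cover[of P "one M" x] assms by (auto simp: prime_join_iff)
qed (use assms in auto)

lemma reg_le: "x \<in> univ M \<Longrightarrow> le (reg x) x"
  by (simp add: diff_le_iff one_le_join_compl)

lemma reg_mono:
  assumes "x \<in> univ M" "y \<in> univ M" "le x y"
  shows "le (reg x) (reg y)"
proof -
  have anti: "le (compl v) (compl u)" if uv: "u \<in> univ M" "v \<in> univ M" "le u v" for u v
  proof -
    have "le (one M) (join M v (compl u))"
    proof (rule le_if_primes)
      fix P assume "is_prime P" "one M \<in> P"
      then show "join M v (compl u) \<in> P"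
        using uv prime_diff_cover[of P "one M" u] prime_up[of P u v] by (auto simp: prime_join_iff)
    qed (use uv in auto)
    then show ?thesis
      using uv by (simp add: diff_le_iff)
  qed
  show ?thesis
    by (intro anti assms diff_closed one_closed)
qed

text \<open>Inside a complemented \<open>w\<close>, subtracting \<open>y\<close> loses nothing of
  \<open>compl y\<close>: every prime filter contains \<open>y\<close>, \<open>w - y\<close> or the
  complement \<open>w'\<close>, hence \<open>compl y\<close> lies below the join of
  \<open>w - y\<close> and \<open>w'\<close>, and \<open>w\<close> excludes \<open>w'\<close>.
  Complementation is expressed through prime filters because that is how it becomes
  available.\<close>

lemma complemented_le_diff:
  assumes w: "w \<in> univ M" "w' \<in> univ M" "y \<in> univ M"
    and compl: "\<And>P. is_prime P \<Longrightarrow> w \<in> P \<longleftrightarrow> w' \<notin> P"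
    and le: "le w (compl y)"
  shows "le w (diff M w y)"
proof (rule le_if_primes)
  fix P assume P: "is_prime P" "w \<in> P"
  have "le (one M) (join M y (join M (diff M w y) w'))"
  proof (rule le_if_primes)
    fix Q assume "is_prime Q" "one M \<in> Q"
    then show "join M y (join M (diff M w y) w') \<in> Q"
      using w compl[of Q] prime_diff_cover[of Q w y] by (auto simp: prime_join_iff)
  qed (use w in auto)
  then have "le (compl y) (join M (diff M w y) w')"
    using w by (simp add: diff_le_iff)
  moreover have "compl y \<in> P"
    using prime_up[OF P] le w by simp
  ultimately have "join M (diff M w y) w' \<in> P"
    using prime_up[OF P(1)] w by simp
  then show "diff M w y \<in> P"
    using P compl w prime_join_iff[of P "diff M w y" w'] by auto
qed (use w in auto)

text \<open>This is primeness of the minimal prime filter below \<open>P\<close>, which consists of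
  the \<open>x\<close> with \<open>reg x \<in> P\<close>.\<close>

lemma prime_reg_join:
  assumes P: "is_prime P" and yd: "y \<in> univ M" "d \<in> univ M" and "reg (join M y d) \<in> P"
  shows "reg y \<in> P \<or> reg d \<in> P"
proof (rule ccontr)
  assume no: "\<not> ?thesis"
  \<comment> \<open>\<open>w\<close> is the part of \<open>reg (join M y d)\<close> outside
    \<open>reg y\<close> and \<open>reg d\<close>, and \<open>w'\<close> is its complement.
    Subtracting \<open>y\<close> and then \<open>d\<close> leaves \<open>w\<close> unchanged by
    \<open>complemented_le_diff\<close>; but \<open>w\<close> lies below \<open>join M y d\<close>,
    so nothing can be left.\<close>
  define w where "w = meet M (meet M (compl y) (compl d)) (reg (join M y d))"
  define w' where "w' = join M (join M (reg y) (reg d)) (compl (join M y d))"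
  have c: "w \<in> univ M" "w' \<in> univ M"
    using yd by (auto simp: w_def w'_def)
  have compl: "w \<in> Q \<longleftrightarrow> w' \<notin> Q" if "is_prime Q" for Q
    unfolding w_def w'_def using that yd
    by (simp add: prime_meet_iff prime_join_iff prime_compl_iff[of Q y]
        prime_compl_iff[of Q d] prime_compl_iff[of Q "join M y d"])
  have wy: "le w (compl y)" and wd: "le w (compl d)"
    by (rule le_if_primes; use yd c in \<open>simp add: w_def prime_meet_iff\<close>)+
  have "le w (join M y d)"
  proof (rule le_if_primes)
    fix Q assume Q: "is_prime Q" "w \<in> Q"
    then have "reg (join M y d) \<in> Q"
      using yd by (simp add: w_def prime_meet_iff)
    then show "join M y d \<in> Q"
      using prime_up[OF Q(1)] reg_le yd by simp
  qed (use c yd in auto)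
  then have "le (diff M w y) d"
    using c yd by (simp add: diff_le_iff)
  with complemented_le_diff[OF c yd(1) compl wy] have "le w d"
    using le_trans[of w "diff M w y" d] c yd by simp
  then have "le (diff M w d) (zero M)"
    using c yd le_joinI1[of d "zero M" w] by (simp add: diff_le_iff)
  with complemented_le_diff[OF c yd(2) compl wd] have "le w (zero M)"
    using le_trans[of w "diff M w d" "zero M"] c yd by simp
  then have "w = zero M"
    using le_zeroD c by simp
  moreover have "w \<in> P"
    using no assms by (simp add: w_def prime_meet_iff prime_compl_iff[of P y] prime_compl_iff[of P d])
  ultimately show False
    using prime_zero P by simp
qed

lemma prime_reg_up:
  assumes "is_prime P" "x \<in> univ M" "y \<in> univ M" "le x y" "reg x \<in> P"
  shows "reg y \<in> P"
  using prime_up[OF assms(1,5)] reg_mono assms by simp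

lemma diff_le_compl:
  assumes xy: "x \<in> univ M" "y \<in> univ M"
  shows "le (diff M x y) (compl y)"
proof -
  have "le x (join M y (compl y))"
    using le_trans[OF xy(1) one_closed _ le_one[OF xy(1)] one_le_join_compl[OF xy(2)]]
      join_comm[of y "compl y"] xy by simp
  then show ?thesis
    using xy by (simp add: diff_le_iff)
qed

text \<open>For the converse, \<open>x\<close> lies below the join of \<open>y\<close> and
  \<open>x - y\<close>, and \<open>prime_reg_join\<close> puts \<open>reg\<close> of one of the two
  into \<open>P\<close>.\<close>

lemma prime_reg_diff_iff:
  assumes P: "is_prime P" and xy: "x \<in> univ M" "y \<in> univ M"
  shows "reg (diff M x y) \<in> P \<longleftrightarrow> reg x \<in> P \<and> reg y \<notin> P"
proof
  assume r: "reg (diff M x y) \<in> P"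
  have "le (diff M x y) (compl y)"
    by (rule diff_le_compl[OF xy])
  moreover have "diff M x y \<in> P"
    using prime_up[OF P r] reg_le xy by simp
  ultimately have "compl y \<in> P"
    using prime_up[OF P] xy by simp
  moreover have "reg x \<in> P"
    by (rule prime_reg_up[OF P _ _ _ r]) (use xy diff_le in auto)
  ultimately show "reg x \<in> P \<and> reg y \<notin> P"
    using prime_compl_iff P xy by simp
next
  assume r: "reg x \<in> P \<and> reg y \<notin> P"
  have "reg (join M y (diff M x y)) \<in> P"
    by (rule prime_reg_up[OF P, of x]) (use r xy in \<open>auto simp: le_def le_join_diff\<close>)
  then show "reg (diff M x y) \<in> P"
    using prime_reg_join[OF P, of y "diff M x y"] r xy by simp
qed

text \<open>Dually, \<open>x - y\<close> lies in \<open>P\<close> iff some prime filter inside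
  \<open>P\<close> contains \<open>x\<close> but not \<open>y\<close>. The two disjuncts are the two
  candidates, \<open>P\<close> itself and the minimal one; \<open>depth_two\<close> excludes any
  other.\<close>

lemma prime_diff_iff:
  assumes P: "is_prime P" and xy: "x \<in> univ M" "y \<in> univ M"
  shows "diff M x y \<in> P \<longleftrightarrow> x \<in> P \<and> y \<notin> P \<or> reg x \<in> P \<and> reg y \<notin> P"
proof
  assume d: "diff M x y \<in> P"
  have x: "x \<in> P"
    using prime_up[OF P d] diff_le xy by simp
  have "le (diff M x y) (compl y)"
    by (rule diff_le_compl[OF xy])
  then have "compl y \<in> P"
    using prime_up[OF P d] xy by simp
  then have ry: "reg y \<notin> P"
    using prime_compl_iff P xy by simp
  have "reg x \<in> P" if y: "y \<in> P"
  proof (rule ccontr)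
    assume rx: "reg x \<notin> P"
    \<comment> \<open>The boundary \<open>z\<close> makes up \<open>x\<close> together with
      \<open>reg x\<close>. As \<open>reg x\<close> is not in \<open>P\<close>, the element
      \<open>z - y\<close> must be, although \<open>depth_two\<close> makes it disjoint from
      \<open>y\<close>.\<close>
    define z where "z = meet M (compl x) x"
    have z: "z \<in> univ M"
      using xy by (simp add: z_def)
    have "le (diff M x y) (join M (reg x) (diff M z y))"
    proof -
      have "le x (join M y (join M (reg x) (diff M z y)))"
      proof (rule le_if_primes)
        fix Q assume Q: "is_prime Q" "x \<in> Q"
        show "join M y (join M (reg x) (diff M z y)) \<in> Q"
        proof (cases "reg x \<in> Q")
          case False
          then have "z \<in> Q"
            using Q xy by (simp add: z_def prime_meet_iff prime_compl_iff)
          then have "y \<in> Q \<or> diff M z y \<in> Q"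
            using prime_diff_cover Q z xy by simp
          then show ?thesis
            using Q xy z by (auto simp: prime_join_iff)
        qed (use Q xy z in \<open>auto simp: prime_join_iff\<close>)
      qed (use xy z in auto)
      then show ?thesis
        using xy z by (simp add: diff_le_iff)
    qed
    then have "join M (reg x) (diff M z y) \<in> P"
      using prime_up[OF P d] xy z by simp
    then have "diff M z y \<in> P"
      using rx P xy z by (simp add: prime_join_iff)
    then have "meet M (diff M z y) y \<in> P"
      using y P xy z by (simp add: prime_meet_iff)
    then show False
      using depth_two[OF xy] prime_zero[OF P] by (simp add: z_def)
  qed
  with x ry show "x \<in> P \<and> y \<notin> P \<or> reg x \<in> P \<and> reg y \<notin> P"
    by blast
next
  assume "x \<in> P \<and> y \<notin> P \<or> reg x \<in> P \<and> reg y \<notin> P"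
  then show "diff M x y \<in> P"
    using prime_diff_cover[OF P xy] prime_reg_diff_iff[OF P xy] reg_le[of "diff M x y"] xy
      prime_up[OF P, of "reg (diff M x y)" "diff M x y"] by auto
qed

text \<open>\<open>reg x \<in> P\<close> expresses that \<open>x\<close> lies in the minimal prime
  filter below \<open>P\<close>.\<close>

definition char_of :: "'a set \<Rightarrow> 'a \<Rightarrow> nat" where
  "char_of P x = (if reg x \<in> P then 2 else if x \<in> P then 1 else 0)"

lemma prime_regD: "is_prime P \<Longrightarrow> x \<in> univ M \<Longrightarrow> reg x \<in> P \<Longrightarrow> x \<in> P"
  using prime_up[of P "reg x" x] reg_le[of x] by simp

lemma prime_reg_join_iff:
  assumes "is_prime P" "x \<in> univ M" "y \<in> univ M"
  shows "reg (join M x y) \<in> P \<longleftrightarrow> reg x \<in> P \<or> reg y \<in> P"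
  using prime_reg_join[OF assms] prime_reg_up[of P x "join M x y"] prime_reg_up[of P y "join M x y"]
    assms by (auto simp: le_join1 le_join2)

text \<open>A De Morgan law, \<open>compl (meet M x y)\<close> below the join of
  \<open>compl x\<close> and \<open>compl y\<close>, is what closes the minimal prime filter under
  meets.\<close>

lemma prime_reg_meet_iff:
  assumes P: "is_prime P" and xy: "x \<in> univ M" "y \<in> univ M"
  shows "reg (meet M x y) \<in> P \<longleftrightarrow> reg x \<in> P \<and> reg y \<in> P"
proof -
  have "le (compl (meet M x y)) (join M (compl x) (compl y))"
    unfolding diff_le_iff[OF one_closed meet_closed[OF xy]
        join_closed[OF diff_closed[OF one_closed xy(1)] diff_closed[OF one_closed xy(2)]]]
  proof (rule le_if_primes)
    fix Q assume "is_prime Q" "one M \<in> Q"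
    then show "join M (meet M x y) (join M (compl x) (compl y)) \<in> Q"
      using xy prime_diff_cover[of Q "one M" x] prime_diff_cover[of Q "one M" y]
      by (auto simp: prime_join_iff prime_meet_iff)
  qed (use xy in auto)
  then have "compl (meet M x y) \<in> P \<Longrightarrow> compl x \<in> P \<or> compl y \<in> P"
    using prime_up[OF P, of "compl (meet M x y)" "join M (compl x) (compl y)"] xy P
    by (simp add: prime_join_iff)
  then show ?thesis
    using prime_reg_up[of P "meet M x y" x] prime_reg_up[of P "meet M x y" y] xy P
      prime_compl_iff[of P x] prime_compl_iff[of P y] prime_compl_iff[of P "meet M x y"]
    by (auto simp: meet_le1 meet_le2)
qed

lemma char_of_in_chars:
  assumes P: "is_prime P"
  shows "char_of P \<in> chars M"
proof -
  have "compl (one M) = zero M"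
    by (rule le_zeroD) (simp_all add: diff_le_iff le_join1)
  moreover have "compl (zero M) = one M"
  proof (intro le_antisym le_if_primes le_one)
    fix Q assume "is_prime Q" "one M \<in> Q"
    then show "compl (zero M) \<in> Q"
      using prime_diff_cover[of Q "one M" "zero M"] prime_zero[of Q] by simp
  qed (simp_all add: prime_one)
  ultimately have "char_of P (one M) = 2" "char_of P (zero M) = 0"
    using P by (simp_all add: char_of_def prime_one prime_zero)
  moreover have "char_of P (join M x y) = max (char_of P x) (char_of P y)"
    if "x \<in> univ M" "y \<in> univ M" for x y
    using that P by (simp add: char_of_def prime_join_iff prime_reg_join_iff)
  moreover have "char_of P (meet M x y) = min (char_of P x) (char_of P y)"
    if "x \<in> univ M" "y \<in> univ M" for x y
    using that P prime_regD[OF P, of x] prime_regD[OF P, of y]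
    by (simp add: char_of_def prime_meet_iff prime_reg_meet_iff)
  moreover have "char_of P (diff M x y) = df3 (char_of P x) (char_of P y)"
    if xy: "x \<in> univ M" "y \<in> univ M" for x y
    using prime_diff_iff[OF P xy] prime_reg_diff_iff[OF P xy] prime_regD[OF P xy(1)]
      prime_regD[OF P xy(2)]
    unfolding char_of_def df3_def
    by (cases "reg x \<in> P"; cases "reg y \<in> P"; cases "x \<in> P"; cases "y \<in> P") simp_all
  ultimately show ?thesis
    by (auto simp: chars_def char_of_def)
qed

text \<open>A prime filter is the set where its character is non-zero, so prime separation carries
  over. From here on, equations in the algebra are checked by computing in the three-element
  chain.\<close>

lemma eq_if_chars:
  assumes "x \<in> univ M" "y \<in> univ M" "\<And>\<chi>. \<chi> \<in> chars M \<Longrightarrow> \<chi> x = \<chi> y"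
  shows "x = y"
proof -
  have "x \<in> P \<longleftrightarrow> y \<in> P" if P: "is_prime P" for P
  proof -
    have "z \<in> P \<longleftrightarrow> char_of P z \<noteq> 0" if "z \<in> univ M" for z
      using prime_regD[OF P that] by (simp add: char_of_def)
    with assms(1,2) assms(3)[OF char_of_in_chars[OF P]] show ?thesis by simp
  qed
  then show ?thesis
    by (intro le_antisym le_if_primes assms(1,2)) auto
qed

end

text \<open>Characters extend along embeddings: separate the filter generated by the image of the prime
  filter of the character from the ideal generated by the image of its complement.\<close>

lemma char_lift:
  assumes M: "V5_algebra M" and N: "V5_algebra N" and f: "embedding f M N" and \<chi>: "\<chi> \<in> chars M"
  obtains \<chi>' where "\<chi>' \<in> chars N" "\<And>x. x \<in> univ M \<Longrightarrow> \<chi>' (f x) = \<chi> x"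
proof -
  interpret M: V5_algebra M by (fact M)
  interpret N: V5_algebra N by (fact N)
  have fc: "f x \<in> univ N" if "x \<in> univ M" for x
    using that f by (auto simp: embedding_def)
  have fh: "f (join M x y) = join N (f x) (f y)" "f (meet M x y) = meet N (f x) (f y)"
    "f (diff M x y) = diff N (f x) (f y)" if "x \<in> univ M" "y \<in> univ M" for x y
    using that f by (auto simp: embedding_def)
  have f01: "f (zero M) = zero N" "f (one M) = one N"
    using f by (auto simp: embedding_def)
  have fle: "M.le x y" if "N.le (f x) (f y)" "x \<in> univ M" "y \<in> univ M" for x y
    using that f by (auto simp: M.le_def N.le_def embedding_def inj_on_def)
  define F where "F = {z \<in> univ N. \<exists>x\<in>univ M. \<chi> x \<noteq> 0 \<and> N.le (f x) z}"
  define I where "I = {z \<in> univ N. \<exists>x\<in>univ M. \<chi> x = 0 \<and> N.le z (f x)}"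
  have "N.is_filter F"
    unfolding N.is_filter_def
  proof (intro conjI ballI impI)
    show "F \<subseteq> univ N"
      by (auto simp: F_def)
    show "one N \<in> F"
      unfolding F_def using \<chi> f01 by (auto simp: char_one intro!: bexI[of _ "one M"] N.le_refl)
  next
    fix a b assume "a \<in> F" "b \<in> F"
    then obtain x y where a: "a \<in> univ N" "x \<in> univ M" "\<chi> x \<noteq> 0" "N.le (f x) a"
      and b: "b \<in> univ N" "y \<in> univ M" "\<chi> y \<noteq> 0" "N.le (f y) b"
      by (auto simp: F_def)
    have "\<chi> (meet M x y) \<noteq> 0"
      using a b \<chi> by (simp add: char_meet)
    moreover have "N.le (f (meet M x y)) (meet N a b)"
      using a b fc by (auto simp: fh intro!: N.le_meetI intro: N.le_meet1 N.le_meet2)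
    ultimately show "meet N a b \<in> F"
      unfolding F_def using a b by blast
  next
    fix a b assume "a \<in> F" "b \<in> univ N" "N.le a b"
    then show "b \<in> F"
      unfolding F_def using N.le_trans[OF fc _ \<open>b \<in> univ N\<close>] by blast
  qed
  moreover have "N.is_ideal I"
    unfolding N.is_ideal_def
  proof (intro conjI ballI impI)
    show "I \<subseteq> univ N"
      by (auto simp: I_def)
    show "zero N \<in> I"
      unfolding I_def using \<chi> f01 by (auto simp: char_zero intro!: bexI[of _ "zero M"] N.le_refl)
  next
    fix a b assume "a \<in> I" "b \<in> I"
    then obtain x y where a: "a \<in> univ N" "x \<in> univ M" "\<chi> x = 0" "N.le a (f x)"
      and b: "b \<in> univ N" "y \<in> univ M" "\<chi> y = 0" "N.le b (f y)"
      by (auto simp: I_def)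
    have "\<chi> (join M x y) = 0"
      using a b \<chi> by (simp add: char_join)
    moreover have "N.le (join N a b) (f (join M x y))"
      using a b fc by (auto simp: fh intro!: N.join_leI intro: N.le_joinI1 N.le_joinI2)
    ultimately show "join N a b \<in> I"
      unfolding I_def using a b by blast
  next
    fix a b assume "a \<in> I" "b \<in> univ N" "N.le b a"
    then show "b \<in> I"
      unfolding I_def using N.le_trans[OF \<open>b \<in> univ N\<close> _ fc] by blast
  qed
  moreover have "F \<inter> I = {}"
  proof (rule ccontr)
    assume "F \<inter> I \<noteq> {}"
    then obtain z x y where z: "z \<in> univ N" and x: "x \<in> univ M" "\<chi> x \<noteq> 0" "N.le (f x) z"
      and y: "y \<in> univ M" "\<chi> y = 0" "N.le z (f y)"
      by (auto simp: F_def I_def)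
    have "M.le x y"
      using N.le_trans[of "f x" z "f y"] x y z fc by (intro fle) auto
    then have "min (\<chi> x) (\<chi> y) = \<chi> x"
      using char_meet[OF \<chi>, of x y] x y by (simp add: M.le_def)
    with x y show False by simp
  qed
  ultimately obtain P where P: "N.is_prime P" "F \<subseteq> P" "P \<inter> I = {}"
    by (rule N.prime_filter_exists)
  have in_P: "f x \<in> P \<longleftrightarrow> \<chi> x \<noteq> 0" if "x \<in> univ M" for x
  proof (cases "\<chi> x = 0")
    case True
    then have "f x \<in> I"
      unfolding I_def using that fc N.le_refl by blast
    with True P show ?thesis by blast
  next
    case False
    then have "f x \<in> F"
      unfolding F_def using that fc N.le_refl by blast
    with False P show ?thesis by blast
  qed
  have "N.char_of P (f x) = \<chi> x" if x: "x \<in> univ M" for x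
  proof -
    \<comment> \<open>\<open>P\<close> lies over the filter of non-zero values by construction. As
      \<open>reg\<close> is a term, \<open>f\<close> commutes with it, so the values 2 are recovered
      as well.\<close>
    have "N.reg (f x) = f (M.reg x)"
      using x f01 by (simp add: fh)
    then have "N.reg (f x) \<in> P \<longleftrightarrow> \<chi> x = 2"
      using x char_le[OF \<chi> x] in_P[of "M.reg x"] \<chi> by (simp add: char_simps df3_def)
    then show ?thesis
      using in_P[OF x] char_le[OF \<chi> x] by (simp add: N.char_of_def)
  qed
  with that N.char_of_in_chars[OF P(1)] show thesis by blast
qed

section \<open>Splitting elements in models of D5 and S5\<close>

locale V5_dense = V5_algebra +
  assumes D5: "\<And>a. a \<in> univ M \<Longrightarrow> a = compl (compl a) \<Longrightarrow> a \<noteq> zero M \<Longrightarrow>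
      \<exists>b\<in>univ M. b \<noteq> zero M \<and> diff M a b = a \<and> meet M b a = b"
    and S5: "\<And>a b1 b2. a \<in> univ M \<Longrightarrow> b1 \<in> univ M \<Longrightarrow> b2 \<in> univ M \<Longrightarrow>
      diff M a (join M b1 b2) = a \<Longrightarrow> meet M (join M b1 b2) a = join M b1 b2 \<Longrightarrow> a \<noteq> zero M \<Longrightarrow>
      meet M (meet M b1 b2) (compl (compl a)) = zero M \<Longrightarrow>
      \<exists>a1\<in>univ M. \<exists>a2\<in>univ M. a1 \<noteq> zero M \<and> a2 \<noteq> zero M \<and>
        diff M a a2 = a1 \<and> meet M b1 a1 = b1 \<and> diff M a a1 = a2 \<and> meet M b2 a2 = b2 \<and>
        meet M a1 a2 = meet M b1 b2"

section \<open>Cells cut out by a finite tuple\<close>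

context V5_algebra
begin

lemma nonzero_iff_char:
  assumes "x \<in> univ M"
  shows "x \<noteq> zero M \<longleftrightarrow> (\<exists>\<chi>\<in>chars M. \<chi> x \<noteq> 0)"
  using eq_if_chars[OF assms zero_closed] char_zero by metis

text \<open>At each character \<open>j\<close> takes the maximum of the family. The maximum is given
  by two bounds so that the empty family, with join 0, is included.\<close>

lemma finite_join:
  assumes "finite F" "\<And>f. f \<in> F \<Longrightarrow> h f \<in> univ M"
  obtains j where "j \<in> univ M" "\<And>\<chi> f. \<chi> \<in> chars M \<Longrightarrow> f \<in> F \<Longrightarrow> \<chi> (h f) \<le> \<chi> j"
    "\<And>\<chi>. \<chi> \<in> chars M \<Longrightarrow> \<chi> j = 0 \<or> (\<exists>f\<in>F. \<chi> j = \<chi> (h f))"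
proof -
  have "\<exists>j\<in>univ M. \<forall>\<chi>\<in>chars M.
      (\<forall>f\<in>F. \<chi> (h f) \<le> \<chi> j) \<and> (\<chi> j = 0 \<or> (\<exists>f\<in>F. \<chi> j = \<chi> (h f)))"
    using assms
  proof (induction F rule: finite_induct)
    case empty
    show ?case by (intro bexI[of _ "zero M"]) (auto simp: char_zero)
  next
    case (insert x F)
    then obtain j where j: "j \<in> univ M" "\<And>\<chi> f. \<chi> \<in> chars M \<Longrightarrow> f \<in> F \<Longrightarrow> \<chi> (h f) \<le> \<chi> j"
      "\<And>\<chi>. \<chi> \<in> chars M \<Longrightarrow> \<chi> j = 0 \<or> (\<exists>f\<in>F. \<chi> j = \<chi> (h f))"
      by (metis insertI2)
    have hx: "h x \<in> univ M"
      using insert.prems by simp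
    show ?case
    proof (intro bexI ballI conjI)
      fix \<chi> assume \<chi>: "\<chi> \<in> chars M"
      note v = char_join[OF \<chi> hx j(1)]
      show "\<chi> (h f) \<le> \<chi> (join M (h x) j)" if "f \<in> insert x F" for f
        using that v j(2)[OF \<chi>, of f] by auto
      show "\<chi> (join M (h x) j) = 0 \<or> (\<exists>f\<in>insert x F. \<chi> (join M (h x) j) = \<chi> (h f))"
        using v j(3)[OF \<chi>] by (auto simp: max_def)
    qed (use hx j in auto)
  qed
  with that show thesis by blast
qed

text \<open>\<open>compl (g i)\<close> and \<open>reg (g i)\<close> have only the values 0 and 2 and
  test whether \<open>mn3 (\<chi> (g i))\<close> is 0 or 2. The cell is the meet of such
  tests.\<close>

lemma regular_cell:
  assumes "finite A" "\<And>i. i \<in> A \<Longrightarrow> g i \<in> univ M" "\<And>i. i \<in> A \<Longrightarrow> p i = 0 \<or> p i = 2"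
  shows "\<exists>r\<in>univ M. \<forall>\<chi>\<in>chars M. \<chi> r = (if \<forall>i\<in>A. mn3 (\<chi> (g i)) = p i then 2 else 0)"
  using assms
proof (induction A rule: finite_induct)
  case empty
  show ?case by (intro bexI[of _ "one M"]) (auto simp: char_one)
next
  case (insert i A)
  then obtain r where r: "r \<in> univ M"
    "\<And>\<chi>. \<chi> \<in> chars M \<Longrightarrow> \<chi> r = (if \<forall>i\<in>A. mn3 (\<chi> (g i)) = p i then 2 else 0)"
    by (metis insertI2)
  have gi: "g i \<in> univ M"
    using insert.prems by simp
  define q where "q = (if p i = 0 then compl (g i) else reg (g i))"
  have q: "q \<in> univ M"
    using gi by (simp add: q_def)
  have qv: "\<chi> q = (if mn3 (\<chi> (g i)) = p i then 2 else 0)" if \<chi>: "\<chi> \<in> chars M" for \<chi>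
    using insert.prems(2)[of i] char_le[OF \<chi> gi] gi \<chi>
    by (auto simp: q_def char_simps df3_def mn3_def)
  show ?case
  proof (intro bexI[of _ "meet M r q"] ballI)
    fix \<chi> assume \<chi>: "\<chi> \<in> chars M"
    show "\<chi> (meet M r q) = (if \<forall>j\<in>insert i A. mn3 (\<chi> (g j)) = p j then 2 else 0)"
      using r(2)[OF \<chi>] qv[OF \<chi>] char_meet[OF \<chi> r(1) q] by auto
  qed (use r q in auto)
qed

text \<open>The value 1 at \<open>i0\<close> is what lets a single pattern be isolated: inside the
  regular cell of the minimal pattern, \<open>g i0\<close> has only the values 0 and 1 and provides
  a small element to be trimmed coordinate by coordinate.\<close>

lemma small_cell:
  assumes "finite A" "\<And>i. i \<in> A \<Longrightarrow> g i \<in> univ M" "\<And>i. i \<in> A \<Longrightarrow> p i \<le> 2"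
    and i0: "i0 \<in> A" "p i0 = 1"
  shows "\<exists>e\<in>univ M. \<forall>\<chi>\<in>chars M. \<chi> e = (if \<forall>i\<in>A. \<chi> (g i) = p i then 1 else 0)"
proof -
  obtain r where r: "r \<in> univ M"
    "\<And>\<chi>. \<chi> \<in> chars M \<Longrightarrow> \<chi> r = (if \<forall>i\<in>A. mn3 (\<chi> (g i)) = mn3 (p i) then 2 else 0)"
  proof -
    have "\<And>i. mn3 (p i) = 0 \<or> mn3 (p i) = 2"
      by (simp add: mn3_def)
    from regular_cell[of A g "\<lambda>i. mn3 (p i)", OF assms(1,2) this] that show thesis by blast
  qed
  have r02: "\<chi> r = 0 \<or> \<chi> r = 2" if "\<chi> \<in> chars M" for \<chi>
    using r(2)[OF that] by auto
  have small: "\<chi> (g i) \<le> 1" if "\<chi> \<in> chars M" "\<chi> r \<noteq> 0" "i \<in> A" "p i \<le> 1" for \<chi> i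
    using that r(2)[of \<chi>] char_le[OF that(1) assms(2)[OF that(3)]]
    by (auto simp: mn3_def split: if_splits)
  have big: "\<chi> (g i) = 2" if "\<chi> \<in> chars M" "\<chi> r \<noteq> 0" "i \<in> A" "p i = 2" for \<chi> i
    using that r(2)[of \<chi>] by (auto simp: mn3_def split: if_splits)
  have "\<exists>e\<in>univ M. \<forall>\<chi>\<in>chars M. \<chi> e = (if \<chi> r = 2 \<and> (\<forall>i\<in>insert i0 B. \<chi> (g i) = p i) then 1 else 0)"
    if "finite B" "B \<subseteq> A" for B
    using that
  proof (induction B rule: finite_induct)
    case empty
    have "\<chi> (meet M r (g i0)) = (if \<chi> r = 2 \<and> \<chi> (g i0) = 1 then 1 else 0)" if "\<chi> \<in> chars M" for \<chi>
      using small[OF that _ i0(1)] r02[OF that] i0(2) char_meet[OF that r(1) assms(2)[OF i0(1)]]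
      by (auto simp: min_def)
    then show ?case
      using r i0 assms(2)[OF i0(1)] by (intro bexI[of _ "meet M r (g i0)"]) auto
  next
    case (insert i B)
    then obtain e where e: "e \<in> univ M"
      "\<And>\<chi>. \<chi> \<in> chars M \<Longrightarrow> \<chi> e = (if \<chi> r = 2 \<and> (\<forall>i\<in>insert i0 B. \<chi> (g i) = p i) then 1 else 0)"
      by auto
    have iA: "i \<in> A" and gi: "g i \<in> univ M"
      using insert.prems assms(2) by auto
    \<comment> \<open>On \<open>r\<close>, a coordinate with \<open>p i \<le> 1\<close> takes only
      the values 0 and 1. Against the value 1 of \<open>e\<close>, the difference tests for 0 and
      the meet for 1; a coordinate with \<open>p i = 2\<close> is already fixed by
      \<open>r\<close>.\<close>
    define e' where "e' = (if p i = 0 then diff M e (g i) else if p i = 1 then meet M e (g i) else e)"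
    have e': "e' \<in> univ M"
      using e gi by (simp add: e'_def)
    have e'v: "\<chi> e' = (if \<chi> e = 1 \<and> \<chi> (g i) = p i then 1 else 0)" if \<chi>: "\<chi> \<in> chars M" for \<chi>
    proof -
      have re: "\<chi> e = 0 \<or> \<chi> e = 1 \<and> \<chi> r = 2"
        using e(2)[OF \<chi>] by auto
      consider "p i = 0" | "p i = 1" | "p i = 2"
        using assms(3)[OF iA] by linarith
      then show ?thesis
      proof cases
        case 1
        then show ?thesis
          using re small[OF \<chi> _ iA] gi e(1) \<chi> by (auto simp: e'_def char_diff df3_def)
      next
        case 2
        then show ?thesis
          using re small[OF \<chi> _ iA] gi e(1) \<chi> by (auto simp: e'_def char_meet)
      next
        case 3
        then show ?thesis
          using re big[OF \<chi> _ iA] by (auto simp: e'_def)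
      qed
    qed
    have "\<chi> e' = (if \<chi> r = 2 \<and> (\<forall>j\<in>insert i0 (insert i B). \<chi> (g j) = p j) then 1 else 0)"
      if \<chi>: "\<chi> \<in> chars M" for \<chi>
      using e(2)[OF \<chi>] e'v[OF \<chi>] by auto
    with e' show ?case by blast
  qed
  from this[OF assms(1) order_refl] obtain e where e: "e \<in> univ M"
    "\<And>\<chi>. \<chi> \<in> chars M \<Longrightarrow> \<chi> e = (if \<chi> r = 2 \<and> (\<forall>i\<in>insert i0 A. \<chi> (g i) = p i) then 1 else 0)"
    by blast
  have "\<chi> e = (if \<forall>i\<in>A. \<chi> (g i) = p i then 1 else 0)" if "\<chi> \<in> chars M" for \<chi>
    using e(2)[OF that] r(2)[OF that] i0 by auto
  with e(1) show ?thesis by blast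
qed

end

section \<open>Consequences of the density and splitting axioms\<close>

context V5_dense
begin

text \<open>S5 with \<open>b1\<close> and \<open>b2\<close> both 0. A difference in the chain is
  either 0 or the whole first argument, so at each character one part inherits the value of
  \<open>a\<close> and the other one vanishes.\<close>

lemma split_nonzero:
  assumes a: "a \<in> univ M" "a \<noteq> zero M"
  obtains a1 a2 where "a1 \<in> univ M" "a2 \<in> univ M" "a1 \<noteq> zero M" "a2 \<noteq> zero M"
    "\<And>\<chi>. \<chi> \<in> chars M \<Longrightarrow> \<chi> a1 = \<chi> a \<and> \<chi> a2 = 0 \<or> \<chi> a1 = 0 \<and> \<chi> a2 = \<chi> a"
proof -
  have 1: "diff M a (join M (zero M) (zero M)) = a"
    by (rule eq_if_chars) (use a in \<open>auto simp: char_simps df3_def\<close>)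
  have 2: "meet M (join M (zero M) (zero M)) a = join M (zero M) (zero M)"
    by (rule eq_if_chars) (use a in \<open>auto simp: char_simps df3_def\<close>)
  have 3: "meet M (meet M (zero M) (zero M)) (reg a) = zero M"
    by (rule eq_if_chars) (use a in \<open>auto simp: char_simps df3_def\<close>)
  obtain a1 a2 where s: "a1 \<in> univ M" "a2 \<in> univ M" "a1 \<noteq> zero M" "a2 \<noteq> zero M"
    "diff M a a2 = a1" "diff M a a1 = a2" "meet M a1 a2 = meet M (zero M) (zero M)"
    using S5[OF a(1) zero_closed zero_closed 1 2 a(2) 3] by blast
  have "\<chi> a1 = \<chi> a \<and> \<chi> a2 = 0 \<or> \<chi> a1 = 0 \<and> \<chi> a2 = \<chi> a" if \<chi>: "\<chi> \<in> chars M" for \<chi>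
    using char_diff[OF \<chi> a(1) s(2)] char_diff[OF \<chi> a(1) s(1)] char_meet[OF \<chi> s(1,2)]
      char_meet[OF \<chi> zero_closed zero_closed] char_zero[OF \<chi>] s(5-7)
    by (auto simp: df3_def min_def split: if_splits)
  with s that show thesis by blast
qed

lemma split_many:
  assumes "finite W" "W \<noteq> {}" "a \<in> univ M" "a \<noteq> zero M"
  shows "\<exists>h. (\<forall>v\<in>W. h v \<in> univ M \<and> h v \<noteq> zero M) \<and>
    (\<forall>\<chi>\<in>chars M. \<exists>v\<in>W. \<chi> (h v) = \<chi> a \<and> (\<forall>w\<in>W - {v}. \<chi> (h w) = 0))"
  using assms
proof (induction W arbitrary: a rule: finite_ne_induct)
  case (singleton v)
  then show ?case by (intro exI[of _ "\<lambda>_. a"]) auto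
next
  case (insert v W)
  obtain a1 a2 where s: "a1 \<in> univ M" "a2 \<in> univ M" "a1 \<noteq> zero M" "a2 \<noteq> zero M"
    "\<And>\<chi>. \<chi> \<in> chars M \<Longrightarrow> \<chi> a1 = \<chi> a \<and> \<chi> a2 = 0 \<or> \<chi> a1 = 0 \<and> \<chi> a2 = \<chi> a"
    using split_nonzero[OF insert.prems] by metis
  obtain h where h: "\<And>v. v \<in> W \<Longrightarrow> h v \<in> univ M \<and> h v \<noteq> zero M"
    "\<And>\<chi>. \<chi> \<in> chars M \<Longrightarrow> \<exists>v\<in>W. \<chi> (h v) = \<chi> a2 \<and> (\<forall>w\<in>W - {v}. \<chi> (h w) = 0)"
    using insert.IH[OF s(2,4)] by blast
  let ?h = "h(v := a1)"
  have "\<exists>u\<in>insert v W. \<chi> (?h u) = \<chi> a \<and> (\<forall>w\<in>insert v W - {u}. \<chi> (?h w) = 0)" if \<chi>: "\<chi> \<in> chars M" for \<chi>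
  proof -
    obtain u where u: "u \<in> W" "\<chi> (h u) = \<chi> a2" "\<forall>w\<in>W - {u}. \<chi> (h w) = 0"
      using h(2)[OF \<chi>] by blast
    from s(5)[OF \<chi>] show ?thesis
    proof
      assume a: "\<chi> a1 = \<chi> a \<and> \<chi> a2 = 0"
      then have "\<chi> (h w) = 0" if "w \<in> W" for w
        using u that by (cases "w = u") auto
      with a show ?thesis
        by (intro bexI[of _ v]) auto
    next
      assume "\<chi> a1 = 0 \<and> \<chi> a2 = \<chi> a"
      with u insert.hyps show ?thesis
        by (intro bexI[of _ u]) auto
    qed
  qed
  with h(1) s(1,3) show ?case
    by (intro exI[of _ ?h]) auto
qed

text \<open>S5 for a regular \<open>c\<close>: subtracting values at most 1 from the value 2 changes
  nothing, so \<open>b1\<close> and \<open>b2\<close> are strongly below \<open>c\<close>, and their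
  disjointness makes the two parts disjoint.\<close>

lemma split_regular:
  assumes c: "c \<in> univ M" "c \<noteq> zero M" "\<And>\<chi>. \<chi> \<in> chars M \<Longrightarrow> \<chi> c = 0 \<or> \<chi> c = 2"
    and b: "b1 \<in> univ M" "b2 \<in> univ M"
      "\<And>\<chi>. \<chi> \<in> chars M \<Longrightarrow> \<chi> b1 \<le> 1 \<and> \<chi> b2 \<le> 1 \<and> \<chi> b1 \<le> \<chi> c \<and> \<chi> b2 \<le> \<chi> c"
      "\<And>\<chi>. \<chi> \<in> chars M \<Longrightarrow> \<chi> b1 = 0 \<or> \<chi> b2 = 0"
  obtains c1 c2 where "c1 \<in> univ M" "c2 \<in> univ M" "c1 \<noteq> zero M" "c2 \<noteq> zero M"
    "\<And>\<chi>. \<chi> \<in> chars M \<Longrightarrow> \<chi> c1 = \<chi> c \<and> \<chi> c2 = 0 \<and> \<chi> b2 = 0 \<or> \<chi> c1 = 0 \<and> \<chi> c2 = \<chi> c \<and> \<chi> b1 = 0"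
proof -
  have 1: "diff M c (join M b1 b2) = c"
  proof (rule eq_if_chars)
    fix \<chi> assume \<chi>: "\<chi> \<in> chars M"
    show "\<chi> (diff M c (join M b1 b2)) = \<chi> c"
      using b(3)[OF \<chi>] c(3)[OF \<chi>] c(1) b(1,2) \<chi>
      by (auto simp: char_simps df3_def max_def split: if_splits)
  qed (use b c in auto)
  have 2: "meet M (join M b1 b2) c = join M b1 b2"
  proof (rule eq_if_chars)
    fix \<chi> assume \<chi>: "\<chi> \<in> chars M"
    show "\<chi> (meet M (join M b1 b2) c) = \<chi> (join M b1 b2)"
      using b(3)[OF \<chi>] c(1) b(1,2) \<chi> by (auto simp: char_simps)
  qed (use b c in auto)
  have 3: "meet M b1 b2 = zero M"
  proof (rule eq_if_chars)
    fix \<chi> assume \<chi>: "\<chi> \<in> chars M"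
    show "\<chi> (meet M b1 b2) = \<chi> (zero M)"
      using b(4)[OF \<chi>] b(1,2) \<chi> by (auto simp: char_simps)
  qed (use b c in auto)
  have 4: "meet M (meet M b1 b2) (reg c) = zero M"
    using c by (simp add: 3 zero_least)
  obtain c1 c2 where s: "c1 \<in> univ M" "c2 \<in> univ M" "c1 \<noteq> zero M" "c2 \<noteq> zero M"
    "diff M c c2 = c1" "meet M b1 c1 = b1" "diff M c c1 = c2" "meet M b2 c2 = b2"
    "meet M c1 c2 = zero M"
    using S5[OF c(1) b(1,2) 1 2 c(2) 4] unfolding 3 by blast
  have "\<chi> c1 = \<chi> c \<and> \<chi> c2 = 0 \<and> \<chi> b2 = 0 \<or> \<chi> c1 = 0 \<and> \<chi> c2 = \<chi> c \<and> \<chi> b1 = 0"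
    if \<chi>: "\<chi> \<in> chars M" for \<chi>
    using char_diff[OF \<chi> c(1) s(2)] char_diff[OF \<chi> c(1) s(1)] char_meet[OF \<chi> s(1,2)]
      char_meet[OF \<chi> b(1) s(1)] char_meet[OF \<chi> b(2) s(2)] char_zero[OF \<chi>] s(5-9)
    by (auto simp: df3_def min_def split: if_splits)
  with s that show thesis by blast
qed

text \<open>Splitting \<open>c\<close> around \<open>meet M s c\<close> and 0 leaves a non-zero
  regular part \<open>c2\<close> disjoint from \<open>s\<close>, to which D5 applies.\<close>

lemma small_below:
  assumes c: "c \<in> univ M" "c \<noteq> zero M" "\<And>\<chi>. \<chi> \<in> chars M \<Longrightarrow> \<chi> c = 0 \<or> \<chi> c = 2"
    and s: "s \<in> univ M" "\<And>\<chi>. \<chi> \<in> chars M \<Longrightarrow> \<chi> s \<le> 1"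
  obtains b where "b \<in> univ M" "b \<noteq> zero M"
    "\<And>\<chi>. \<chi> \<in> chars M \<Longrightarrow> \<chi> b \<le> 1 \<and> (\<chi> b \<noteq> 0 \<longrightarrow> \<chi> c = 2 \<and> \<chi> s = 0)"
proof -
  obtain c1 c2 where c12: "c1 \<in> univ M" "c2 \<in> univ M" "c1 \<noteq> zero M" "c2 \<noteq> zero M"
    "\<And>\<chi>. \<chi> \<in> chars M \<Longrightarrow> \<chi> c1 = \<chi> c \<and> \<chi> c2 = 0 \<and> \<chi> (zero M) = 0 \<or>
      \<chi> c1 = 0 \<and> \<chi> c2 = \<chi> c \<and> \<chi> (meet M s c) = 0"
  proof (rule split_regular[of c "meet M s c" "zero M"])
    fix \<chi> assume \<chi>: "\<chi> \<in> chars M"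
    show "\<chi> (meet M s c) \<le> 1 \<and> \<chi> (zero M) \<le> 1 \<and> \<chi> (meet M s c) \<le> \<chi> c \<and> \<chi> (zero M) \<le> \<chi> c"
      using s(1) s(2)[OF \<chi>] c(1) \<chi> by (simp add: char_simps min_le_iff_disj)
  qed (use s c in \<open>simp_all add: char_zero\<close>)
  have reg: "c2 = reg c2"
  proof (rule eq_if_chars)
    fix \<chi> assume \<chi>: "\<chi> \<in> chars M"
    show "\<chi> c2 = \<chi> (reg c2)"
      using c12(5)[OF \<chi>] c(3)[OF \<chi>] c12(2) \<chi> by (simp add: char_simps df3_def) auto
  qed (use c12 in auto)
  obtain b where b: "b \<in> univ M" "b \<noteq> zero M" "diff M c2 b = c2" "meet M b c2 = b"
    using D5[OF c12(2) reg c12(4)] by blast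
  have "\<chi> b \<le> 1 \<and> (\<chi> b \<noteq> 0 \<longrightarrow> \<chi> c = 2 \<and> \<chi> s = 0)" if \<chi>: "\<chi> \<in> chars M" for \<chi>
    using char_diff[OF \<chi> c12(2) b(1)] char_meet[OF \<chi> b(1) c12(2)] b(3,4) c12(5)[OF \<chi>]
      c(3)[OF \<chi>] char_meet[OF \<chi> s(1) c(1)]
    by (auto simp: df3_def min_def split: if_splits)
  with b that show thesis by blast
qed


text \<open>
  One regular cell \<open>c\<close> of the extension problem: \<open>Q\<close> indexes the small cells \<open>e p\<close> inside \<open>c\<close>, and the
  new element \<open>y\<close> has to take exactly the values \<open>F p\<close> on \<open>e p\<close> and exactly the values \<open>F0\<close> on the rest
  of \<open>c\<close>. Each \<open>e p\<close> is split according to \<open>F p\<close>; then \<open>c\<close> is split into \<open>d0\<close> and \<open>d2\<close> around the parts with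
  values in \<open>{0, 1}\<close> and those with value 2, and D5 supplies a small part \<open>b\<close> of \<open>d0\<close> for the value 1.
\<close>

lemma realize_cell:
  fixes e :: "'i \<Rightarrow> 'a" and F :: "'i \<Rightarrow> nat set"
  assumes c: "c \<in> univ M" "c \<noteq> zero M" "\<And>\<chi>. \<chi> \<in> chars M \<Longrightarrow> \<chi> c = 0 \<or> \<chi> c = 2"
    and Q: "finite Q"
    and e: "\<And>p. p \<in> Q \<Longrightarrow> e p \<in> univ M" "\<And>p. p \<in> Q \<Longrightarrow> e p \<noteq> zero M"
      "\<And>p \<chi>. p \<in> Q \<Longrightarrow> \<chi> \<in> chars M \<Longrightarrow> \<chi> (e p) \<le> 1 \<and> \<chi> (e p) \<le> \<chi> c"
      "\<And>p q \<chi>. p \<in> Q \<Longrightarrow> q \<in> Q \<Longrightarrow> \<chi> \<in> chars M \<Longrightarrow> \<chi> (e p) \<noteq> 0 \<Longrightarrow> \<chi> (e q) \<noteq> 0 \<Longrightarrow> p = q"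
    and F0: "F0 \<subseteq> {..2}" "F0 \<noteq> {}" "1 \<in> F0 \<Longrightarrow> 0 \<in> F0"
    and F: "\<And>p. p \<in> Q \<Longrightarrow> F p \<subseteq> {..2} \<and> F p \<noteq> {}"
      "\<And>p v. p \<in> Q \<Longrightarrow> v \<in> F p \<Longrightarrow> mn3 v \<in> F0"
  obtains y where "y \<in> univ M" "\<And>\<chi>. \<chi> \<in> chars M \<Longrightarrow> \<chi> c = 0 \<Longrightarrow> \<chi> y = 0"
    "\<And>\<chi>. \<chi> \<in> chars M \<Longrightarrow> \<chi> c = 2 \<Longrightarrow> \<forall>p\<in>Q. \<chi> (e p) = 0 \<Longrightarrow> \<chi> y \<in> F0"
    "\<And>p \<chi>. p \<in> Q \<Longrightarrow> \<chi> \<in> chars M \<Longrightarrow> \<chi> (e p) = 1 \<Longrightarrow> \<chi> y \<in> F p"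
    "\<And>v. v \<in> F0 \<Longrightarrow> \<exists>\<chi>\<in>chars M. \<chi> c = 2 \<and> (\<forall>p\<in>Q. \<chi> (e p) = 0) \<and> \<chi> y = v"
    "\<And>p v. p \<in> Q \<Longrightarrow> v \<in> F p \<Longrightarrow> \<exists>\<chi>\<in>chars M. \<chi> (e p) = 1 \<and> \<chi> y = v"
proof -
  have finF: "finite (F p)" if "p \<in> Q" for p
    using F(1)[OF that] finite_subset by blast
  have "\<forall>p\<in>Q. \<exists>h. (\<forall>v\<in>F p. h v \<in> univ M \<and> h v \<noteq> zero M) \<and>
    (\<forall>\<chi>\<in>chars M. \<exists>v\<in>F p. \<chi> (h v) = \<chi> (e p) \<and> (\<forall>w\<in>F p - {v}. \<chi> (h w) = 0))"
  proof
    fix p assume p: "p \<in> Q"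
    show "\<exists>h. (\<forall>v\<in>F p. h v \<in> univ M \<and> h v \<noteq> zero M) \<and>
      (\<forall>\<chi>\<in>chars M. \<exists>v\<in>F p. \<chi> (h v) = \<chi> (e p) \<and> (\<forall>w\<in>F p - {v}. \<chi> (h w) = 0))"
      by (rule split_many[OF finF[OF p] _ e(1,2)[OF p]]) (use F(1)[OF p] in simp)
  qed
  then obtain h where h0: "\<forall>p\<in>Q. (\<forall>v\<in>F p. h p v \<in> univ M \<and> h p v \<noteq> zero M) \<and>
    (\<forall>\<chi>\<in>chars M. \<exists>v\<in>F p. \<chi> (h p v) = \<chi> (e p) \<and> (\<forall>w\<in>F p - {v}. \<chi> (h p w) = 0))"
    by (rule bchoice[THEN exE])
  have h: "h p v \<in> univ M" "h p v \<noteq> zero M" if "p \<in> Q" "v \<in> F p" for p v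
    using h0 that by auto
  have hv: "\<exists>v\<in>F p. \<chi> (h p v) = \<chi> (e p) \<and> (\<forall>w\<in>F p - {v}. \<chi> (h p w) = 0)"
    if "p \<in> Q" "\<chi> \<in> chars M" for p \<chi>
    using h0 that by blast
  have h_le: "\<chi> (h p v) \<le> \<chi> (e p)" if t: "p \<in> Q" "v \<in> F p" "\<chi> \<in> chars M" for p v \<chi>
  proof -
    obtain u where "\<chi> (h p u) = \<chi> (e p)" "\<forall>w\<in>F p - {u}. \<chi> (h p w) = 0"
      using hv[OF t(1,3)] by blast
    then show ?thesis
      using t(2) by (cases "v = u") auto
  qed
  \<comment> \<open>The join of all parts \<open>h p v\<close> with label \<open>v\<close> in
    \<open>S\<close>, for all \<open>S\<close> at once; the sets \<open>{0,1}\<close>,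
    \<open>{2}\<close>, \<open>{1}\<close> and \<open>{0,1,2}\<close> will be used.\<close>
  have "\<forall>S. \<exists>j. j \<in> univ M \<and> (\<forall>\<chi>\<in>chars M.
      (\<forall>p\<in>Q. \<forall>v\<in>F p \<inter> S. \<chi> (h p v) \<le> \<chi> j) \<and>
      (\<chi> j = 0 \<or> (\<exists>p\<in>Q. \<exists>v\<in>F p \<inter> S. \<chi> j = \<chi> (h p v))))"
  proof
    fix S
    have fin: "finite (SIGMA p:Q. F p \<inter> S)"
      using Q finF by blast
    obtain j where j: "j \<in> univ M"
      "\<And>\<chi> f. \<chi> \<in> chars M \<Longrightarrow> f \<in> (SIGMA p:Q. F p \<inter> S) \<Longrightarrow> \<chi> (h (fst f) (snd f)) \<le> \<chi> j"
      "\<And>\<chi>. \<chi> \<in> chars M \<Longrightarrow> \<chi> j = 0 \<or> (\<exists>f\<in>SIGMA p:Q. F p \<inter> S. \<chi> j = \<chi> (h (fst f) (snd f)))"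
      by (rule finite_join[OF fin, of "\<lambda>f. h (fst f) (snd f)"]) (use h in auto)
    show "\<exists>j. j \<in> univ M \<and> (\<forall>\<chi>\<in>chars M.
      (\<forall>p\<in>Q. \<forall>v\<in>F p \<inter> S. \<chi> (h p v) \<le> \<chi> j) \<and>
      (\<chi> j = 0 \<or> (\<exists>p\<in>Q. \<exists>v\<in>F p \<inter> S. \<chi> j = \<chi> (h p v))))"
    proof (intro exI[of _ j] conjI ballI j(1))
      fix \<chi> assume \<chi>: "\<chi> \<in> chars M"
      show "\<chi> (h p v) \<le> \<chi> j" if "p \<in> Q" "v \<in> F p \<inter> S" for p v
        using j(2)[OF \<chi>, of "(p, v)"] that by simp
      show "\<chi> j = 0 \<or> (\<exists>p\<in>Q. \<exists>v\<in>F p \<inter> S. \<chi> j = \<chi> (h p v))"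
        using j(3)[OF \<chi>] by auto
    qed
  qed
  then obtain B where B0: "\<forall>S. B S \<in> univ M \<and> (\<forall>\<chi>\<in>chars M.
      (\<forall>p\<in>Q. \<forall>v\<in>F p \<inter> S. \<chi> (h p v) \<le> \<chi> (B S)) \<and>
      (\<chi> (B S) = 0 \<or> (\<exists>p\<in>Q. \<exists>v\<in>F p \<inter> S. \<chi> (B S) = \<chi> (h p v))))"
    by (rule choice[THEN exE])
  have B: "B S \<in> univ M" for S
    using B0 by blast
  have B_ge: "\<chi> (h p v) \<le> \<chi> (B S)" if "\<chi> \<in> chars M" "p \<in> Q" "v \<in> F p" "v \<in> S" for S \<chi> p v
    using B0 that by blast
  have B_eq: "\<chi> (B S) = 0 \<or> (\<exists>p\<in>Q. \<exists>v\<in>F p \<inter> S. \<chi> (B S) = \<chi> (h p v))"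
    if "\<chi> \<in> chars M" for S \<chi>
    using B0 that by blast
  \<comment> \<open>A character either misses all small cells, or meets exactly one, and in it
    exactly one part \<open>h p v\<close>; this determines its value on every
    \<open>B S\<close>.\<close>
  have dich: "(\<forall>p\<in>Q. \<chi> (e p) = 0) \<and> (\<forall>S. \<chi> (B S) = 0) \<or>
    (\<exists>p\<in>Q. \<exists>v\<in>F p. \<chi> (e p) = 1 \<and> (\<forall>w\<in>F p. \<chi> (h p w) = (if w = v then 1 else 0)) \<and>
      \<chi> c = 2 \<and> (\<forall>S. \<chi> (B S) = (if v \<in> S then 1 else 0)))"
    if \<chi>: "\<chi> \<in> chars M" for \<chi>
  proof (cases "\<forall>p\<in>Q. \<chi> (e p) = 0")
    case True
    have "\<chi> (B S) = 0" for S
      using B_eq[OF \<chi>, of S]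
    proof (elim disjE bexE)
      fix p v assume "p \<in> Q" "v \<in> F p \<inter> S" "\<chi> (B S) = \<chi> (h p v)"
      then show ?thesis
        using h_le[of p v, OF _ _ \<chi>] True by simp
    qed
    with True show ?thesis by blast
  next
    case False
    then obtain p where p: "p \<in> Q" "\<chi> (e p) \<noteq> 0" by blast
    obtain v where v: "v \<in> F p" "\<chi> (h p v) = \<chi> (e p)" "\<forall>w\<in>F p - {v}. \<chi> (h p w) = 0"
      using hv[OF p(1) \<chi>] by blast
    have e1: "\<chi> (e p) = 1" and c2: "\<chi> c = 2"
      using e(3)[OF p(1) \<chi>] c(3)[OF \<chi>] p(2) by auto
    have hq: "\<chi> (h q w) = (if q = p \<and> w = v then 1 else 0)" if "q \<in> Q" "w \<in> F q" for q w
    proof (cases "q = p")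
      case True
      then show ?thesis
        using v e1 that by auto
    next
      case False
      then have "\<chi> (e q) = 0"
        using e(4)[OF that(1) p(1) \<chi>] p(2) by blast
      then show ?thesis
        using h_le[OF that \<chi>] False by simp
    qed
    have "\<chi> (B S) = (if v \<in> S then 1 else 0)" for S
    proof (cases "v \<in> S")
      case True
      then have "\<chi> (B S) \<ge> 1"
        using B_ge[OF \<chi> p(1) v(1) True] hq[OF p(1) v(1)] by simp
      moreover have "\<chi> (B S) \<le> 1"
        using B_eq[OF \<chi>, of S]
      proof (elim disjE bexE)
        fix q w assume "q \<in> Q" "w \<in> F q \<inter> S" "\<chi> (B S) = \<chi> (h q w)"
        then show ?thesis
          using hq[of q w] by simp
      qed simp
      ultimately show ?thesis using True by simp
    next
      case False
      then have "\<chi> (h q w) = 0" if "q \<in> Q" "w \<in> F q \<inter> S" for q w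
        using hq[of q w] that by auto
      then show ?thesis
        using B_eq[OF \<chi>, of S] False by auto
    qed
    moreover have "\<forall>w\<in>F p. \<chi> (h p w) = (if w = v then 1 else 0)"
      using hq[OF p(1)] by simp
    ultimately show ?thesis
      using p v e1 c2 by blast
  qed
  have B_small: "\<chi> (B S) \<le> 1 \<and> \<chi> (B S) \<le> \<chi> c" if \<chi>: "\<chi> \<in> chars M" for \<chi> S
    using dich[OF \<chi>]
  proof (elim disjE conjE bexE)
    fix v assume "\<forall>S. \<chi> (B S) = (if v \<in> S then 1 else 0)" "\<chi> c = 2"
    then show ?thesis by simp
  qed simp
  have B_disj: "\<chi> (B S) = 0 \<or> \<chi> (B T) = 0" if \<chi>: "\<chi> \<in> chars M" and "S \<inter> T = {}" for \<chi> S T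
    using dich[OF \<chi>]
  proof (elim disjE conjE bexE)
    fix v assume v: "\<forall>S. \<chi> (B S) = (if v \<in> S then 1 else 0)"
    from that(2) have "v \<notin> S \<or> v \<notin> T" by blast
    then show ?thesis
      using v by (elim disjE) simp_all
  qed simp
  have F2: "v \<in> F0 \<Longrightarrow> v = 0 \<or> v = 1 \<or> v = 2" for v
    using F0(1) by auto
  have F2': "v = 0 \<or> v = 1 \<or> v = 2" if "p \<in> Q" "v \<in> F p" for p v
    using F(1)[OF that(1)] that(2) by auto
  have Bz: "2 \<in> F0 \<or> \<chi> (B {2}) = 0" "0 \<in> F0 \<or> \<chi> (B {0,1}) = 0" if \<chi>: "\<chi> \<in> chars M" for \<chi>
  proof -
    have mn: "mn3 0 = 0" "mn3 1 = 0" "mn3 2 = 2"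
      by (simp_all add: mn3_def)
    have "(2 \<in> F0 \<or> \<chi> (B {2}) = 0) \<and> (0 \<in> F0 \<or> \<chi> (B {0,1}) = 0)"
      using dich[OF \<chi>]
    proof (elim disjE conjE bexE)
      fix p v assume pv: "p \<in> Q" "v \<in> F p" and "\<forall>S. \<chi> (B S) = (if v \<in> S then 1 else 0)"
      then show ?thesis
        using F(2)[OF pv] F2'[OF pv] mn by auto
    qed simp
    then show "2 \<in> F0 \<or> \<chi> (B {2}) = 0" "0 \<in> F0 \<or> \<chi> (B {0,1}) = 0"
      by simp_all
  qed
  \<comment> \<open>\<open>F0\<close> contains 0 or 2, since 1 brings 0 with it. If only one of them
    occurs, \<open>c\<close> stays whole: by \<open>Bz\<close> no part carries a label for the other
    side.\<close>
  have "\<exists>d0 d2. d0 \<in> univ M \<and> d2 \<in> univ M \<and> (0 \<in> F0 \<longrightarrow> d0 \<noteq> zero M) \<and> (2 \<in> F0 \<longrightarrow> d2 \<noteq> zero M) \<and>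
    (\<forall>\<chi>\<in>chars M. \<chi> d0 = \<chi> c \<and> \<chi> d2 = 0 \<and> \<chi> (B {2}) = 0 \<and> (\<chi> c = 2 \<longrightarrow> 0 \<in> F0) \<or>
       \<chi> d0 = 0 \<and> \<chi> d2 = \<chi> c \<and> \<chi> (B {0,1}) = 0 \<and> (\<chi> c = 2 \<longrightarrow> 2 \<in> F0))"
  proof -
    consider "0 \<in> F0" "2 \<in> F0" | "0 \<in> F0" "2 \<notin> F0" | "0 \<notin> F0" "2 \<in> F0"
      using F0 F2 by fastforce
    then show ?thesis
    proof cases
      case 1
      obtain c1 c2 where "c1 \<in> univ M" "c2 \<in> univ M" "c1 \<noteq> zero M" "c2 \<noteq> zero M"
        "\<And>\<chi>. \<chi> \<in> chars M \<Longrightarrow> \<chi> c1 = \<chi> c \<and> \<chi> c2 = 0 \<and> \<chi> (B {2}) = 0 \<or>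
          \<chi> c1 = 0 \<and> \<chi> c2 = \<chi> c \<and> \<chi> (B {0,1}) = 0"
      proof (rule split_regular[of c "B {0,1}" "B {2}"])
        fix \<chi> assume \<chi>: "\<chi> \<in> chars M"
        show "\<chi> (B {0,1}) \<le> 1 \<and> \<chi> (B {2}) \<le> 1 \<and> \<chi> (B {0,1}) \<le> \<chi> c \<and> \<chi> (B {2}) \<le> \<chi> c"
          using B_small[OF \<chi>] by blast
        show "\<chi> (B {0,1}) = 0 \<or> \<chi> (B {2}) = 0"
          by (rule B_disj[OF \<chi>]) simp
      qed (use c B in blast)+
      with 1 show ?thesis by blast
    next
      case 2
      with c Bz show ?thesis
        by (intro exI[of _ c] exI[of _ "zero M"]) (simp add: char_zero)
    next
      case 3
      with c Bz show ?thesis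
        by (intro exI[of _ "zero M"] exI[of _ c]) (simp add: char_zero)
    qed
  qed
  then obtain d0 d2 where d: "d0 \<in> univ M" "d2 \<in> univ M"
    and d0: "0 \<in> F0 \<Longrightarrow> d0 \<noteq> zero M" and d2: "2 \<in> F0 \<Longrightarrow> d2 \<noteq> zero M"
    and dv: "\<And>\<chi>. \<chi> \<in> chars M \<Longrightarrow> \<chi> d0 = \<chi> c \<and> \<chi> d2 = 0 \<and> \<chi> (B {2}) = 0 \<and> (\<chi> c = 2 \<longrightarrow> 0 \<in> F0) \<or>
       \<chi> d0 = 0 \<and> \<chi> d2 = \<chi> c \<and> \<chi> (B {0,1}) = 0 \<and> (\<chi> c = 2 \<longrightarrow> 2 \<in> F0)"
    by auto
  have d02: "\<chi> d0 = 0 \<or> \<chi> d0 = 2" if \<chi>: "\<chi> \<in> chars M" for \<chi>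
    using dv[OF \<chi>] c(3)[OF \<chi>] by auto
  \<comment> \<open>\<open>B {0,1,2}\<close> joins all parts of all small cells, so avoiding it
    keeps \<open>b\<close> from disturbing the values prescribed there. If 1 is in \<open>F0\<close>
    then so is 0, hence \<open>d0\<close> is non-zero.\<close>
  have "\<exists>b\<in>univ M. (1 \<in> F0 \<longrightarrow> b \<noteq> zero M) \<and>
    (\<forall>\<chi>\<in>chars M. \<chi> b \<le> 1 \<and> (\<chi> b \<noteq> 0 \<longrightarrow> \<chi> d0 = 2 \<and> \<chi> (B {0,1,2}) = 0 \<and> 1 \<in> F0))"
  proof (cases "1 \<in> F0")
    case True
    obtain b where "b \<in> univ M" "b \<noteq> zero M"
      "\<And>\<chi>. \<chi> \<in> chars M \<Longrightarrow> \<chi> b \<le> 1 \<and> (\<chi> b \<noteq> 0 \<longrightarrow> \<chi> d0 = 2 \<and> \<chi> (B {0,1,2}) = 0)"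
      by (rule small_below[of d0 "B {0,1,2}"]) (use d(1) d0[OF F0(3)[OF True]] d02 B B_small in blast)+
    with True show ?thesis by blast
  next
    case False
    then show ?thesis
      by (intro bexI[of _ "zero M"]) (simp_all add: char_zero)
  qed
  then obtain b where bU: "b \<in> univ M" and b0: "(1 \<in> F0 \<longrightarrow> b \<noteq> zero M) \<and>
    (\<forall>\<chi>\<in>chars M. \<chi> b \<le> 1 \<and> (\<chi> b \<noteq> 0 \<longrightarrow> \<chi> d0 = 2 \<and> \<chi> (B {0,1,2}) = 0 \<and> 1 \<in> F0))"
    by (rule bexE)
  have b: "b \<in> univ M" "1 \<in> F0 \<Longrightarrow> b \<noteq> zero M"
    using bU b0 by simp_all
  have bv: "\<chi> b \<le> 1 \<and> (\<chi> b \<noteq> 0 \<longrightarrow> \<chi> d0 = 2 \<and> \<chi> (B {0,1,2}) = 0 \<and> 1 \<in> F0)"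
    if "\<chi> \<in> chars M" for \<chi>
    using b0 that by (elim conjE) (drule (1) bspec)
  \<comment> \<open>Value 2 comes from \<open>d2\<close>, which contains the parts labelled 2; value
    1 comes from \<open>b\<close> outside the small cells and from \<open>B {1}\<close> inside
    them.\<close>
  define y where "y = join M d2 (join M b (B {1}))"
  have y: "y \<in> univ M"
    using d b B by (simp add: y_def)
  have yv: "\<chi> y = max (\<chi> d2) (max (\<chi> b) (\<chi> (B {1})))" if "\<chi> \<in> chars M" for \<chi>
    using that d b B by (simp add: y_def char_join)
  have inner: "\<chi> y = v" if \<chi>: "\<chi> \<in> chars M" and p: "p \<in> Q" "\<chi> (e p) = 1" "v \<in> F p" "\<chi> (h p v) = 1"
    for \<chi> p v
  proof -
    obtain q u where q: "q \<in> Q" "u \<in> F q" "\<chi> (e q) = 1" "\<chi> c = 2"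
      "\<forall>w\<in>F q. \<chi> (h q w) = (if w = u then 1 else 0)"
      "\<forall>S. \<chi> (B S) = (if u \<in> S then 1 else 0)"
      using dich[OF \<chi>]
    proof (elim disjE conjE bexE)
      assume "\<forall>p\<in>Q. \<chi> (e p) = 0"
      with p show thesis by simp
    qed (rule that)
    have "q = p"
      using e(4)[OF q(1) p(1) \<chi>] p q by simp
    then have "u = v"
      using q(5) p by (metis zero_neq_one)
    consider "v = 0" | "v = 1" | "v = 2"
      using F2'[OF p(1,3)] by blast
    then show ?thesis
      by cases (use yv[OF \<chi>] bv[OF \<chi>] dv[OF \<chi>] q(4,6) \<open>u = v\<close> in auto)
  qed
  have outer: "\<chi> (B S) = 0" if \<chi>: "\<chi> \<in> chars M" and "\<forall>p\<in>Q. \<chi> (e p) = 0" for \<chi> S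
    using dich[OF \<chi>]
  proof (elim disjE conjE bexE)
    fix q assume "q \<in> Q" "\<chi> (e q) = 1"
    with that show ?thesis by simp
  qed simp
  have clear: "\<forall>p\<in>Q. \<chi> (e p) = 0" if \<chi>: "\<chi> \<in> chars M" and "\<chi> (B {0,1,2}) = 0" for \<chi>
    using dich[OF \<chi>]
  proof (elim disjE conjE bexE)
    fix p v assume "p \<in> Q" "v \<in> F p" "\<forall>S. \<chi> (B S) = (if v \<in> S then 1 else 0)"
    then show ?thesis
      using F2'[of p v] that(2) by auto
  qed
  have mn_clear: "\<forall>p\<in>Q. mn3 (\<chi> (e p)) = 0" if \<chi>: "\<chi> \<in> chars M" for \<chi>
  proof
    fix p assume "p \<in> Q"
    then show "mn3 (\<chi> (e p)) = 0"
      using e(3)[OF _ \<chi>, of p] by (simp add: mn3_def)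
  qed
  show thesis
  proof (rule that[OF y])
    fix \<chi> assume \<chi>: "\<chi> \<in> chars M" and "\<chi> c = 0"
    then show "\<chi> y = 0"
      using yv[OF \<chi>] dv[OF \<chi>] bv[OF \<chi>] B_small[OF \<chi>, of "{1}"] by auto
  next
    fix \<chi> assume \<chi>: "\<chi> \<in> chars M" and c2: "\<chi> c = 2" and clr: "\<forall>p\<in>Q. \<chi> (e p) = 0"
    have "\<chi> b = 0 \<or> \<chi> b = 1"
      using bv[OF \<chi>] by auto
    then show "\<chi> y \<in> F0"
      using yv[OF \<chi>] dv[OF \<chi>] bv[OF \<chi>] outer[OF \<chi> clr] c2 by auto
  next
    fix p \<chi> assume p: "p \<in> Q" and \<chi>: "\<chi> \<in> chars M" and ep: "\<chi> (e p) = 1"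
    then obtain v where "v \<in> F p" "\<chi> (h p v) = 1"
      using hv[OF p \<chi>] by auto
    then show "\<chi> y \<in> F p"
      using inner[OF \<chi> p ep] by simp
  next
    fix v assume v: "v \<in> F0"
    consider "v = 0" | "v = 1" | "v = 2"
      using F2[OF v] by blast
    then show "\<exists>\<chi>\<in>chars M. \<chi> c = 2 \<and> (\<forall>p\<in>Q. \<chi> (e p) = 0) \<and> \<chi> y = v"
    proof cases
      case 1
      then obtain \<chi> where \<chi>: "\<chi> \<in> chars M" "\<chi> d0 \<noteq> 0"
        using d0 v d nonzero_iff_char by blast
      \<comment> \<open>The given character may meet \<open>b\<close> or a small cell. Passing to
        the minimal one keeps the value 2 of \<open>d0\<close> and sends all small elements to 0.
        The same device yields the value 2 from \<open>d2\<close> below.\<close>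
      let ?\<chi> = "\<lambda>x. mn3 (\<chi> x)"
      have \<chi>': "?\<chi> \<in> chars M"
        using chars_mn \<chi> by blast
      have "?\<chi> d0 = 2"
        using d02[OF \<chi>(1)] \<chi>(2) by (simp add: mn3_def)
      moreover have "?\<chi> b = 0"
        using bv[OF \<chi>(1)] by (simp add: mn3_def)
      ultimately show ?thesis
        using 1 yv[OF \<chi>'] dv[OF \<chi>'] outer[OF \<chi>' mn_clear[OF \<chi>(1)]] mn_clear[OF \<chi>(1)]
        by (intro bexI[OF _ \<chi>']) auto
    next
      case 2
      then obtain \<chi> where \<chi>: "\<chi> \<in> chars M" "\<chi> b \<noteq> 0"
        using b v nonzero_iff_char by blast
      then have bb: "\<chi> b = 1" "\<chi> d0 = 2" "\<chi> (B {0,1,2}) = 0"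
        using bv[OF \<chi>(1)] by auto
      have clr: "\<forall>p\<in>Q. \<chi> (e p) = 0"
        using clear[OF \<chi>(1) bb(3)] .
      then show ?thesis
        using 2 bb yv[OF \<chi>(1)] dv[OF \<chi>(1)] outer[OF \<chi>(1) clr]
        by (intro bexI[OF _ \<chi>(1)]) auto
    next
      case 3
      then obtain \<chi> where \<chi>: "\<chi> \<in> chars M" "\<chi> d2 \<noteq> 0"
        using d2 v d nonzero_iff_char by blast
      let ?\<chi> = "\<lambda>x. mn3 (\<chi> x)"
      have \<chi>': "?\<chi> \<in> chars M"
        using chars_mn \<chi> by blast
      have "\<chi> d2 = 2"
        using dv[OF \<chi>(1)] c(3)[OF \<chi>(1)] \<chi>(2) by auto
      then have "?\<chi> d2 = 2"
        by (simp add: mn3_def)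
      moreover have "?\<chi> b = 0"
        using bv[OF \<chi>(1)] by (simp add: mn3_def)
      ultimately show ?thesis
        using 3 yv[OF \<chi>'] dv[OF \<chi>'] c(3)[OF \<chi>'] outer[OF \<chi>' mn_clear[OF \<chi>(1)]] mn_clear[OF \<chi>(1)]
        by (intro bexI[OF _ \<chi>']) auto
    qed
  next
    fix p v assume pv: "p \<in> Q" "v \<in> F p"
    then obtain \<chi> where \<chi>: "\<chi> \<in> chars M" "\<chi> (h p v) \<noteq> 0"
      using h nonzero_iff_char by blast
    then have "\<chi> (h p v) = 1" "\<chi> (e p) = 1"
      using h_le[OF pv \<chi>(1)] e(3)[OF pv(1) \<chi>(1)] by auto
    then show "\<exists>\<chi>\<in>chars M. \<chi> (e p) = 1 \<and> \<chi> y = v"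
      using inner[OF \<chi>(1) pv(1) _ pv(2)] \<chi>(1) by blast
  qed
qed

end

section \<open>Back and forth\<close>

text \<open>In both directions together this is equality of pattern sets, hence of the
  quantifier-free types of the two tuples.\<close>

definition covers :: "('a \<Rightarrow> nat) set \<Rightarrow> ('b \<Rightarrow> nat) set \<Rightarrow> 'i set \<Rightarrow> ('i \<Rightarrow> 'a) \<Rightarrow> ('i \<Rightarrow> 'b) \<Rightarrow> bool" where
  "covers H H' A g g' \<longleftrightarrow> (\<forall>\<chi>\<in>H. \<exists>\<chi>'\<in>H'. \<forall>i\<in>A. \<chi> (g i) = \<chi>' (g' i))"

lemma covers_subset: "covers H H' A g g' \<Longrightarrow> B \<subseteq> A \<Longrightarrow> covers H H' B g g'"
  unfolding covers_def by (meson subsetD)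

context V5_dense
begin

text \<open>The forth step. Patterns are grouped by their minimal pattern,
  \<open>realize_cell\<close> treats each group, and the results are joined. The compatibility that
  \<open>realize_cell\<close> demands holds because the characters of \<open>N\<close> are closed
  under composition with \<open>mn3\<close>.\<close>

theorem extend:
  fixes N :: "'b struct" and g :: "'i \<Rightarrow> 'b" and g' :: "'i \<Rightarrow> 'a"
  assumes A: "finite A" and g: "\<And>i. i \<in> A \<Longrightarrow> g i \<in> univ N" and g': "\<And>i. i \<in> A \<Longrightarrow> g' i \<in> univ M"
    and x: "x \<in> univ N"
    and cov: "covers (chars N) (chars M) A g g'" "covers (chars M) (chars N) A g' g"
  obtains x' where "x' \<in> univ M"
    "\<And>\<chi>. \<chi> \<in> chars N \<Longrightarrow> \<exists>\<chi>'\<in>chars M. (\<forall>i\<in>A. \<chi> (g i) = \<chi>' (g' i)) \<and> \<chi> x = \<chi>' x'"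
    "\<And>\<chi>'. \<chi>' \<in> chars M \<Longrightarrow> \<exists>\<chi>\<in>chars N. (\<forall>i\<in>A. \<chi>' (g' i) = \<chi> (g i)) \<and> \<chi>' x' = \<chi> x"
proof -
  \<comment> \<open>\<open>Pt\<close> is the set of patterns of the tuple, \<open>Fl p\<close> the set of values that \<open>x\<close> takes on pattern \<open>p\<close>, and
    \<open>nm\<close> singles out the patterns that only non-minimal prime filters can have.\<close>
  define pat where "pat \<chi> = restrict (\<lambda>i. \<chi> (g i)) A" for \<chi> :: "'b \<Rightarrow> nat"
  define pat' where "pat' \<chi> = restrict (\<lambda>i. \<chi> (g' i)) A" for \<chi> :: "'a \<Rightarrow> nat"
  define mnp where "mnp p = restrict (\<lambda>i. mn3 (p i)) A" for p :: "'i \<Rightarrow> nat"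
  define nm where "nm p \<longleftrightarrow> (\<exists>i\<in>A. p i = 1)" for p :: "'i \<Rightarrow> nat"
  define Pt where "Pt = pat ` chars N"
  define Fl where "Fl p = {\<chi> x |\<chi>. \<chi> \<in> chars N \<and> pat \<chi> = p}" for p
  have eq_restrict: "restrict u A = restrict v A \<longleftrightarrow> (\<forall>i\<in>A. u i = v i)" for u v :: "'i \<Rightarrow> nat"
    by (metis restrict_apply' restrict_ext)
  have fwd: "\<exists>\<chi>'\<in>chars M. pat' \<chi>' = pat \<chi>" if "\<chi> \<in> chars N" for \<chi>
    using cov(1) that unfolding covers_def pat_def pat'_def eq_restrict by metis
  have bwd: "pat' \<chi>' \<in> Pt" if "\<chi>' \<in> chars M" for \<chi>'
  proof -
    obtain \<chi> where "\<chi> \<in> chars N" "\<forall>i\<in>A. \<chi>' (g' i) = \<chi> (g i)"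
      using cov(2) \<open>\<chi>' \<in> chars M\<close> unfolding covers_def by blast
    then have "pat' \<chi>' = pat \<chi>"
      by (simp add: pat_def pat'_def eq_restrict)
    with \<open>\<chi> \<in> chars N\<close> show ?thesis by (simp add: Pt_def)
  qed
  have in_Pt: "\<exists>\<chi>'\<in>chars M. pat' \<chi>' = p" if "p \<in> Pt" for p
    using that fwd by (auto simp: Pt_def)
  have pat_mn: "pat (\<lambda>z. mn3 (\<chi> z)) = mnp (pat \<chi>)" for \<chi>
    by (auto simp: pat_def mnp_def)
  have pat'_mn: "pat' (\<lambda>z. mn3 (\<chi> z)) = mnp (pat' \<chi>)" for \<chi>
    by (auto simp: pat'_def mnp_def)
  have p_le: "p i \<le> 2" if "p \<in> Pt" "i \<in> A" for p i
    using that g char_le by (fastforce simp: Pt_def pat_def)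
  have Pt_ext: "p = restrict p A" if "p \<in> Pt" for p
    using that by (auto simp: Pt_def pat_def)
  have finPt: "finite Pt"
  proof (rule finite_subset)
    show "Pt \<subseteq> PiE A (\<lambda>_. {..2})"
    proof
      fix p assume p: "p \<in> Pt"
      show "p \<in> PiE A (\<lambda>_. {..2})"
        using p_le[OF p] p by (auto simp: PiE_iff Pt_def pat_def)
    qed
  qed (use A in \<open>simp add: finite_PiE\<close>)
  have mnp_idem: "mnp (mnp p) = mnp p" for p
    by (auto simp: mnp_def mn3_def)
  have nm_mnp: "\<not> nm (mnp p)" for p
    by (auto simp: nm_def mnp_def mn3_def)
  have mnp_id: "mnp p = p" if p: "p \<in> Pt" "\<not> nm p" for p
  proof -
    have "mn3 (p i) = p i" if i: "i \<in> A" for i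
    proof -
      have "p i \<noteq> 1" "p i \<le> 2"
        using p(2) i p_le[OF p(1) i] by (auto simp: nm_def)
      then show ?thesis by (simp add: mn3_def)
    qed
    then have "mnp p = restrict p A"
      by (simp add: mnp_def eq_restrict)
    with Pt_ext[OF p(1)] show ?thesis by simp
  qed
  have mnp_Pt: "mnp p \<in> Pt" if p: "p \<in> Pt" for p
  proof -
    obtain \<chi> where "\<chi> \<in> chars N" "p = pat \<chi>"
      using p by (auto simp: Pt_def)
    then show ?thesis
      using imageI[OF chars_mn, of \<chi> N pat] pat_mn[of \<chi>] unfolding Pt_def by simp
  qed
  have Fl_le: "Fl p \<subseteq> {..2}" for p
    using char_le[OF _ x] by (auto simp: Fl_def)
  have Fl_ne: "Fl p \<noteq> {}" if "p \<in> Pt" for p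
    using that by (auto simp: Fl_def Pt_def)
  have Fl_mn: "mn3 v \<in> Fl (mnp p)" if v: "v \<in> Fl p" for p v
  proof -
    obtain \<chi> where \<chi>: "\<chi> \<in> chars N" "pat \<chi> = p" "v = \<chi> x"
      using v by (auto simp: Fl_def)
    have "(\<lambda>z. mn3 (\<chi> z)) \<in> chars N"
      using chars_mn[OF \<chi>(1)] .
    with \<chi> pat_mn[of \<chi>] show ?thesis
      unfolding Fl_def by (intro CollectI exI[of _ "\<lambda>z. mn3 (\<chi> z)"]) simp
  qed
  \<comment> \<open>A pattern with a value 1 gets its exact cell. A pattern without one can only be
    isolated together with those above it, since an element of a minimal prime filter belongs to
    every larger one.\<close>
  have "\<forall>p\<in>Pt. \<exists>e. e \<in> univ M \<and> (\<forall>\<chi>\<in>chars M. \<chi> e = (if nm p then if pat' \<chi> = p then 1 else 0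
      else if mnp (pat' \<chi>) = p then 2 else 0))"
  proof
    fix p assume p: "p \<in> Pt"
    have pat'_iff: "pat' \<chi> = p \<longleftrightarrow> (\<forall>i\<in>A. \<chi> (g' i) = p i)" for \<chi>
      by (subst Pt_ext[OF p]) (simp add: pat'_def eq_restrict)
    have mnp_iff: "mnp (pat' \<chi>) = p \<longleftrightarrow> (\<forall>i\<in>A. mn3 (\<chi> (g' i)) = p i)" for \<chi>
      by (subst Pt_ext[OF p]) (simp add: pat'_def mnp_def eq_restrict)
    show "\<exists>e. e \<in> univ M \<and> (\<forall>\<chi>\<in>chars M. \<chi> e = (if nm p then if pat' \<chi> = p then 1 else 0
      else if mnp (pat' \<chi>) = p then 2 else 0))"
    proof (cases "nm p")
      case True
      then obtain i0 where "i0 \<in> A" "p i0 = 1"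
        by (auto simp: nm_def)
      from small_cell[of A g' p i0, OF A g' p_le[OF p] this] show ?thesis
        unfolding pat'_iff Bex_def by (simp only: True if_True)
    next
      case False
      have "p i = 0 \<or> p i = 2" if i: "i \<in> A" for i
      proof -
        have "p i \<noteq> 1" "p i \<le> 2"
          using False i p_le[OF p i] by (auto simp: nm_def)
        then show ?thesis by linarith
      qed
      from regular_cell[of A g' p, OF A g' this] show ?thesis
        unfolding mnp_iff Bex_def by (simp only: False if_False)
    qed
  qed
  then obtain e where e0: "\<forall>p\<in>Pt. e p \<in> univ M \<and> (\<forall>\<chi>\<in>chars M. \<chi> (e p) =
      (if nm p then if pat' \<chi> = p then 1 else 0 else if mnp (pat' \<chi>) = p then 2 else 0))"
    by (rule bchoice[THEN exE])
  have eU: "e p \<in> univ M" if "p \<in> Pt" for p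
    using e0 that by blast
  have ev: "\<chi> (e p) = (if nm p then if pat' \<chi> = p then 1 else 0 else if mnp (pat' \<chi>) = p then 2 else 0)"
    if "p \<in> Pt" "\<chi> \<in> chars M" for p \<chi>
    using e0 that by blast
  have e_nm: "\<chi> (e p) = (if pat' \<chi> = p then 1 else 0)" if "p \<in> Pt" "nm p" "\<chi> \<in> chars M" for p \<chi>
    using ev[OF that(1,3)] that(2) by simp
  have e_min: "\<chi> (e p) = (if mnp (pat' \<chi>) = p then 2 else 0)" if "p \<in> Pt" "\<not> nm p" "\<chi> \<in> chars M" for p \<chi>
    using ev[OF that(1,3)] that(2) by simp
  have e_nz: "e p \<noteq> zero M" if p: "p \<in> Pt" for p
  proof -
    obtain \<chi> where \<chi>: "\<chi> \<in> chars M" "pat' \<chi> = p"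
      using in_Pt[OF p] by blast
    then have "\<chi> (e p) \<noteq> 0"
      using e_nm[OF p _ \<chi>(1)] e_min[OF p _ \<chi>(1)] mnp_id[OF p] by (cases "nm p") simp_all
    then show ?thesis
      using char_zero[OF \<chi>(1)] by metis
  qed
  \<comment> \<open>Each \<open>y\<close> vanishes off its regular cell, so in the final join a
    character sees only the \<open>y\<close> of its own cell.\<close>
  have "\<forall>m\<in>mnp ` Pt. \<exists>y. y \<in> univ M \<and>
    (\<forall>\<chi>\<in>chars M. if mnp (pat' \<chi>) = m then \<chi> y \<in> Fl (pat' \<chi>) else \<chi> y = 0) \<and>
    (\<forall>p\<in>Pt. mnp p = m \<longrightarrow> (\<forall>v\<in>Fl p. \<exists>\<chi>\<in>chars M. pat' \<chi> = p \<and> \<chi> y = v))"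
  proof
    fix m assume "m \<in> mnp ` Pt"
    then have m: "m \<in> Pt" "\<not> nm m" "mnp m = m"
      using mnp_Pt nm_mnp mnp_idem by auto
    define Q where "Q = {p \<in> Pt. nm p \<and> mnp p = m}"
    have Q: "p \<in> Pt" "nm p" "mnp p = m" if "p \<in> Q" for p
      using that by (auto simp: Q_def)
    obtain y where y: "y \<in> univ M" "\<And>\<chi>. \<chi> \<in> chars M \<Longrightarrow> \<chi> (e m) = 0 \<Longrightarrow> \<chi> y = 0"
      "\<And>\<chi>. \<chi> \<in> chars M \<Longrightarrow> \<chi> (e m) = 2 \<Longrightarrow> \<forall>p\<in>Q. \<chi> (e p) = 0 \<Longrightarrow> \<chi> y \<in> Fl m"
      "\<And>p \<chi>. p \<in> Q \<Longrightarrow> \<chi> \<in> chars M \<Longrightarrow> \<chi> (e p) = 1 \<Longrightarrow> \<chi> y \<in> Fl p"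
      "\<And>v. v \<in> Fl m \<Longrightarrow> \<exists>\<chi>\<in>chars M. \<chi> (e m) = 2 \<and> (\<forall>p\<in>Q. \<chi> (e p) = 0) \<and> \<chi> y = v"
      "\<And>p v. p \<in> Q \<Longrightarrow> v \<in> Fl p \<Longrightarrow> \<exists>\<chi>\<in>chars M. \<chi> (e p) = 1 \<and> \<chi> y = v"
    proof (rule realize_cell[of "e m" Q e "Fl m" Fl])
      show "e m \<in> univ M" "e m \<noteq> zero M"
        using eU e_nz m by auto
      show "\<chi> (e m) = 0 \<or> \<chi> (e m) = 2" if "\<chi> \<in> chars M" for \<chi>
        using e_min[OF m(1,2) that] by simp
      show "finite Q"
        using finPt by (simp add: Q_def)
      show "e p \<in> univ M" "e p \<noteq> zero M" if "p \<in> Q" for p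
        using eU e_nz Q[OF that] by auto
      show "\<chi> (e p) \<le> 1 \<and> \<chi> (e p) \<le> \<chi> (e m)" if "p \<in> Q" "\<chi> \<in> chars M" for p \<chi>
        using e_nm[OF Q(1,2)[OF that(1)] that(2)] e_min[OF m(1,2) that(2)] Q(3)[OF that(1)] by auto
      show "p = q" if "p \<in> Q" "q \<in> Q" "\<chi> \<in> chars M" "\<chi> (e p) \<noteq> 0" "\<chi> (e q) \<noteq> 0" for p q \<chi>
        using e_nm[OF Q(1,2)[OF that(1)] that(3)] e_nm[OF Q(1,2)[OF that(2)] that(3)] that(4,5)
        by (simp split: if_splits)
      show "Fl m \<subseteq> {..2}" "Fl m \<noteq> {}"
        using Fl_le Fl_ne m by auto
      \<comment> \<open>The minimal version of a character with pattern \<open>m\<close> again has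
        pattern \<open>m\<close>, because \<open>mnp m = m\<close>, and it turns the value 1 into
        0.\<close>
      show "0 \<in> Fl m" if "1 \<in> Fl m"
        using Fl_mn[OF that] m(3) by (simp add: mn3_def)
      show "Fl p \<subseteq> {..2} \<and> Fl p \<noteq> {}" if "p \<in> Q" for p
        using Fl_le Fl_ne Q(1)[OF that] by blast
      show "mn3 v \<in> Fl m" if "p \<in> Q" "v \<in> Fl p" for p v
        using Fl_mn[OF that(2)] Q(3)[OF that(1)] by simp
    qed blast
    have "if mnp (pat' \<chi>) = m then \<chi> y \<in> Fl (pat' \<chi>) else \<chi> y = 0" if \<chi>: "\<chi> \<in> chars M" for \<chi>
    proof (cases "mnp (pat' \<chi>) = m")
      case True
      note em = e_min[OF m(1,2) \<chi>]
      show ?thesis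
      proof (cases "nm (pat' \<chi>)")
        case nm: True
        then have "pat' \<chi> \<in> Q"
          using bwd[OF \<chi>] True by (simp add: Q_def)
        then have "\<chi> y \<in> Fl (pat' \<chi>)"
          using y(4)[OF _ \<chi>, of "pat' \<chi>"] e_nm[OF _ nm \<chi>] Q by simp
        with True show ?thesis by simp
      next
        case False
        then have pm: "pat' \<chi> = m"
          using mnp_id[OF bwd[OF \<chi>]] True by simp
        have "\<chi> (e p) = 0" if "p \<in> Q" for p
          using e_nm[OF Q(1,2)[OF that] \<chi>] Q(2)[OF that] m(2) pm by auto
        then have "\<chi> y \<in> Fl m"
          using y(3)[OF \<chi>] em True by simp
        with True pm show ?thesis by simp
      qed
    next
      case False
      then show ?thesis
        using y(2)[OF \<chi>] e_min[OF m(1,2) \<chi>] by simp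
    qed
    moreover have "\<exists>\<chi>\<in>chars M. pat' \<chi> = p \<and> \<chi> y = v" if p: "p \<in> Pt" "mnp p = m" and v: "v \<in> Fl p" for p v
    proof (cases "nm p")
      case True
      then have "p \<in> Q"
        using p by (simp add: Q_def)
      then obtain \<chi> where \<chi>: "\<chi> \<in> chars M" "\<chi> (e p) = 1" "\<chi> y = v"
        using y(6) v by blast
      then have "pat' \<chi> = p"
        using e_nm[OF p(1) True \<chi>(1)] \<chi>(2) by (cases "pat' \<chi> = p") simp_all
      with \<chi>(1,3) show ?thesis by blast
    next
      case False
      then have pm: "p = m"
        using mnp_id p by simp
      then obtain \<chi> where \<chi>: "\<chi> \<in> chars M" "\<chi> (e m) = 2" "\<forall>p\<in>Q. \<chi> (e p) = 0" "\<chi> y = v"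
        using y(5) v by blast
      have mm: "mnp (pat' \<chi>) = m"
        using e_min[OF m(1,2) \<chi>(1)] \<chi>(2) by (cases "mnp (pat' \<chi>) = m") simp_all
      \<comment> \<open>A pattern above \<open>m\<close> with a value 1 would belong to
        \<open>Q\<close>, and its small cell would have value 1 at \<open>\<chi>\<close>.\<close>
      have "\<not> nm (pat' \<chi>)"
      proof
        assume nm: "nm (pat' \<chi>)"
        then have "pat' \<chi> \<in> Q"
          using bwd[OF \<chi>(1)] mm by (simp add: Q_def)
        then show False
          using \<chi>(3) e_nm[OF bwd[OF \<chi>(1)] nm \<chi>(1)] by simp
      qed
      then have "pat' \<chi> = p"
        using mnp_id[OF bwd[OF \<chi>(1)]] mm pm by simp
      with \<chi>(1,4) show ?thesis by blast
    qed
    ultimately show "\<exists>y. y \<in> univ M \<and>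
      (\<forall>\<chi>\<in>chars M. if mnp (pat' \<chi>) = m then \<chi> y \<in> Fl (pat' \<chi>) else \<chi> y = 0) \<and>
      (\<forall>p\<in>Pt. mnp p = m \<longrightarrow> (\<forall>v\<in>Fl p. \<exists>\<chi>\<in>chars M. pat' \<chi> = p \<and> \<chi> y = v))"
      using y(1) by blast
  qed
  then obtain Y where Y: "\<forall>m\<in>mnp ` Pt. Y m \<in> univ M \<and>
    (\<forall>\<chi>\<in>chars M. if mnp (pat' \<chi>) = m then \<chi> (Y m) \<in> Fl (pat' \<chi>) else \<chi> (Y m) = 0) \<and>
    (\<forall>p\<in>Pt. mnp p = m \<longrightarrow> (\<forall>v\<in>Fl p. \<exists>\<chi>\<in>chars M. pat' \<chi> = p \<and> \<chi> (Y m) = v))"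
    by (rule bchoice[THEN exE])
  have finI: "finite (mnp ` Pt)"
    using finPt by blast
  obtain x' where x': "x' \<in> univ M"
    "\<And>\<chi> m. \<chi> \<in> chars M \<Longrightarrow> m \<in> mnp ` Pt \<Longrightarrow> \<chi> (Y m) \<le> \<chi> x'"
    "\<And>\<chi>. \<chi> \<in> chars M \<Longrightarrow> \<chi> x' = 0 \<or> (\<exists>m\<in>mnp ` Pt. \<chi> x' = \<chi> (Y m))"
    by (rule finite_join[OF finI, of Y]) (use Y in blast)+
  have x'v: "\<chi> x' = \<chi> (Y (mnp (pat' \<chi>)))" if \<chi>: "\<chi> \<in> chars M" for \<chi>
  proof -
    have "mnp (pat' \<chi>) \<in> mnp ` Pt"
      using bwd[OF \<chi>] by blast
    then have ge: "\<chi> (Y (mnp (pat' \<chi>))) \<le> \<chi> x'"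
      using x'(2)[OF \<chi>] by blast
    from x'(3)[OF \<chi>] show ?thesis
    proof (elim disjE bexE)
      fix m assume m: "m \<in> mnp ` Pt" "\<chi> x' = \<chi> (Y m)"
      then have "m = mnp (pat' \<chi>) \<or> \<chi> (Y m) = 0"
        using Y \<chi> by metis
      with m ge show ?thesis by auto
    qed (use ge in simp)
  qed
  show thesis
  proof (rule that[OF x'(1)])
    fix \<chi> assume \<chi>: "\<chi> \<in> chars N"
    have p: "pat \<chi> \<in> Pt" "\<chi> x \<in> Fl (pat \<chi>)"
      using \<chi> by (auto simp: Pt_def Fl_def)
    then obtain \<chi>' where \<chi>': "\<chi>' \<in> chars M" "pat' \<chi>' = pat \<chi>" "\<chi>' (Y (mnp (pat \<chi>))) = \<chi> x"
      using Y by blast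
    have "\<forall>i\<in>A. \<chi> (g i) = \<chi>' (g' i)"
      using \<chi>'(2) by (simp add: pat_def pat'_def eq_restrict)
    moreover have "\<chi> x = \<chi>' x'"
      using x'v[OF \<chi>'(1)] \<chi>'(2,3) by simp
    ultimately show "\<exists>\<chi>'\<in>chars M. (\<forall>i\<in>A. \<chi> (g i) = \<chi>' (g' i)) \<and> \<chi> x = \<chi>' x'"
      using \<chi>'(1) by blast
  next
    fix \<chi>' assume \<chi>': "\<chi>' \<in> chars M"
    have "\<chi>' x' \<in> Fl (pat' \<chi>')"
      using x'v[OF \<chi>'] bwd[OF \<chi>'] Y \<chi>' by (metis imageI)
    then obtain \<chi> where \<chi>: "\<chi> \<in> chars N" "pat \<chi> = pat' \<chi>'" "\<chi>' x' = \<chi> x"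
      by (auto simp: Fl_def)
    have "\<forall>i\<in>A. \<chi>' (g' i) = \<chi> (g i)"
      using \<chi>(2) by (simp add: pat_def pat'_def eq_restrict)
    with \<chi> show "\<exists>\<chi>\<in>chars N. (\<forall>i\<in>A. \<chi>' (g' i) = \<chi> (g i)) \<and> \<chi>' x' = \<chi> x"
      by blast
  qed
qed

end

section \<open>Transfer of truth between dense models\<close>

lemma tval_closed:
  assumes "is_struct M" "\<And>n. n \<in> fvt t \<Longrightarrow> e n \<in> univ M" "\<And>c. c \<in> set_trm t \<Longrightarrow> k c \<in> univ M"
  shows "tval M k e t \<in> univ M"
  using assms(2,3) by (induction t) (use assms(1) in \<open>simp_all add: is_struct_def\<close>)

lemma char_tval:
  assumes M: "is_struct M" and N: "is_struct N" and \<chi>: "\<chi> \<in> chars M" "\<chi>' \<in> chars N"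
    and "\<And>n. n \<in> fvt t \<Longrightarrow> e n \<in> univ M \<and> e' n \<in> univ N \<and> \<chi> (e n) = \<chi>' (e' n)"
    and "\<And>c. c \<in> set_trm t \<Longrightarrow> k c \<in> univ M \<and> k' c \<in> univ N \<and> \<chi> (k c) = \<chi>' (k' c)"
  shows "\<chi> (tval M k e t) = \<chi>' (tval N k' e' t)"
  using assms(5,6)
proof (induction t)
  case (Jn s t)
  have "tval M k e s \<in> univ M" "tval M k e t \<in> univ M"
    by (rule tval_closed[OF M]; use Jn.prems in simp)+
  moreover have "tval N k' e' s \<in> univ N" "tval N k' e' t \<in> univ N"
    by (rule tval_closed[OF N]; use Jn.prems in simp)+
  ultimately show ?case
    using Jn \<chi> by (simp add: char_join)
next
  case (Mt s t)
  have "tval M k e s \<in> univ M" "tval M k e t \<in> univ M"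
    by (rule tval_closed[OF M]; use Mt.prems in simp)+
  moreover have "tval N k' e' s \<in> univ N" "tval N k' e' t \<in> univ N"
    by (rule tval_closed[OF N]; use Mt.prems in simp)+
  ultimately show ?case
    using Mt \<chi> by (simp add: char_meet)
next
  case (Df s t)
  have "tval M k e s \<in> univ M" "tval M k e t \<in> univ M"
    by (rule tval_closed[OF M]; use Df.prems in simp)+
  moreover have "tval N k' e' s \<in> univ N" "tval N k' e' t \<in> univ N"
    by (rule tval_closed[OF N]; use Df.prems in simp)+
  ultimately show ?case
    using Df \<chi> by (simp add: char_diff)
qed (use \<chi> in \<open>simp_all add: char_zero char_one\<close>)

lemma (in V5_algebra) is_struct: "is_struct M"
  by (simp add: is_struct_def)

text \<open>Each character of \<open>M\<close> has a partner on \<open>N\<close> with the same term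
  values, so an equation true in \<open>N\<close> holds at all characters of \<open>M\<close>.
  Variables are tagged \<open>Inl\<close> and constants \<open>Inr\<close>, so that one finite tuple
  comprises both.\<close>

lemma eq_transfer:
  fixes k :: "'c \<Rightarrow> 'a" and k' :: "'c \<Rightarrow> 'b"
  assumes M: "V5_algebra M" and N: "V5_algebra N"
    and A: "Inl ` (fvt s \<union> fvt t) \<union> Inr ` (set_trm s \<union> set_trm t) \<subseteq> A"
    and g: "\<And>i. i \<in> A \<Longrightarrow> case_sum e k i \<in> univ M" and g': "\<And>i. i \<in> A \<Longrightarrow> case_sum e' k' i \<in> univ N"
    and cov: "covers (chars M) (chars N) A (case_sum e k) (case_sum e' k')"
    and eq: "tval N k' e' s = tval N k' e' t"
  shows "tval M k e s = tval M k e t"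
proof -
  interpret M: V5_algebra M by (fact M)
  interpret N: V5_algebra N by (fact N)
  have eU: "e n \<in> univ M" "e' n \<in> univ N" if "Inl n \<in> A" for n
    using g[OF that] g'[OF that] by simp_all
  have kU: "k c \<in> univ M" "k' c \<in> univ N" if "Inr c \<in> A" for c
    using g[OF that] g'[OF that] by simp_all
  show ?thesis
  proof (rule M.eq_if_chars)
    show "tval M k e s \<in> univ M" "tval M k e t \<in> univ M"
      by (rule tval_closed[OF M.is_struct]; use A in \<open>auto intro!: eU kU\<close>)+
    fix \<chi> assume \<chi>: "\<chi> \<in> chars M"
    obtain \<chi>' where \<chi>': "\<chi>' \<in> chars N" "\<forall>i\<in>A. \<chi> (case_sum e k i) = \<chi>' (case_sum e' k' i)"
      using cov \<chi> unfolding covers_def by blast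
    have e: "\<chi> (e n) = \<chi>' (e' n)" if "Inl n \<in> A" for n
      using bspec[OF \<chi>'(2) that] by simp
    have k: "\<chi> (k c) = \<chi>' (k' c)" if "Inr c \<in> A" for c
      using bspec[OF \<chi>'(2) that] by simp
    have "\<chi> (tval M k e r) = \<chi>' (tval N k' e' r)" if "r = s \<or> r = t" for r
    proof (rule char_tval[OF M.is_struct N.is_struct \<chi> \<chi>'(1)])
      fix n assume "n \<in> fvt r"
      then have "Inl n \<in> A" using A that by auto
      then show "e n \<in> univ M \<and> e' n \<in> univ N \<and> \<chi> (e n) = \<chi>' (e' n)"
        using eU e by simp
    next
      fix c assume "c \<in> set_trm r"
      then have "Inr c \<in> A" using A that by auto
      then show "k c \<in> univ M \<and> k' c \<in> univ N \<and> \<chi> (k c) = \<chi>' (k' c)"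
        using kU k by simp
    qed
    with eq show "\<chi> (tval M k e s) = \<chi> (tval M k e t)" by simp
  qed
qed

lemma case_sum_fun_upd: "case_sum (u(n := z)) w i = (if i = Inl n then z else case_sum u w i)"
  by (cases i) auto

text \<open>The index \<open>Inl n\<close> is exempt from the hypotheses: the quantifier overwrites
  the old value of this variable, which may be unmatched.\<close>

lemma (in V5_dense) extend_assignment:
  fixes N :: "'b struct" and k :: "'c \<Rightarrow> 'b" and k' :: "'c \<Rightarrow> 'a"
  assumes A: "finite A"
    and g: "\<And>i. i \<in> A - {Inl n} \<Longrightarrow> case_sum e k i \<in> univ N"
    and g': "\<And>i. i \<in> A - {Inl n} \<Longrightarrow> case_sum e' k' i \<in> univ M"
    and cov: "covers (chars N) (chars M) (A - {Inl n}) (case_sum e k) (case_sum e' k')"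
      "covers (chars M) (chars N) (A - {Inl n}) (case_sum e' k') (case_sum e k)"
    and x: "x \<in> univ N"
  obtains x' where "x' \<in> univ M"
    "covers (chars N) (chars M) A (case_sum (e(n := x)) k) (case_sum (e'(n := x')) k')"
    "covers (chars M) (chars N) A (case_sum (e'(n := x')) k') (case_sum (e(n := x)) k)"
proof -
  obtain x' where "x' \<in> univ M"
    "\<And>\<chi>. \<chi> \<in> chars N \<Longrightarrow> \<exists>\<chi>'\<in>chars M.
      (\<forall>i\<in>A - {Inl n}. \<chi> (case_sum e k i) = \<chi>' (case_sum e' k' i)) \<and> \<chi> x = \<chi>' x'"
    "\<And>\<chi>'. \<chi>' \<in> chars M \<Longrightarrow> \<exists>\<chi>\<in>chars N.
      (\<forall>i\<in>A - {Inl n}. \<chi>' (case_sum e' k' i) = \<chi> (case_sum e k i)) \<and> \<chi>' x' = \<chi> x"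
    by (rule extend[of "A - {Inl n}" "case_sum e k" N "case_sum e' k'" x])
      (use A g g' cov x in auto)
  note x' = this
  show thesis
  proof (rule that[OF x'(1)])
    show "covers (chars N) (chars M) A (case_sum (e(n := x)) k) (case_sum (e'(n := x')) k')"
      unfolding covers_def
    proof
      fix \<chi> assume "\<chi> \<in> chars N"
      from x'(2)[OF this] obtain \<chi>' where "\<chi>' \<in> chars M"
        "\<forall>i\<in>A - {Inl n}. \<chi> (case_sum e k i) = \<chi>' (case_sum e' k' i)" "\<chi> x = \<chi>' x'" by blast
      then show "\<exists>\<chi>'\<in>chars M. \<forall>i\<in>A. \<chi> (case_sum (e(n := x)) k i) = \<chi>' (case_sum (e'(n := x')) k' i)"
        by (intro bexI[of _ \<chi>']) (auto simp: case_sum_fun_upd)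
    qed
    show "covers (chars M) (chars N) A (case_sum (e'(n := x')) k') (case_sum (e(n := x)) k)"
      unfolding covers_def
    proof
      fix \<chi>' assume "\<chi>' \<in> chars M"
      from x'(3)[OF this] obtain \<chi> where "\<chi> \<in> chars N"
        "\<forall>i\<in>A - {Inl n}. \<chi>' (case_sum e' k' i) = \<chi> (case_sum e k i)" "\<chi>' x' = \<chi> x" by blast
      then show "\<exists>\<chi>\<in>chars N. \<forall>i\<in>A. \<chi>' (case_sum (e'(n := x')) k' i) = \<chi> (case_sum (e(n := x)) k i)"
        by (intro bexI[of _ \<chi>]) (auto simp: case_sum_fun_upd)
    qed
  qed
qed

text \<open>Back and forth as an induction on formulas; the quantifier case uses the extension
  property of both models. With the covering hypotheses it amounts to quantifier
  elimination.\<close>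

theorem sat_transfer:
  fixes k :: "'c \<Rightarrow> 'a" and k' :: "'c \<Rightarrow> 'b"
  assumes M: "V5_dense M" and N: "V5_dense N"
    and "finite A" "Inl ` fv p \<union> Inr ` set_fm p \<subseteq> A"
    and "\<And>i. i \<in> A \<Longrightarrow> case_sum e k i \<in> univ M" "\<And>i. i \<in> A \<Longrightarrow> case_sum e' k' i \<in> univ N"
    and "covers (chars M) (chars N) A (case_sum e k) (case_sum e' k')"
    and "covers (chars N) (chars M) A (case_sum e' k') (case_sum e k)"
  shows "sat M k e p \<longleftrightarrow> sat N k' e' p"
  using assms(3-)
proof (induction p arbitrary: A e e')
  case (Eq s t)
  have M': "V5_algebra M" and N': "V5_algebra N"
    using M N by (simp_all add: V5_dense_def)
  have sub: "Inl ` (fvt s \<union> fvt t) \<union> Inr ` (set_trm s \<union> set_trm t) \<subseteq> A"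
    using Eq.prems(2) by simp
  show ?case
    using eq_transfer[OF M' N' sub Eq.prems(3,4,5)] eq_transfer[OF N' M' sub Eq.prems(4,3,6)] by auto
next
  case (Neg p)
  have "sat M k e p \<longleftrightarrow> sat N k' e' p"
    by (rule Neg.IH[OF Neg.prems(1) _ Neg.prems(3-6)]) (use Neg.prems(2) in simp_all)
  then show ?case by simp
next
  case (Conj p q)
  have "sat M k e p \<longleftrightarrow> sat N k' e' p"
    by (rule Conj.IH(1)[OF Conj.prems(1) _ Conj.prems(3-6)]) (use Conj.prems(2) in auto)
  moreover have "sat M k e q \<longleftrightarrow> sat N k' e' q"
    by (rule Conj.IH(2)[OF Conj.prems(1) _ Conj.prems(3-6)]) (use Conj.prems(2) in auto)
  ultimately show ?case by simp
next
  case (Forall n p)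
  interpret M: V5_dense M by (fact M)
  interpret N: V5_dense N by (fact N)
  \<comment> \<open>The bound variable may be free in the body without having an index in
    \<open>A\<close>.\<close>
  let ?A = "insert (Inl n) A"
  have A: "finite ?A" and sub: "Inl ` fv p \<union> Inr ` set_fm p \<subseteq> ?A"
    using Forall.prems(1,2) by auto
  have A': "?A - {Inl n} \<subseteq> A"
    by auto
  note cov = Forall.prems(5,6)[THEN covers_subset, OF A']
  have g: "case_sum e k i \<in> univ M" "case_sum e' k' i \<in> univ N" if "i \<in> ?A - {Inl n}" for i
    using that Forall.prems(3,4)[of i] by auto
  have gu: "case_sum (e(n := x)) k i \<in> univ M" if "x \<in> univ M" "i \<in> ?A" for x i
    using that Forall.prems(3)[of i] by (cases i) auto
  have gu': "case_sum (e'(n := x)) k' i \<in> univ N" if "x \<in> univ N" "i \<in> ?A" for x i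
    using that Forall.prems(4)[of i] by (cases i) auto
  show ?case
  proof
    assume r: "sat M k e (Forall n p)"
    have "sat N k' (e'(n := x')) p" if x': "x' \<in> univ N" for x'
    proof -
      obtain x where x: "x \<in> univ M"
        "covers (chars N) (chars M) ?A (case_sum (e'(n := x')) k') (case_sum (e(n := x)) k)"
        "covers (chars M) (chars N) ?A (case_sum (e(n := x)) k) (case_sum (e'(n := x')) k')"
        by (rule M.extend_assignment[OF A g(2,1) cov(2,1) x'])
      have "sat M k (e(n := x)) p \<longleftrightarrow> sat N k' (e'(n := x')) p"
        by (rule Forall.IH[OF A sub gu[OF x(1)] gu'[OF x'] x(3,2)])
      with r x(1) show ?thesis by simp
    qed
    then show "sat N k' e' (Forall n p)" by simp
  next
    assume r: "sat N k' e' (Forall n p)"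
    have "sat M k (e(n := x)) p" if x: "x \<in> univ M" for x
    proof -
      obtain x' where x': "x' \<in> univ N"
        "covers (chars M) (chars N) ?A (case_sum (e(n := x)) k) (case_sum (e'(n := x')) k')"
        "covers (chars N) (chars M) ?A (case_sum (e'(n := x')) k') (case_sum (e(n := x)) k)"
        by (rule N.extend_assignment[OF A g cov x])
      have "sat M k (e(n := x)) p \<longleftrightarrow> sat N k' (e'(n := x')) p"
        by (rule Forall.IH[OF A sub gu[OF x] gu'[OF x'(1)] x'(2,3)])
      with r x'(1) show ?thesis by simp
    qed
    then show "sat M k e (Forall n p)" by simp
  qed
qed

section \<open>Completeness of the theory with a diagram\<close>

lemma holds_id:
  assumes "sentence {} p"
  shows "holds M k p \<longleftrightarrow> holds M k' p"
proof -
  have "sat M k e p \<longleftrightarrow> sat M k' e p" for e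
    by (rule sat_cong) (use assms in \<open>auto simp: sentence_def\<close>)
  then show ?thesis by (simp add: holds_def)
qed

lemma is_model_dense_iff:
  fixes M :: "'a struct"
  shows "is_model (V5 \<union> {D5, S5}) M \<longleftrightarrow> V5_dense M"
proof -
  have "holds M id D5 \<and> holds M id S5 \<longleftrightarrow> V5_dense_axioms M" if "V5_algebra M"
  proof -
    interpret V5_algebra M by (fact that)
    have e: "range (\<lambda>_::nat. zero M) \<subseteq> univ M"
      by auto
    have "holds M id D5 \<longleftrightarrow> sat M id (\<lambda>_. zero M) D5" "holds M id S5 \<longleftrightarrow> sat M id (\<lambda>_. zero M) S5"
      by (rule holds_sentence_iff[OF _ e], use axioms_are_sentences[of "D5 :: 'a fm"] axioms_are_sentences[of "S5 :: 'a fm"] in \<open>simp add: sentence_def\<close>)+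
    then show ?thesis
      unfolding sat_D5 sat_S5 V5_dense_axioms_def by (simp add: Ball_def imp_conjL)
  qed
  then show ?thesis
    using is_model_V5_iff[of M] by (auto simp: V5_dense_def is_model_def model_def)
qed

lemma model_dense:
  fixes M :: "'a struct" and k :: "'a \<Rightarrow> 'a"
  assumes "model A (V5 \<union> {D5, S5} \<union> T) M k"
  shows "V5_dense M"
proof -
  have "holds M id p" if "p \<in> V5 \<union> {D5, S5}" for p
    using assms that holds_id[OF axioms_are_sentences[OF that], of M id k]
    by (auto simp: model_def)
  with assms have "is_model (V5 \<union> {D5, S5}) M"
    by (simp add: is_model_def model_def)
  then show ?thesis
    by (simp only: is_model_dense_iff)
qed

text \<open>The negated equations of the diagram give injectivity, its equations the homomorphism
  conditions.\<close>

lemma embedding_if_diagram: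
  assumes M: "is_struct M" and N: "model (univ M) T N k" and T: "diagram M \<subseteq> T"
  shows "embedding k M N"
proof -
  have kU: "k x \<in> univ N" if "x \<in> univ M" for x
    using N that by (auto simp: model_def)
  have N0: "range (\<lambda>_::nat. zero N) \<subseteq> univ N" and M0: "range (\<lambda>_::nat. zero M) \<subseteq> univ M"
    using N M by (auto simp: model_def is_struct_def)
  have lit: "sat N k (\<lambda>_. zero N) p"
    if "sentence (univ M) p" "literal p" "sat M id (\<lambda>_. zero M) p" for p
  proof -
    have "fv p = {}"
      using that(1) by (simp add: sentence_def)
    then have "p \<in> diagram M"
      using that holds_sentence_iff[OF _ M0] by (auto simp: diagram_def)
    then have "holds N k p"
      using N T by (auto simp: model_def)
    then show ?thesis
      using holds_sentence_iff[OF \<open>fv p = {}\<close> N0] by simp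
  qed
  have "k x = k y \<Longrightarrow> x = y" if "x \<in> univ M" "y \<in> univ M" for x y
    using lit[of "Cst x \<^bold>\<noteq> Cst y"] that by (auto simp: sentence_def)
  moreover have "k (zero M) = zero N" "k (one M) = one N"
    using lit[of "Cst (zero M) \<approx> Zr"] lit[of "Cst (one M) \<approx> On"] M
    by (auto simp: sentence_def is_struct_def)
  moreover have "k (join M x y) = join N (k x) (k y)" "k (meet M x y) = meet N (k x) (k y)"
    "k (diff M x y) = diff N (k x) (k y)" if "x \<in> univ M" "y \<in> univ M" for x y
    using lit[of "Cst (join M x y) \<approx> Cst x \<squnion> Cst y"] lit[of "Cst (meet M x y) \<approx> Cst x \<sqinter> Cst y"]
      lit[of "Cst (diff M x y) \<approx> Cst x \<ominus> Cst y"] M that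
    by (auto simp: sentence_def is_struct_def)
  ultimately show ?thesis
    using kU by (auto simp: embedding_def inj_on_def)
qed

lemma embedding_tval:
  assumes M: "is_struct M" and f: "embedding f M N" and "fvt t = {}"
    and "\<And>c. c \<in> set_trm t \<Longrightarrow> k c \<in> univ M \<and> k' c = f (k c)"
  shows "tval N k' e' t = f (tval M k e t)"
  using assms(3,4)
proof (induction t)
  case (Jn s t)
  have "tval M k e s \<in> univ M" "tval M k e t \<in> univ M"
    by (rule tval_closed[OF M]; use Jn.prems in auto)+
  then show ?case
    using Jn f by (auto simp: embedding_def)
next
  case (Mt s t)
  have "tval M k e s \<in> univ M" "tval M k e t \<in> univ M"
    by (rule tval_closed[OF M]; use Mt.prems in auto)+
  then show ?case
    using Mt f by (auto simp: embedding_def)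
next
  case (Df s t)
  have "tval M k e s \<in> univ M" "tval M k e t \<in> univ M"
    by (rule tval_closed[OF M]; use Df.prems in auto)+
  then show ?case
    using Df f by (auto simp: embedding_def)
qed (use f in \<open>auto simp: embedding_def\<close>)

lemma diagram_holds:
  assumes M: "is_struct M" and f: "embedding f M N" and N: "is_struct N" and p: "p \<in> diagram M"
  shows "holds N f p"
proof -
  define e where "e = (\<lambda>_::nat. zero M)"
  define e' where "e' = (\<lambda>_::nat. zero N)"
  have e: "range e \<subseteq> univ M" and e': "range e' \<subseteq> univ N"
    using M N by (auto simp: is_struct_def e_def e'_def)
  have sp: "fv p = {}" "set_fm p \<subseteq> univ M" "literal p" "holds M id p"
    using p by (auto simp: diagram_def sentence_def)
  have "tval N f e' s = tval N f e' t \<longleftrightarrow> tval M id e s = tval M id e t"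
    if "fvt s = {}" "fvt t = {}" "set_trm s \<subseteq> univ M" "set_trm t \<subseteq> univ M" for s t
  proof -
    have "tval M id e s \<in> univ M" "tval M id e t \<in> univ M"
      by (rule tval_closed[OF M]; use that in auto)+
    moreover have "tval N f e' s = f (tval M id e s)" "tval N f e' t = f (tval M id e t)"
      by (rule embedding_tval[OF M f]; use that in auto)+
    moreover have "inj_on f (univ M)"
      using f by (simp add: embedding_def)
    ultimately show ?thesis
      by (simp add: inj_on_eq_iff)
  qed
  then have "sat N f e' p \<longleftrightarrow> sat M id e p"
    using sp(1-3) by (cases p rule: literal.cases) auto
  then show ?thesis
    using sp holds_sentence_iff[OF sp(1) e] holds_sentence_iff[OF sp(1) e'] by simp
qed

text \<open>A character of \<open>N\<close> restricts along \<open>k\<close> to \<open>M\<close> and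
  lifts along \<open>k'\<close> to \<open>N'\<close>. Hence \<open>M\<close> alone determines the
  pattern sets of its tuples in any extension; this takes the place of amalgamation.\<close>

lemma covers_embeddings:
  assumes M: "V5_algebra M" and N: "V5_algebra N" "V5_algebra N'"
    and k: "embedding k M N" "embedding k' M N'" and S: "S \<subseteq> univ M"
  shows "covers (chars N) (chars N') (Inr ` S) (case_sum e k) (case_sum e' k')"
  unfolding covers_def
proof
  interpret M: V5_algebra M by (fact M)
  fix \<chi> assume \<chi>: "\<chi> \<in> chars N"
  have "(\<lambda>x. \<chi> (k x)) \<in> chars M"
    using \<chi> k(1) by (auto simp: chars_def embedding_def image_subset_iff)
  then obtain \<chi>' where "\<chi>' \<in> chars N'" "\<And>x. x \<in> univ M \<Longrightarrow> \<chi>' (k' x) = \<chi> (k x)"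
    using char_lift[OF M N(2) k(2), of "\<lambda>x. \<chi> (k x)"] by blast
  with S show "\<exists>\<chi>'\<in>chars N'. \<forall>i\<in>Inr ` S. \<chi> (case_sum e k i) = \<chi>' (case_sum e' k' i)"
    by (intro bexI[of _ \<chi>']) auto
qed

lemma trm_consts_finite: "finite (set_trm t)"
  by (induction t) auto

lemma fm_consts_finite: "finite (set_fm p)"
  by (induction p) (auto simp: trm_consts_finite)

text \<open>Both models extend \<open>M\<close>, so the finitely many constants of \<open>p\<close>
  have equal pattern sets in them, and \<open>sat_transfer\<close> applies.\<close>

theorem diagram_complete:
  fixes M N N' :: "'u struct" and k k' :: "'u \<Rightarrow> 'u"
  assumes M: "V5_algebra M" and p: "sentence (univ M) p"
    and N: "model (univ M) (V5 \<union> {D5, S5} \<union> diagram M) N k"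
    and N': "model (univ M) (V5 \<union> {D5, S5} \<union> diagram M) N' k'"
    and "holds N k p"
  shows "holds N' k' p"
proof -
  have struct: "is_struct M"
    using M by (rule V5_algebra.is_struct)
  have D: "V5_dense N" "V5_dense N'"
    using model_dense[OF N] model_dense[OF N'] by simp_all
  then have V: "V5_algebra N" "V5_algebra N'"
    by (simp_all add: V5_dense_def)
  have emb: "embedding k M N" "embedding k' M N'"
    using embedding_if_diagram[OF struct N] embedding_if_diagram[OF struct N'] by auto
  have S: "set_fm p \<subseteq> univ M" "fv p = {}"
    using p by (auto simp: sentence_def)
  have kU: "k x \<in> univ N" "k' x \<in> univ N'" if "x \<in> set_fm p" for x
    using emb S(1) that by (auto simp: embedding_def)
  define e where "e = (\<lambda>_::nat. zero N)"
  define e' where "e' = (\<lambda>_::nat. zero N')"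
  have e: "range e \<subseteq> univ N" "range e' \<subseteq> univ N'"
    using V by (auto simp: e_def e'_def V5_algebra.zero_closed)
  have "sat N k e p \<longleftrightarrow> sat N' k' e' p"
  proof (rule sat_transfer[OF D, of "Inr ` set_fm p"])
    show "covers (chars N) (chars N') (Inr ` set_fm p) (case_sum e k) (case_sum e' k')"
      by (rule covers_embeddings[OF M V emb S(1)])
    show "covers (chars N') (chars N) (Inr ` set_fm p) (case_sum e' k') (case_sum e k)"
      by (rule covers_embeddings[OF M V(2,1) emb(2,1) S(1)])
  qed (use S(2) kU fm_consts_finite in auto)
  then show ?thesis
    using assms(5) holds_sentence_iff[OF S(2) e(1)] holds_sentence_iff[OF S(2) e(2)] by simp
qed

section \<open>Extension to a model of D5 and S5\<close>

unbundle cardinal_syntax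

lemma finite_ordLeq_infinite: "finite A \<Longrightarrow> |A| \<le>o |UNIV :: 'u::infinite set|"
  by (intro ordLess_imp_ordLeq finite_ordLess_infinite) (auto simp: card_of_well_order_on Field_card_of infinite_UNIV)

text \<open>Arity three is dictated by S5, whose witnesses depend on three elements; operations of
  smaller arity ignore the surplus arguments.\<close>

lemma closure_ordLeq:
  fixes A B :: "'b set" and \<Omega> :: "('b \<Rightarrow> 'b \<Rightarrow> 'b \<Rightarrow> 'b) set"
  assumes "finite \<Omega>" "A \<subseteq> B" and A: "|A| \<le>o |UNIV :: 'u::infinite set|"
    and B: "\<forall>w\<in>\<Omega>. \<forall>x\<in>B. \<forall>y\<in>B. \<forall>z\<in>B. w x y z \<in> B"
  obtains C where "A \<subseteq> C" "C \<subseteq> B" "|C| \<le>o |UNIV :: 'u set|"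
    "\<forall>w\<in>\<Omega>. \<forall>x\<in>C. \<forall>y\<in>C. \<forall>z\<in>C. w x y z \<in> C"
proof -
  have inf: "infinite (UNIV :: 'u set)"
    by (rule infinite_UNIV)
  \<comment> \<open>The added projection makes \<open>step\<close> increasing, so arguments from
    different stages meet in a common one.\<close>
  define \<Omega>' where "\<Omega>' = insert (\<lambda>x y z. x) \<Omega>"
  define step where "step X = (\<Union>w\<in>\<Omega>'. (\<lambda>(x, y, z). w x y z) ` (X \<times> X \<times> X))" for X
  have mem: "w x y z \<in> step X" if "w \<in> \<Omega>'" "x \<in> X" "y \<in> X" "z \<in> X" for w x y z X
    unfolding step_def using that by force
  have incr: "X \<subseteq> step X" for X
    using mem[of "\<lambda>x y z. x"] by (auto simp: \<Omega>'_def)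
  have sub: "step X \<subseteq> B" if "X \<subseteq> B" for X
  proof -
    have "w x y z \<in> B" if "w \<in> \<Omega>'" "x \<in> X" "y \<in> X" "z \<in> X" for w x y z
      using that \<open>X \<subseteq> B\<close> B by (auto simp: \<Omega>'_def subset_iff)
    then show ?thesis by (auto simp: step_def)
  qed
  have fin: "finite \<Omega>'"
    using assms(1) by (simp add: \<Omega>'_def)
  have card: "|step X| \<le>o |UNIV :: 'u set|" if X: "|X| \<le>o |UNIV :: 'u set|" for X
    unfolding step_def
  proof (rule card_of_UNION_ordLeq_infinite[OF inf finite_ordLeq_infinite[OF fin]], rule ballI)
    fix w :: "'b \<Rightarrow> 'b \<Rightarrow> 'b \<Rightarrow> 'b"
    have "|X \<times> X \<times> X| \<le>o |UNIV :: 'u set|"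
      by (intro card_of_Times_ordLeq_infinite_Field X) (simp_all add: inf Field_card_of card_of_card_order_on)
    then show "|(\<lambda>(x, y, z). w x y z) ` (X \<times> X \<times> X)| \<le>o |UNIV :: 'u set|"
      using card_of_image ordLeq_transitive by blast
  qed
  define C where "C = (\<Union>n. (step ^^ n) A)"
  have mono: "(step ^^ m) A \<subseteq> (step ^^ n) A" if "m \<le> n" for m n
    by (rule lift_Suc_mono_le[OF _ that]) (use incr in auto)
  have pow_sub: "(step ^^ n) A \<subseteq> B" for n
    by (induction n) (use assms(2) sub in auto)
  have pow_card: "|(step ^^ n) A| \<le>o |UNIV :: 'u set|" for n
    by (induction n) (use A card in auto)
  show thesis
  proof (rule that[of C])
    show "A \<subseteq> C"
      unfolding C_def by (rule order_trans[OF _ UN_upper[of 0]]) auto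
    show "C \<subseteq> B"
      unfolding C_def using pow_sub by blast
    show "|C| \<le>o |UNIV :: 'u set|"
      unfolding C_def using inf pow_card infinite_iff_card_of_nat
      by (intro card_of_UNION_ordLeq_infinite) auto
    show "\<forall>w\<in>\<Omega>. \<forall>x\<in>C. \<forall>y\<in>C. \<forall>z\<in>C. w x y z \<in> C"
    proof (intro ballI)
      fix w x y z assume w: "w \<in> \<Omega>" "x \<in> C" "y \<in> C" "z \<in> C"
      then obtain l m n where "x \<in> (step ^^ l) A" "y \<in> (step ^^ m) A" "z \<in> (step ^^ n) A"
        by (auto simp: C_def)
      then have "x \<in> (step ^^ (l + m + n)) A" "y \<in> (step ^^ (l + m + n)) A" "z \<in> (step ^^ (l + m + n)) A"
        using mono[of l "l + m + n"] mono[of m "l + m + n"] mono[of n "l + m + n"] by auto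
      then have "w x y z \<in> (step ^^ Suc (l + m + n)) A"
        using mem[of w] w(1) by (simp add: \<Omega>'_def)
      then show "w x y z \<in> C"
        unfolding C_def by blast
    qed
  qed
qed

text \<open>The axioms are universal: identities and one implication between equations, all
  reflected by an injective homomorphism.\<close>

lemma V5_algebra_if_embedding:
  assumes N: "V5_algebra N" and struct: "is_struct M" and h: "embedding h M N"
  shows "V5_algebra M"
proof -
  interpret N: V5_algebra N by (fact N)
  have hU: "h x \<in> univ N" if "x \<in> univ M" for x
    using h that by (auto simp: embedding_def)
  have c01: "zero M \<in> univ M" "one M \<in> univ M"
    using struct by (simp_all add: is_struct_def)
  have c: "join M x y \<in> univ M" "meet M x y \<in> univ M" "diff M x y \<in> univ M"
    if "x \<in> univ M" "y \<in> univ M" for x y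
    using struct that by (simp_all add: is_struct_def)
  have h01: "h (zero M) = zero N" "h (one M) = one N"
    using h by (simp_all add: embedding_def)
  have hom: "h (join M x y) = join N (h x) (h y)" "h (meet M x y) = meet N (h x) (h y)"
    "h (diff M x y) = diff N (h x) (h y)" if "x \<in> univ M" "y \<in> univ M" for x y
    using h that by (simp_all add: embedding_def)
  have eqI: "x = y" if "x \<in> univ M" "y \<in> univ M" "h x = h y" for x y
    using h that by (auto simp: embedding_def inj_on_def)
  note simps = c01 c h01 hom hU
  show ?thesis
  proof
    show "zero M \<in> univ M" "one M \<in> univ M"
      by (fact c01)+
  next
    fix x y assume xy: "x \<in> univ M" "y \<in> univ M"
    show "join M x y \<in> univ M" "meet M x y \<in> univ M" "diff M x y \<in> univ M"
      using c[OF xy] .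
    show "join M x y = join M y x"
      by (rule eqI) (use xy N.join_comm[of "h x" "h y"] in \<open>simp_all add: simps\<close>)
    show "meet M x y = meet M y x"
      by (rule eqI) (use xy N.meet_comm[of "h x" "h y"] in \<open>simp_all add: simps\<close>)
    show "join M x (meet M x y) = x"
      by (rule eqI) (use xy in \<open>simp_all add: simps N.join_meet_absorb\<close>)
    show "meet M x (join M x y) = x"
      by (rule eqI) (use xy in \<open>simp_all add: simps N.meet_join_absorb\<close>)
    show "meet M x (join M y (diff M x y)) = x"
      by (rule eqI) (use xy in \<open>simp_all add: simps N.le_join_diff\<close>)
    show "meet M (diff M (meet M (diff M (one M) x) x) y) y = zero M"
      by (rule eqI) (use xy in \<open>simp_all add: simps N.depth_two\<close>)
    fix z assume z: "z \<in> univ M"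
    show "join M (join M x y) z = join M x (join M y z)"
      by (rule eqI) (use xy z in \<open>simp_all add: simps N.join_assoc\<close>)
    show "meet M (meet M x y) z = meet M x (meet M y z)"
      by (rule eqI) (use xy z in \<open>simp_all add: simps N.meet_assoc\<close>)
    show "meet M x (join M y z) = join M (meet M x y) (meet M x z)"
      by (rule eqI) (use xy z in \<open>simp_all add: simps N.meet_join_distrib\<close>)
    assume "meet M x (join M y z) = x"
    then have "meet N (h x) (join N (h y) (h z)) = h x"
      using xy z by (metis c(1) hom(1,2))
    then show "meet M (diff M x y) z = diff M x y"
      by (intro eqI) (use xy z in \<open>simp_all add: simps N.diff_least\<close>)
  next
    fix x assume x: "x \<in> univ M"
    show "meet M (zero M) x = zero M"
      by (rule eqI) (use x in \<open>simp_all add: simps N.zero_least\<close>)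
    show "meet M x (one M) = x"
      by (rule eqI) (use x in \<open>simp_all add: simps N.one_greatest\<close>)
    show "meet M (diff M (one M) x) (diff M (one M) (diff M (one M) x)) = zero M"
      by (rule eqI) (use x in \<open>simp_all add: simps N.dual_stone\<close>)
  qed
qed

lemma downward_loewenheim_skolem:
  fixes N :: "'b struct" and A :: "'b set"
  assumes N: "V5_dense N" and A: "A \<subseteq> univ N" "|A| \<le>o |UNIV :: 'u::infinite set|"
  obtains M :: "'u::infinite struct" and h where "V5_dense M" "embedding h M N" "A \<subseteq> h ` univ M"
proof -
  interpret N: V5_dense N by (fact N)
  let ?U = "univ N"
  \<comment> \<open>Skolem functions: \<open>d\<close> for D5 and \<open>s\<close>, with a pair of
    witnesses as its value, for S5.\<close>
  have "\<forall>a\<in>?U. \<exists>b. b \<in> ?U \<and> (a = N.reg a \<longrightarrow> a \<noteq> zero N \<longrightarrow>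
      b \<noteq> zero N \<and> diff N a b = a \<and> meet N b a = b)"
    using N.D5 N.zero_closed by blast
  then obtain d where d: "\<forall>a\<in>?U. d a \<in> ?U \<and> (a = N.reg a \<longrightarrow> a \<noteq> zero N \<longrightarrow>
      d a \<noteq> zero N \<and> diff N a (d a) = a \<and> meet N (d a) a = d a)"
    by (rule bchoice[THEN exE])
  define good where "good a b1 b2 p \<longleftrightarrow>
      diff N a (join N b1 b2) = a \<and> meet N (join N b1 b2) a = join N b1 b2 \<and> a \<noteq> zero N \<and>
      meet N (meet N b1 b2) (N.reg a) = zero N \<longrightarrow>
      fst p \<noteq> zero N \<and> snd p \<noteq> zero N \<and> diff N a (snd p) = fst p \<and> meet N b1 (fst p) = b1 \<and>
      diff N a (fst p) = snd p \<and> meet N b2 (snd p) = b2 \<and> meet N (fst p) (snd p) = meet N b1 b2"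
    for a b1 b2 p
  have "\<exists>p. fst p \<in> ?U \<and> snd p \<in> ?U \<and> good a b1 b2 p" if "a \<in> ?U" "b1 \<in> ?U" "b2 \<in> ?U" for a b1 b2
  proof (cases "diff N a (join N b1 b2) = a \<and> meet N (join N b1 b2) a = join N b1 b2 \<and> a \<noteq> zero N \<and>
      meet N (meet N b1 b2) (N.reg a) = zero N")
    case True
    then show ?thesis
      using N.S5[OF that] unfolding good_def by auto
  next
    case False
    \<comment> \<open>If the hypotheses of S5 fail, \<open>good\<close> holds of every pair; this
      one lies in the universe.\<close>
    then show ?thesis
      unfolding good_def by (intro exI[of _ "(zero N, zero N)"]) auto
  qed
  then obtain s where s: "\<And>a b1 b2. a \<in> ?U \<Longrightarrow> b1 \<in> ?U \<Longrightarrow> b2 \<in> ?U \<Longrightarrow>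
      fst (s a b1 b2) \<in> ?U \<and> snd (s a b1 b2) \<in> ?U \<and> good a b1 b2 (s a b1 b2)"
    by metis
  define \<Omega> where "\<Omega> = {\<lambda>x y z. zero N, \<lambda>x y z. one N, \<lambda>x y z. join N x y, \<lambda>x y z. meet N x y,
    \<lambda>x y z. diff N x y, \<lambda>x y z. d x, \<lambda>x y z. fst (s x y z), \<lambda>x y z. snd (s x y z)}"
  have fin: "finite \<Omega>"
    by (simp add: \<Omega>_def)
  \<comment> \<open>The added zero makes the closure non-empty, so that the constant operations in
    \<open>\<Omega>\<close> have arguments to act on.\<close>
  have A0: "insert (zero N) A \<subseteq> ?U"
    using A by auto
  have "|{zero N} \<union> A| \<le>o |UNIV :: 'u set|"
    by (intro card_of_Un_ordLeq_infinite_Field A(2) finite_ordLeq_infinite)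
      (simp_all add: Field_card_of card_of_card_order_on infinite_UNIV)
  then have A1: "|insert (zero N) A| \<le>o |UNIV :: 'u set|"
    by simp
  have \<Omega>U: "w x y z \<in> ?U" if "w \<in> \<Omega>" "x \<in> ?U" "y \<in> ?U" "z \<in> ?U" for w x y z
    using that d s[of x y z] by (auto simp: \<Omega>_def)
  then have "\<forall>w\<in>\<Omega>. \<forall>x\<in>?U. \<forall>y\<in>?U. \<forall>z\<in>?U. w x y z \<in> ?U"
    by blast
  then obtain C where C: "insert (zero N) A \<subseteq> C" "C \<subseteq> ?U" "|C| \<le>o |UNIV :: 'u set|"
    and cl0: "\<forall>w\<in>\<Omega>. \<forall>x\<in>C. \<forall>y\<in>C. \<forall>z\<in>C. w x y z \<in> C"
    by (rule closure_ordLeq[OF fin A0 A1])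
  have cl: "w x y z \<in> C" if "w \<in> \<Omega>" "x \<in> C" "y \<in> C" "z \<in> C" for w x y z
    using cl0 that by blast
  have z: "zero N \<in> C"
    using C(1) by blast
  have one: "one N \<in> C"
    using cl[OF _ z z z, of "\<lambda>x y z. one N"] by (simp add: \<Omega>_def)
  have ops: "join N x y \<in> C" "meet N x y \<in> C" "diff N x y \<in> C" if "x \<in> C" "y \<in> C" for x y
    using cl[OF _ that z, of "\<lambda>x y z. join N x y"] cl[OF _ that z, of "\<lambda>x y z. meet N x y"]
      cl[OF _ that z, of "\<lambda>x y z. diff N x y"] by (simp_all add: \<Omega>_def)
  have dC: "d x \<in> C" if "x \<in> C" for x
    using cl[OF _ that that that, of "\<lambda>x y z. d x"] by (simp add: \<Omega>_def)
  have sC: "fst (s x y z) \<in> C" "snd (s x y z) \<in> C" if "x \<in> C" "y \<in> C" "z \<in> C" for x y z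
    using cl[OF _ that, of "\<lambda>x y z. fst (s x y z)"] cl[OF _ that, of "\<lambda>x y z. snd (s x y z)"]
    by (simp_all add: \<Omega>_def)
  have "\<exists>g :: 'b \<Rightarrow> 'u. inj_on g C \<and> g ` C \<subseteq> UNIV"
    using C(3) by (simp only: card_of_ordLeq)
  then obtain g :: "'b \<Rightarrow> 'u" where g: "inj_on g C"
    by blast
  define h where "h = inv_into C g"
  have hg: "h (g x) = x" if "x \<in> C" for x
    using that g by (simp add: h_def)
  \<comment> \<open>The closed subset \<open>C\<close> is copied into \<open>'u\<close> along the
    injection \<open>g\<close>, with inverse \<open>h\<close>.\<close>
  define M where "M = \<lparr>univ = g ` C, zero = g (zero N), one = g (one N),
    join = \<lambda>x y. g (join N (h x) (h y)), meet = \<lambda>x y. g (meet N (h x) (h y)),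
    diff = \<lambda>x y. g (diff N (h x) (h y))\<rparr>"
  have Ms: "univ M = g ` C" "zero M = g (zero N)" "one M = g (one N)"
    "join M x y = g (join N (h x) (h y))" "meet M x y = g (meet N (h x) (h y))"
    "diff M x y = g (diff N (h x) (h y))" for x y
    by (simp_all add: M_def)
  have struct: "is_struct M"
    using z one ops by (auto simp: is_struct_def Ms hg)
  have emb: "embedding h M N"
    unfolding embedding_def using z one ops C(2)
    by (auto simp: Ms hg inj_on_def)
  have img: "h ` univ M = C"
    by (auto simp: Ms hg image_image)
  interpret M: V5_algebra M
    by (rule V5_algebra_if_embedding[OF _ struct emb]) unfold_locales
  have g_eq: "g x = g y \<longleftrightarrow> x = y" if "x \<in> C" "y \<in> C" for x y
    using g that by (simp add: inj_on_eq_iff)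
  have "V5_dense M"
  proof
    fix a assume a: "a \<in> univ M" "a = M.reg a" "a \<noteq> zero M"
    then obtain x where x: "x \<in> C" "a = g x"
      by (auto simp: Ms)
    have "x = N.reg x" "x \<noteq> zero N"
      using a x one ops z by (auto simp: Ms hg g_eq)
    then have "d x \<noteq> zero N \<and> diff N x (d x) = x \<and> meet N (d x) x = d x"
      using d x(1) C(2) by blast
    then show "\<exists>b\<in>univ M. b \<noteq> zero M \<and> diff M a b = a \<and> meet M b a = b"
      using x dC[OF x(1)] z by (intro bexI[of _ "g (d x)"]) (auto simp: Ms hg g_eq)
  next
    fix a b1 b2
    assume ab: "a \<in> univ M" "b1 \<in> univ M" "b2 \<in> univ M"
      and 1: "diff M a (join M b1 b2) = a" "meet M (join M b1 b2) a = join M b1 b2" "a \<noteq> zero M"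
        "meet M (meet M b1 b2) (M.reg a) = zero M"
    obtain x y1 y2 where x: "x \<in> C" "a = g x" "y1 \<in> C" "b1 = g y1" "y2 \<in> C" "b2 = g y2"
      using ab by (auto simp: Ms)
    have "good x y1 y2 (s x y1 y2)"
      using s[of x y1 y2] x C(2) by blast
    moreover have "diff N x (join N y1 y2) = x" "meet N (join N y1 y2) x = join N y1 y2" "x \<noteq> zero N"
      "meet N (meet N y1 y2) (N.reg x) = zero N"
      using 1 x one ops z by (auto simp: Ms hg g_eq)
    ultimately have sp: "fst (s x y1 y2) \<noteq> zero N \<and> snd (s x y1 y2) \<noteq> zero N \<and>
      diff N x (snd (s x y1 y2)) = fst (s x y1 y2) \<and> meet N y1 (fst (s x y1 y2)) = y1 \<and>
      diff N x (fst (s x y1 y2)) = snd (s x y1 y2) \<and> meet N y2 (snd (s x y1 y2)) = y2 \<and>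
      meet N (fst (s x y1 y2)) (snd (s x y1 y2)) = meet N y1 y2"
      by (simp add: good_def)
    show "\<exists>a1\<in>univ M. \<exists>a2\<in>univ M. a1 \<noteq> zero M \<and> a2 \<noteq> zero M \<and>
        diff M a a2 = a1 \<and> meet M b1 a1 = b1 \<and> diff M a a1 = a2 \<and> meet M b2 a2 = b2 \<and>
        meet M a1 a2 = meet M b1 b2"
      using sp sC[OF x(1,3,5)] x z ops
      by (intro bexI[of _ "g (fst (s x y1 y2))"] bexI[of _ "g (snd (s x y1 y2))"])
        (auto simp: Ms hg g_eq)
  qed
  then show thesis
    by (rule that[OF _ emb]) (use img C(1) in simp)
qed

text \<open>
  In the concrete model, the minimal points are the sequences \<open>s\<close>, topologized by their initial segments,
  and a non-minimal point sits above \<open>s\<close> if \<open>s\<close> is eventually in \<open>{0, 1}\<close>. An element of level \<open>n\<close> is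
  determined by its values on sequences that vanish from \<open>n\<close> on (\<open>sect\<close>): its minimal points depend
  on the first \<open>n\<close> coordinates, and its further points only occur above \<open>low n\<close>.
\<close>

definition trunc :: "nat \<Rightarrow> (nat \<Rightarrow> nat) \<Rightarrow> nat \<Rightarrow> nat" where
  "trunc n s = (\<lambda>i. if i < n then s i else 0)"

definition low :: "nat \<Rightarrow> (nat \<Rightarrow> nat) set" where
  "low n = {s. \<forall>i\<ge>n. s i < 2}"

definition sect :: "nat \<Rightarrow> ((nat \<Rightarrow> nat) \<Rightarrow> nat) \<Rightarrow> bool" where
  "sect n f \<longleftrightarrow> (\<forall>s. f s \<le> 2 \<and> f s = (if s \<in> low n then f (trunc n s) else mn3 (f (trunc n s))))"

lemma trunc_low: "trunc n s \<in> low n"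
  by (simp add: low_def trunc_def)

lemma trunc_trunc: "m \<le> n \<Longrightarrow> trunc m (trunc n s) = trunc m s"
  by (auto simp: trunc_def)

lemma sect_le: "sect n f \<Longrightarrow> f s \<le> 2"
  unfolding sect_def by blast

lemma sect_eq: "sect n f \<Longrightarrow> f s = (if s \<in> low n then f (trunc n s) else mn3 (f (trunc n s)))"
  unfolding sect_def by blast

lemma mn3_idem: "mn3 (mn3 v) = mn3 v"
  by (simp add: mn3_def)

lemma sect_mono:
  assumes f: "sect m f" and "m \<le> n"
  shows "sect n f"
  unfolding sect_def
proof (intro allI conjI)
  fix s
  show "f s \<le> 2"
    by (rule sect_le[OF f])
  \<comment> \<open>Of the coordinates from \<open>m\<close> on, those before \<open>n\<close> are
    visible in \<open>trunc n s\<close>, the others in \<open>s\<close>.\<close>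
  have "s \<in> low m \<longleftrightarrow> trunc n s \<in> low m \<and> s \<in> low n"
  proof
    assume "trunc n s \<in> low m \<and> s \<in> low n"
    then have t: "trunc n s \<in> low m" and s: "s \<in> low n" by auto
    have "s i < 2" if i: "i \<ge> m" for i
    proof (cases "i < n")
      case True
      then show ?thesis
        using t i by (auto simp: low_def trunc_def split: if_splits)
    next
      case False
      then show ?thesis
        using s by (simp add: low_def)
    qed
    then show "s \<in> low m" by (simp add: low_def)
  qed (use \<open>m \<le> n\<close> in \<open>simp add: low_def trunc_def\<close>)
  then show "f s = (if s \<in> low n then f (trunc n s) else mn3 (f (trunc n s)))"
    using sect_eq[OF f, of s] sect_eq[OF f, of "trunc n s"] trunc_trunc[OF assms(2), of s]
    by (simp add: mn3_idem split: if_splits)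
qed

text \<open>Any operation on the chain that commutes with \<open>mn3\<close> preserves the defining
  equation of a common level.\<close>

lemma sect_op:
  assumes "sect m f" "sect n g"
    and op: "\<And>v w. v \<le> 2 \<Longrightarrow> w \<le> 2 \<Longrightarrow> op v w \<le> 2" "\<And>v w. v \<le> 2 \<Longrightarrow> w \<le> 2 \<Longrightarrow> op (mn3 v) (mn3 w) = mn3 (op v w)"
  shows "sect (max m n) (\<lambda>s. op (f s) (g s))"
proof -
  have f: "sect (max m n) f" and g: "sect (max m n) g"
    using assms(1,2) by (auto intro: sect_mono)
  show ?thesis
    unfolding sect_def
  proof (intro allI conjI)
    fix s
    show "op (f s) (g s) \<le> 2"
      using op(1) sect_le[OF f] sect_le[OF g] by blast
    show "op (f s) (g s) = (if s \<in> low (max m n)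
      then op (f (trunc (max m n) s)) (g (trunc (max m n) s))
      else mn3 (op (f (trunc (max m n) s)) (g (trunc (max m n) s))))"
      unfolding sect_eq[OF f, of s] sect_eq[OF g, of s] by (simp add: op(2) sect_le[OF f] sect_le[OF g])
  qed
qed

text \<open>One copy of the concrete model for each index, with levels that may vary from index to
  index. The fixed value 0 outside \<open>I\<close> turns equality over \<open>I\<close> into
  equality of functions.\<close>

definition power_struct :: "'i set \<Rightarrow> ('i \<times> (nat \<Rightarrow> nat) \<Rightarrow> nat) struct" where
  "power_struct I = \<lparr>univ = {F. \<forall>i. if i \<in> I then \<exists>n. sect n (\<lambda>s. F (i, s)) else \<forall>s. F (i, s) = 0},
     zero = (\<lambda>p. 0), one = (\<lambda>p. if fst p \<in> I then 2 else 0),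
     join = (\<lambda>F G p. max (F p) (G p)), meet = (\<lambda>F G p. min (F p) (G p)),
     diff = (\<lambda>F G p. df3 (F p) (G p))\<rparr>"

lemma power_struct_simps:
  "zero (power_struct I) = (\<lambda>p. 0)" "one (power_struct I) = (\<lambda>p. if fst p \<in> I then 2 else 0)"
  "join (power_struct I) F G = (\<lambda>p. max (F p) (G p))"
  "meet (power_struct I) F G = (\<lambda>p. min (F p) (G p))"
  "diff (power_struct I) F G = (\<lambda>p. df3 (F p) (G p))"
  by (simp_all add: power_struct_def)

lemma power_univI:
  assumes "\<And>i. i \<in> I \<Longrightarrow> \<exists>n. sect n (\<lambda>s. F (i, s))" "\<And>i s. i \<notin> I \<Longrightarrow> F (i, s) = 0"
  shows "F \<in> univ (power_struct I)"
  using assms by (simp add: power_struct_def)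

lemma power_sect: "F \<in> univ (power_struct I) \<Longrightarrow> i \<in> I \<Longrightarrow> \<exists>n. sect n (\<lambda>s. F (i, s))"
  by (simp add: power_struct_def split: if_splits)

lemma power_outside: "F \<in> univ (power_struct I) \<Longrightarrow> i \<notin> I \<Longrightarrow> F (i, s) = 0"
  by (simp add: power_struct_def split: if_splits)

lemma power_le: "F \<in> univ (power_struct I) \<Longrightarrow> F p \<le> (if fst p \<in> I then 2 else 0)"
  using power_sect[of F I "fst p"] power_outside[of F I "fst p" "snd p"] sect_le[of _ _ "snd p"]
  by fastforce

lemma power_op:
  assumes F: "F \<in> univ (power_struct I)" and G: "G \<in> univ (power_struct I)"
    and op: "\<And>v w. v \<le> 2 \<Longrightarrow> w \<le> 2 \<Longrightarrow> op v w \<le> 2" "\<And>v w. v \<le> 2 \<Longrightarrow> w \<le> 2 \<Longrightarrow> op (mn3 v) (mn3 w) = mn3 (op v w)"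
      "op 0 0 = 0"
  shows "(\<lambda>p. op (F p) (G p)) \<in> univ (power_struct I)"
proof (rule power_univI)
  fix i assume "i \<in> I"
  then obtain m n where "sect m (\<lambda>s. F (i, s))" "sect n (\<lambda>s. G (i, s))"
    using power_sect F G by metis
  from sect_op[where op = op, OF this op(1,2)] show "\<exists>n. sect n (\<lambda>s. op (F (i, s)) (G (i, s)))"
    by blast
next
  fix i s assume "i \<notin> I"
  then show "op (F (i, s)) (G (i, s)) = 0"
    using power_outside F G op(3) by metis
qed

lemma power_V5_algebra: "V5_algebra (power_struct I)"
proof
  show "zero (power_struct I) \<in> univ (power_struct I)" "one (power_struct I) \<in> univ (power_struct I)"
    by (rule power_univI; simp add: power_struct_simps sect_def mn3_def)+
next
  fix x y assume xy: "x \<in> univ (power_struct I)" "y \<in> univ (power_struct I)"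
  show "join (power_struct I) x y \<in> univ (power_struct I)"
    unfolding power_struct_simps by (rule power_op[OF xy]) (auto simp: mn3_def max_def)
  show "meet (power_struct I) x y \<in> univ (power_struct I)"
    unfolding power_struct_simps by (rule power_op[OF xy]) (auto simp: mn3_def min_def)
  show "diff (power_struct I) x y \<in> univ (power_struct I)"
    unfolding power_struct_simps by (rule power_op[OF xy]) (auto simp: mn3_def df3_def)
  show "meet (power_struct I) (diff (power_struct I) (meet (power_struct I)
      (diff (power_struct I) (one (power_struct I)) x) x) y) y = zero (power_struct I)"
    unfolding power_struct_simps
  proof
    fix p
    show "min (df3 (min (df3 (if fst p \<in> I then 2 else 0) (x p)) (x p)) (y p)) (y p) = 0"
      using power_le[OF xy(1), of p] by (auto simp: df3_def min_def)
  qed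
  fix z assume "meet (power_struct I) x (join (power_struct I) y z) = x"
  then have le: "min (x p) (max (y p) (z p)) = x p" for p
    unfolding power_struct_simps by (rule fun_cong)
  show "meet (power_struct I) (diff (power_struct I) x y) z = diff (power_struct I) x y"
    unfolding power_struct_simps
  proof
    fix p
    show "min (df3 (x p) (y p)) (z p) = df3 (x p) (y p)"
      using le[of p] by (auto simp: df3_def min_def max_def split: if_splits)
  qed
next
  fix x assume x: "x \<in> univ (power_struct I)"
  show "meet (power_struct I) x (one (power_struct I)) = x"
    unfolding power_struct_simps
  proof
    fix p
    show "min (x p) (if fst p \<in> I then 2 else 0) = x p"
      using power_le[OF x, of p] by (simp split: if_splits)
  qed
qed (auto simp: power_struct_simps fun_eq_iff df3_def max_def min_def)

lemma sect_restrict: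
  assumes f: "sect n f" and P: "\<And>s. P s \<longleftrightarrow> P (trunc n s)"
  shows "sect n (\<lambda>s. if P s then f s else 0)"
  unfolding sect_def
proof (intro allI conjI)
  fix s
  show "(if P s then f s else 0) \<le> 2"
    using sect_le[OF f] by simp
  show "(if P s then f s else 0) = (if s \<in> low n then if P (trunc n s) then f (trunc n s) else 0
    else mn3 (if P (trunc n s) then f (trunc n s) else 0))"
    using sect_eq[OF f, of s] P[of s] by (simp add: mn3_def)
qed

lemma trunc_upd: "trunc n ((trunc n s)(n := v)) = trunc n s"
  by (auto simp: trunc_def)

lemma power_nonzero:
  assumes "F \<in> univ (power_struct I)" "F \<noteq> (\<lambda>p. 0)"
  obtains i s where "i \<in> I" "F (i, s) \<noteq> 0"
proof -
  obtain i s where "F (i, s) \<noteq> 0"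
    using assms(2) by fastforce
  moreover from this have "i \<in> I"
    using power_outside[OF assms(1), of i s] by (cases "i \<in> I") simp_all
  ultimately show thesis
    by (intro that)
qed

lemma power_D5:
  assumes a: "a \<in> univ (power_struct I)" and reg: "\<And>p. a p \<noteq> 1" and "a \<noteq> (\<lambda>p. 0)"
  obtains b where "b \<in> univ (power_struct I)" "b \<noteq> (\<lambda>p. 0)" "\<And>p. df3 (a p) (b p) = a p"
    "\<And>p. min (b p) (a p) = b p"
proof -
  have "\<forall>i\<in>I. \<exists>n. sect n (\<lambda>s. a (i, s))"
    using power_sect[OF a] by blast
  then obtain n where n: "\<forall>i\<in>I. sect (n i) (\<lambda>s. a (i, s))"
    by (rule bchoice[THEN exE])
  have a02: "a p = 0 \<or> a p = 2" for p
    using power_le[OF a, of p] reg[of p] by (auto split: if_splits)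
  \<comment> \<open>The non-minimal points that level \<open>n\<close> permits inside
    \<open>a\<close>: the value 1 is small, and truncation leads into \<open>low\<close>, so
    \<open>b\<close> is non-zero at the same level as \<open>a\<close>.\<close>
  define b where "b p = (if a p = 2 \<and> snd p \<in> low (n (fst p)) then 1 else 0 :: nat)" for p
  have b: "b \<in> univ (power_struct I)"
  proof (rule power_univI)
    fix i assume i: "i \<in> I"
    have "sect (n i) (\<lambda>s. b (i, s))"
      unfolding sect_def
    proof (intro allI conjI)
      fix s
      show "b (i, s) \<le> 2"
        by (simp add: b_def)
      have "a (i, s) = 2 \<longleftrightarrow> a (i, trunc (n i) s) = 2"
        using sect_eq[OF bspec[OF n i], of s] by (simp add: mn3_def)
      then show "b (i, s) = (if s \<in> low (n i) then b (i, trunc (n i) s) else mn3 (b (i, trunc (n i) s)))"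
        using trunc_low[of "n i" s] by (simp add: b_def mn3_def)
    qed
    then show "\<exists>n. sect n (\<lambda>s. b (i, s))" by blast
  qed (use power_outside[OF a] in \<open>simp add: b_def\<close>)
  obtain i s where i: "i \<in> I" "a (i, s) \<noteq> 0"
    by (rule power_nonzero[OF a assms(3)])
  have "a (i, trunc (n i) s) \<noteq> 0"
    using sect_eq[OF bspec[OF n i(1)], of s] i(2) by (auto simp: mn3_def split: if_splits)
  then have "b (i, trunc (n i) s) = 1"
    using a02[of "(i, trunc (n i) s)"] trunc_low by (simp add: b_def)
  then have "b \<noteq> (\<lambda>p. 0)"
    by (metis zero_neq_one)
  moreover have "df3 (a p) (b p) = a p" "min (b p) (a p) = b p" for p
    using a02[of p] by (auto simp: b_def df3_def)
  ultimately show thesis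
    using that b by blast
qed

text \<open>
  At each index, coordinate \<open>n\<close> is still free, where \<open>n\<close> is a level at which the three given elements
  are determined. Its values 0 and 1 may carry non-minimal points, hence are distributed as \<open>b1\<close> and
  \<open>b2\<close> require; its values 2 and 3 carry minimal points only and make both parts non-zero.
\<close>

lemma power_S5:
  assumes a: "a \<in> univ (power_struct I)" and b: "b1 \<in> univ (power_struct I)" "b2 \<in> univ (power_struct I)"
    and nz: "a \<noteq> (\<lambda>p. 0)"
    and small: "\<And>p. b1 p \<noteq> 0 \<or> b2 p \<noteq> 0 \<Longrightarrow> a p = 2 \<and> b1 p \<le> 1 \<and> b2 p \<le> 1 \<and> (b1 p = 0 \<or> b2 p = 0)"
  obtains a1 a2 where "a1 \<in> univ (power_struct I)" "a2 \<in> univ (power_struct I)"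
    "a1 \<noteq> (\<lambda>p. 0)" "a2 \<noteq> (\<lambda>p. 0)"
    "\<forall>p. a1 p = a p \<and> a2 p = 0 \<and> b2 p = 0 \<or> a1 p = 0 \<and> a2 p = a p \<and> b1 p = 0"
proof -
  have "\<forall>i\<in>I. \<exists>n. sect n (\<lambda>s. a (i, s)) \<and> sect n (\<lambda>s. b1 (i, s)) \<and> sect n (\<lambda>s. b2 (i, s))"
  proof
    fix i assume i: "i \<in> I"
    obtain l m n where "sect l (\<lambda>s. a (i, s))" "sect m (\<lambda>s. b1 (i, s))" "sect n (\<lambda>s. b2 (i, s))"
      using power_sect[OF a i] power_sect[OF b(1) i] power_sect[OF b(2) i] by blast
    then show "\<exists>n. sect n (\<lambda>s. a (i, s)) \<and> sect n (\<lambda>s. b1 (i, s)) \<and> sect n (\<lambda>s. b2 (i, s))"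
      by (intro exI[of _ "l + m + n"]) (auto intro: sect_mono)
  qed
  then obtain n where n: "\<forall>i\<in>I. sect (n i) (\<lambda>s. a (i, s)) \<and> sect (n i) (\<lambda>s. b1 (i, s)) \<and>
      sect (n i) (\<lambda>s. b2 (i, s))"
    by (rule bchoice[THEN exE])
  have na: "sect (n i) (\<lambda>s. a (i, s))" and nb1: "sect (n i) (\<lambda>s. b1 (i, s))"
    and nb2: "sect (n i) (\<lambda>s. b2 (i, s))" if "i \<in> I" for i
    using n that by blast+
  \<comment> \<open>Where the truncated point gives \<open>a\<close> the value 1, \<open>b1\<close>
    and \<open>b2\<close> vanish by \<open>small\<close>, and the digits 0 and 1, both still in
    \<open>low\<close>, go to different parts. Elsewhere the digits below 2 follow
    \<open>b2\<close>, and 2 is separated from 3.\<close>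
  define P where "P i s \<longleftrightarrow> (if a (i, trunc (n i) s) = 1 then s (n i) = 0
    else s (n i) < 2 \<and> b2 (i, trunc (n i) s) = 0 \<or> s (n i) = 2)" for i s
  define a1 where "a1 p = (if P (fst p) (snd p) then a p else 0)" for p
  define a2 where "a2 p = (if \<not> P (fst p) (snd p) then a p else 0)" for p
  have P_trunc: "P i s \<longleftrightarrow> P i (trunc (Suc (n i)) s)" for i s
    unfolding P_def by (simp add: trunc_trunc) (simp add: trunc_def)
  have aS: "sect (Suc (n i)) (\<lambda>s. a (i, s))" if "i \<in> I" for i
    using sect_mono[OF na[OF that]] by simp
  have a1: "a1 \<in> univ (power_struct I)"
  proof (rule power_univI)
    fix i assume i: "i \<in> I"
    show "\<exists>n. sect n (\<lambda>s. a1 (i, s))"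
      using sect_restrict[OF aS[OF i], of "P i", OF P_trunc] unfolding a1_def fst_conv snd_conv by blast
  qed (use power_outside[OF a] in \<open>simp add: a1_def\<close>)
  have a2: "a2 \<in> univ (power_struct I)"
  proof (rule power_univI)
    fix i assume i: "i \<in> I"
    have "\<not> P i s \<longleftrightarrow> \<not> P i (trunc (Suc (n i)) s)" for s
      using P_trunc by blast
    from sect_restrict[OF aS[OF i], of "\<lambda>s. \<not> P i s", OF this]
    show "\<exists>n. sect n (\<lambda>s. a2 (i, s))"
      unfolding a2_def fst_conv snd_conv by blast
  qed (use power_outside[OF a] in \<open>simp add: a2_def\<close>)
  obtain i s where i: "i \<in> I" "a (i, s) \<noteq> 0"
    by (rule power_nonzero[OF a nz])
  define t where "t = trunc (n i) s"
  have tt: "trunc (n i) (t(n i := v)) = t" for v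
    by (simp add: t_def trunc_upd)
  have at: "a (i, t) \<noteq> 0"
    using sect_eq[OF na[OF i(1)], of s] i(2) by (auto simp: t_def mn3_def split: if_splits)
  have at2: "a (i, t) \<le> 2"
    using sect_le[OF na[OF i(1)], of t] .
  have av: "a (i, t(n i := v)) = (if t(n i := v) \<in> low (n i) then a (i, t) else mn3 (a (i, t)))" for v
    using sect_eq[OF na[OF i(1)], of "t(n i := v)"] unfolding tt .
  have low: "t(n i := v) \<in> low (n i)" if "v < 2" for v
    using that trunc_low[of "n i" s] by (simp add: low_def t_def)
  have "(\<exists>v. P i (t(n i := v)) \<and> a (i, t(n i := v)) \<noteq> 0) \<and>
    (\<exists>v. \<not> P i (t(n i := v)) \<and> a (i, t(n i := v)) \<noteq> 0)"
  proof (cases "a (i, t) = 1")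
    case True
    then have "P i (t(n i := 0))" "\<not> P i (t(n i := 1))"
      by (simp_all add: P_def tt)
    moreover have "a (i, t(n i := 0)) \<noteq> 0" "a (i, t(n i := 1)) \<noteq> 0"
      using True low[of 0] low[of 1] av[of 0] av[of 1] by simp_all
    ultimately show ?thesis by blast
  next
    case False
    with at at2 have "a (i, t) = 2" by linarith
    then have "a (i, t(n i := v)) \<noteq> 0" for v
      using av[of v] by (simp add: mn3_def)
    moreover have "P i (t(n i := 2))" "\<not> P i (t(n i := 3))"
      using False by (simp_all add: P_def tt)
    ultimately show ?thesis by blast
  qed
  then obtain v w where "P i (t(n i := v))" "a (i, t(n i := v)) \<noteq> 0"
    "\<not> P i (t(n i := w))" "a (i, t(n i := w)) \<noteq> 0"
    by blast
  then have "a1 (i, t(n i := v)) \<noteq> 0" "a2 (i, t(n i := w)) \<noteq> 0"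
    by (simp_all add: a1_def a2_def)
  then have nz12: "a1 \<noteq> (\<lambda>p. 0)" "a2 \<noteq> (\<lambda>p. 0)"
    by metis+
  \<comment> \<open>A non-zero value of \<open>b2\<close> is 1, which forces \<open>r\<close> into
    \<open>low (n j)\<close>: the digit at \<open>n j\<close> is below 2 and \<open>b2\<close> is
    non-zero at the truncation, so the point is assigned to \<open>a2\<close>. The argument for
    \<open>b1\<close> is analogous.\<close>
  have b2P: "b2 (j, r) = 0" if P: "P j r" for j r
  proof (rule ccontr)
    assume nz: "b2 (j, r) \<noteq> 0"
    then have j: "j \<in> I"
      using power_outside[OF b(2), of j r] by (cases "j \<in> I") simp_all
    have "b2 (j, r) \<le> 1"
      using small[of "(j, r)"] nz by simp
    then have r: "r \<in> low (n j)" "b2 (j, trunc (n j) r) \<noteq> 0"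
      using sect_eq[OF nb2[OF j], of r] nz by (auto simp: mn3_def split: if_splits)
    have "r (n j) < 2"
      using r(1) by (simp add: low_def)
    moreover have "a (j, trunc (n j) r) = 2"
      using small[of "(j, trunc (n j) r)"] r(2) by simp
    ultimately show False
      using P r(2) by (simp add: P_def)
  qed
  have b1P: "b1 (j, r) = 0" if P: "\<not> P j r" for j r
  proof (rule ccontr)
    assume nz: "b1 (j, r) \<noteq> 0"
    then have j: "j \<in> I"
      using power_outside[OF b(1), of j r] by (cases "j \<in> I") simp_all
    have "b1 (j, r) \<le> 1"
      using small[of "(j, r)"] nz by simp
    then have r: "r \<in> low (n j)" "b1 (j, trunc (n j) r) \<noteq> 0"
      using sect_eq[OF nb1[OF j], of r] nz by (auto simp: mn3_def split: if_splits)
    have "r (n j) < 2"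
      using r(1) by (simp add: low_def)
    moreover have "a (j, trunc (n j) r) = 2 \<and> b2 (j, trunc (n j) r) = 0"
      using small[of "(j, trunc (n j) r)"] r(2) by simp
    ultimately show False
      using P by (simp add: P_def)
  qed
  show thesis
  proof (rule that[OF a1 a2 nz12], rule allI)
    fix p
    show "a1 p = a p \<and> a2 p = 0 \<and> b2 p = 0 \<or> a1 p = 0 \<and> a2 p = a p \<and> b1 p = 0"
      using b2P[of "fst p" "snd p"] b1P[of "fst p" "snd p"] by (simp add: a1_def a2_def)
  qed
qed

lemma power_V5_dense: "V5_dense (power_struct I)"
proof -
  interpret V5_algebra "power_struct I"
    by (rule power_V5_algebra)
  show ?thesis
  proof
    fix a assume a: "a \<in> univ (power_struct I)" "a = reg a" "a \<noteq> zero (power_struct I)"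
    have eq: "a p = df3 (if fst p \<in> I then 2 else 0) (df3 (if fst p \<in> I then 2 else 0) (a p))" for p
      using fun_cong[OF a(2), of p] by (simp add: power_struct_simps)
    have "a p \<noteq> 1" for p
      by (subst eq) (simp add: df3_def)
    moreover have "a \<noteq> (\<lambda>p. 0)"
      using a(3) by (simp add: power_struct_simps)
    ultimately obtain b where "b \<in> univ (power_struct I)" "b \<noteq> (\<lambda>p. 0)"
      "\<And>p. df3 (a p) (b p) = a p" "\<And>p. min (b p) (a p) = b p"
      using power_D5[OF a(1)] by metis
    then show "\<exists>b\<in>univ (power_struct I). b \<noteq> zero (power_struct I) \<and>
        diff (power_struct I) a b = a \<and> meet (power_struct I) b a = b"
      by (intro bexI[of _ b]) (simp_all add: power_struct_simps)
  next
    fix a b1 b2 assume ab: "a \<in> univ (power_struct I)" "b1 \<in> univ (power_struct I)"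
      "b2 \<in> univ (power_struct I)"
      and h: "diff (power_struct I) a (join (power_struct I) b1 b2) = a"
        "meet (power_struct I) (join (power_struct I) b1 b2) a = join (power_struct I) b1 b2"
        "a \<noteq> zero (power_struct I)"
        "meet (power_struct I) (meet (power_struct I) b1 b2) (reg a) = zero (power_struct I)"
    have small: "a p = 2 \<and> b1 p \<le> 1 \<and> b2 p \<le> 1 \<and> (b1 p = 0 \<or> b2 p = 0)"
      if "b1 p \<noteq> 0 \<or> b2 p \<noteq> 0" for p
    proof -
      have "df3 (a p) (max (b1 p) (b2 p)) = a p" "min (max (b1 p) (b2 p)) (a p) = max (b1 p) (b2 p)"
        "min (min (b1 p) (b2 p)) (df3 (if fst p \<in> I then 2 else 0)
          (df3 (if fst p \<in> I then 2 else 0) (a p))) = 0"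
        using fun_cong[OF h(1), of p] fun_cong[OF h(2), of p] fun_cong[OF h(4), of p]
        by (simp_all add: power_struct_simps)
      then show ?thesis
        using that power_le[OF ab(1), of p] power_le[OF ab(2), of p] power_le[OF ab(3), of p]
        by (auto simp: df3_def max_def min_def split: if_splits)
    qed
    have nz: "a \<noteq> (\<lambda>p. 0)"
      using h(3) by (simp add: power_struct_simps)
    obtain a1 a2 where a12: "a1 \<in> univ (power_struct I)" "a2 \<in> univ (power_struct I)"
      "a1 \<noteq> (\<lambda>p. 0)" "a2 \<noteq> (\<lambda>p. 0)"
      "\<forall>p. a1 p = a p \<and> a2 p = 0 \<and> b2 p = 0 \<or> a1 p = 0 \<and> a2 p = a p \<and> b1 p = 0"
      by (rule power_S5[OF ab nz small])
    have "df3 (a p) (a2 p) = a1 p \<and> min (b1 p) (a1 p) = b1 p \<and> df3 (a p) (a1 p) = a2 p \<and>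
      min (b2 p) (a2 p) = b2 p \<and> min (a1 p) (a2 p) = min (b1 p) (b2 p)" for p
      using spec[OF a12(5), of p] small[of p]
      by (cases "b1 p = 0"; cases "b2 p = 0") (auto simp: df3_def)
    with a12(1-4) show "\<exists>a1\<in>univ (power_struct I). \<exists>a2\<in>univ (power_struct I).
        a1 \<noteq> zero (power_struct I) \<and> a2 \<noteq> zero (power_struct I) \<and>
        diff (power_struct I) a a2 = a1 \<and> meet (power_struct I) b1 a1 = b1 \<and>
        diff (power_struct I) a a1 = a2 \<and> meet (power_struct I) b2 a2 = b2 \<and>
        meet (power_struct I) a1 a2 = meet (power_struct I) b1 b2"
      by (intro bexI[of _ a1] bexI[of _ a2]) (simp_all add: power_struct_simps)
  qed
qed

section \<open>Representation by characters and the model completion\<close>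

lemma power_embedding:
  assumes M: "V5_algebra M"
  defines "f \<equiv> \<lambda>x p. if fst p \<in> chars M then if snd p \<in> low 0 then fst p x else mn3 (fst p x) else 0"
  shows "embedding f M (power_struct (chars M))"
proof -
  interpret V5_algebra M by (fact M)
  \<comment> \<open>At each point the map evaluates a character, \<open>\<chi>\<close> itself or its
    minimal version, hence it is a homomorphism; the image has level 0.\<close>
  have f_char: "\<exists>\<chi>'\<in>chars M. \<forall>x. f x (\<chi>, s) = \<chi>' x" if "\<chi> \<in> chars M" for \<chi> s
    using chars_mn[OF that] that by (cases "s \<in> low 0") (auto simp: f_def)
  have f_out: "f x (\<chi>, s) = 0" if "\<chi> \<notin> chars M" for x \<chi> s
    using that by (simp add: f_def)
  have "f x \<in> univ (power_struct (chars M))" if x: "x \<in> univ M" for x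
  proof (rule power_univI)
    fix \<chi> assume \<chi>: "\<chi> \<in> chars M"
    have "sect 0 (\<lambda>s. f x (\<chi>, s))"
      unfolding sect_def using char_le[OF \<chi> x] \<chi> trunc_low by (simp add: f_def mn3_def)
    then show "\<exists>n. sect n (\<lambda>s. f x (\<chi>, s))" by blast
  qed (simp add: f_def)
  moreover have "inj_on f (univ M)"
  proof (rule inj_onI)
    fix x y assume xy: "x \<in> univ M" "y \<in> univ M" "f x = f y"
    show "x = y"
    proof (rule eq_if_chars[OF xy(1,2)])
      fix \<chi> assume "\<chi> \<in> chars M"
      then show "\<chi> x = \<chi> y"
        using fun_cong[OF xy(3), of "(\<chi>, \<lambda>_. 0)"] by (simp add: f_def low_def)
    qed
  qed
  moreover have "f (zero M) = zero (power_struct (chars M))" "f (one M) = one (power_struct (chars M))"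
    by (auto simp: fun_eq_iff f_def power_struct_simps char_zero char_one mn3_def)
  moreover have "f (join M x y) = join (power_struct (chars M)) (f x) (f y)"
    "f (meet M x y) = meet (power_struct (chars M)) (f x) (f y)"
    "f (diff M x y) = diff (power_struct (chars M)) (f x) (f y)"
    if xy: "x \<in> univ M" "y \<in> univ M" for x y
  proof -
    have "f (join M x y) (\<chi>, s) = max (f x (\<chi>, s)) (f y (\<chi>, s)) \<and>
      f (meet M x y) (\<chi>, s) = min (f x (\<chi>, s)) (f y (\<chi>, s)) \<and>
      f (diff M x y) (\<chi>, s) = df3 (f x (\<chi>, s)) (f y (\<chi>, s))" for \<chi> s
    proof (cases "\<chi> \<in> chars M")
      case True
      then obtain \<chi>' where \<chi>': "\<chi>' \<in> chars M" "\<forall>x. f x (\<chi>, s) = \<chi>' x"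
        using f_char by blast
      show ?thesis
        unfolding \<chi>'(2)[rule_format] using \<chi>'(1) xy by (simp add: char_simps)
    next
      case False
      then show ?thesis by (simp add: f_out df3_def)
    qed
    then show "f (join M x y) = join (power_struct (chars M)) (f x) (f y)"
      "f (meet M x y) = meet (power_struct (chars M)) (f x) (f y)"
      "f (diff M x y) = diff (power_struct (chars M)) (f x) (f y)"
      unfolding power_struct_simps fun_eq_iff split_paired_All by simp_all
  qed
  ultimately show ?thesis
    by (auto simp: embedding_def)
qed

text \<open>The power may exceed the type \<open>'u\<close>, but the image of \<open>M\<close> does
  not, so a dense submodel containing that image can be copied into \<open>'u\<close>.\<close>

theorem V5_dense_extension:
  fixes M :: "'u::infinite struct"
  assumes M: "V5_algebra M"
  obtains N :: "'u struct" and f where "V5_dense N" "embedding f M N"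
proof -
  obtain f where f: "embedding f M (power_struct (chars M))"
    using power_embedding[OF M] by blast
  then have fU: "f ` univ M \<subseteq> univ (power_struct (chars M))"
    by (simp add: embedding_def)
  have "|f ` univ M| \<le>o |univ M|"
    by (rule card_of_image)
  also have "|univ M| \<le>o |UNIV :: 'u set|"
    by (rule card_of_mono1) simp
  finally have card: "|f ` univ M| \<le>o |UNIV :: 'u set|" .
  obtain N :: "'u struct" and h where N: "V5_dense N" "embedding h N (power_struct (chars M))"
    "f ` univ M \<subseteq> h ` univ N"
    by (rule downward_loewenheim_skolem[OF power_V5_dense fU card])
  interpret N: V5_dense N by (fact N(1))
  define g where "g x = inv_into (univ N) h (f x)" for x
  have g: "g x \<in> univ N" "h (g x) = f x" if "x \<in> univ M" for x
    using that N(3) unfolding g_def by (auto intro!: inv_into_into f_inv_into_f)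
  have g_eq: "g x = y" if "x \<in> univ M" "y \<in> univ N" "f x = h y" for x y
    using N(2) that g[OF that(1)] by (auto simp: embedding_def inj_on_def)
  interpret M: V5_algebra M by (fact M)
  have "embedding g M N"
    unfolding embedding_def
  proof (intro conjI ballI)
    show "g ` univ M \<subseteq> univ N"
      using g by blast
    show "inj_on g (univ M)"
    proof (rule inj_onI)
      fix x y assume "x \<in> univ M" "y \<in> univ M" "g x = g y"
      then have "f x = f y"
        using g(2) by metis
      with f \<open>x \<in> univ M\<close> \<open>y \<in> univ M\<close> show "x = y"
        by (auto simp: embedding_def inj_on_def)
    qed
    show "g (zero M) = zero N" "g (one M) = one N"
      by (rule g_eq; use f N(2) in \<open>simp add: embedding_def\<close>)+
    fix x y assume "x \<in> univ M" "y \<in> univ M"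
    then show "g (join M x y) = join N (g x) (g y)" "g (meet M x y) = meet N (g x) (g y)"
      "g (diff M x y) = diff N (g x) (g y)"
      using f N(2) g by (auto intro!: g_eq simp: embedding_def)
  qed
  with N(1) that show thesis by blast
qed

theorem theorem8p2:
  shows "model_completion (V5 :: 'u::infinite fm set) (V5 \<union> {D5, S5})"
  unfolding model_completion_def
proof (intro conjI allI impI ballI)
  fix p :: "'u fm" assume "p \<in> V5 \<union> (V5 \<union> {D5, S5})"
  then show "sentence {} p"
    using axioms_are_sentences[of p] by blast
next
  fix p :: "'u fm" assume "p \<in> V5"
  then show "entails {} (V5 \<union> {D5, S5}) p"
    by (auto simp: entails_def model_def)
next
  fix M :: "'u struct" assume "is_model V5 M"
  then have "V5_algebra M"
    by (simp add: is_model_V5_iff)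
  then obtain N :: "'u struct" and f where "V5_dense N" "embedding f M N"
    by (rule V5_dense_extension)
  then show "\<exists>(N :: 'u struct) f. is_model (V5 \<union> {D5, S5}) N \<and> embedding f M N"
    using is_model_dense_iff[of N] by (intro exI[of _ N] exI[of _ f]) simp
next
  fix M :: "'u struct" assume "is_model V5 M"
  then have M: "V5_algebra M"
    by (simp add: is_model_V5_iff)
  then have struct: "is_struct M"
    by (rule V5_algebra.is_struct)
  show "complete_theory (univ M) (V5 \<union> {D5, S5} \<union> diagram M)"
    unfolding complete_theory_def
  proof (intro conjI allI impI)
    obtain N :: "'u struct" and f where N: "V5_dense N" and f: "embedding f M N"
      by (rule V5_dense_extension[OF M])
    then have "is_model (V5 \<union> {D5, S5}) N"
      by (simp only: is_model_dense_iff)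
    then have NT: "is_struct N" "\<forall>p\<in>V5 \<union> {D5, S5}. holds N id p"
      by (simp_all add: is_model_def model_def)
    have "holds N f p" if "p \<in> V5 \<union> {D5, S5} \<union> diagram M" for p
    proof (cases "p \<in> diagram M")
      case True
      then show ?thesis
        by (rule diagram_holds[OF struct f NT(1)])
    next
      case False
      then have p: "p \<in> V5 \<union> {D5, S5}"
        using that by blast
      then show ?thesis
        using NT(2) holds_id[OF axioms_are_sentences[OF p], of N f id] by blast
    qed
    then have "model (univ M) (V5 \<union> {D5, S5} \<union> diagram M) N f"
      using NT(1) f unfolding model_def embedding_def by blast
    then show "\<exists>(N :: 'u struct) k. model (univ M) (V5 \<union> {D5, S5} \<union> diagram M) N k"
      by blast
  next
    fix p :: "'u fm" assume p: "sentence (univ M) p"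
    let ?T = "V5 \<union> {D5, S5} \<union> diagram M"
    show "entails (univ M) ?T p \<or> entails (univ M) ?T (Neg p)"
    \<comment> \<open>By \<open>diagram_complete\<close> one model of \<open>p\<close> makes
      \<open>p\<close> true in all models; if there is none, all models satisfy
      \<open>Neg p\<close>.\<close>
    proof (cases "\<exists>(N :: 'u struct) k. model (univ M) ?T N k \<and> holds N k p")
      case True
      then show ?thesis
        using diagram_complete[OF M p] unfolding entails_def by blast
    next
      case False
      have "holds N k (Neg p)" if N: "model (univ M) ?T N k" for N :: "'u struct" and k
      proof -
        have e: "range (\<lambda>_::nat. zero N) \<subseteq> univ N"
          using N by (auto simp: model_def is_struct_def)
        have fv: "fv p = {}" "fv (Neg p) = {}"
          using p by (simp_all add: sentence_def)
        have "\<not> holds N k p"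
          using False N by blast
        then show ?thesis
          using holds_sentence_iff[OF fv(1) e] holds_sentence_iff[OF fv(2) e] by simp
      qed
      then show ?thesis
        unfolding entails_def by blast
    qed
  qed
qed

end
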